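(* Let $\sigma(t)=(\lambda_h(t),\Lambda_h(t))$ be the real-analytic parametrization of the separatrix described in the context and let $a_\pm=-\tfrac12\pm\tfrac{\sqrt2}2$. Then $q(t)=\cos\big(\tfrac{\lambda_h(t)}2\big)$ satisfies $q(t)\in[a_+,1)$ for $t\in\mathbb R$, $q(0)=a_+$, and $$\dot q^2=\frac3q(q-1)^2(q+1)(q-a_-)(q-a_+).$$ Moreover, with $A=\int_0^{a_+}\frac1{1-x}\sqrt{\frac{x}{3(x+1)(a_+-x)(x-a_-)}}\,dx$ and $\Pi_A=\{|\operatorname{Im}t|<A\}$: (i) $q$ extends analytically to $\Pi_A$; (ii) $q$ has only two singularities on $\partial\Pi_A$, at $t=\pm iA$; (iii) there exists $\nu>0$ such that for $|t-iA|<\nu$ and $\arg(t-iA)\in(-\tfrac{3\pi}2,\tfrac\pi2)$, $$q(t)=-\frac{3\alpha_+}2(t-iA)^{2/3}+\mathcal O\big((t-iA)^{4/3}\big),$$ with $\alpha_+\in\mathbb C$ such that $\alpha_+^3=\tfrac12$; analogously, for $|t+iA|<\nu$ and $\arg(t+iA)\in(-\tfrac\pi2,\tfrac{3\pi}2)$, $q(t)=-\frac{3\alpha_-}2(t+iA)^{2/3}+\mathcal O((t+iA)^{4/3})$ with $\alpha_-=\overline{\alpha_+}$.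
   Context: $H_{\mathrm{pend}}(\lambda,\Lambda)=-\tfrac32\Lambda^2+V(\lambda)$ with $V(\lambda)=1-\cos\lambda-\frac1{\sqrt{2+2\cos\lambda}}$, equations $\dot\lambda=-3\Lambda$, $\dot\Lambda=-V'(\lambda)$. $\sigma(t)=(\lambda_h(t),\Lambda_h(t))$ is the solution parametrizing the homoclinic orbit to the saddle $(0,0)$ with $\lambda\in(0,\pi)$ (energy level $H_{\mathrm{pend}}=-\tfrac12$), normalized by $\sigma(0)=(\lambda_0,0)$ with $\lambda_0\in(\tfrac23\pi,\pi)$. *)

theory Defs
  imports "HOL-Complex_Analysis.Complex_Analysis"
begin

definition V_pend :: "real \<Rightarrow> real" where
  "V_pend l = 1 - cos l - 1 / sqrt (2 + 2 * cos l)"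

definition H_pend :: "real \<Rightarrow> real \<Rightarrow> real" where
  "H_pend l L = - (3/2) * L\<^sup>2 + V_pend l"

definition a_plus :: real where "a_plus = - 1/2 + sqrt 2 / 2"
definition a_minus :: real where "a_minus = - 1/2 - sqrt 2 / 2"

definition A_width :: real where
  "A_width = integral {0..a_plus}
     (\<lambda>x. (1 / (1 - x)) * sqrt (x / (3 * (x + 1) * (a_plus - x) * (x - a_minus))))"

definition strip_PiA :: "complex set" where
  "strip_PiA = {z. \<bar>Im z\<bar> < A_width}"

definition sector_disc :: "complex \<Rightarrow> real \<Rightarrow> real \<Rightarrow> real \<Rightarrow> complex set" where
  "sector_disc z0 nu th0 th1 =
     {z0 + complex_of_real r * cis th | r th. 0 < r \<and> r < nu \<and> th0 < th \<and> th < th1}"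

end

(* Write q = v/(1+v) and v = s^2 + v_plus, where q = a_plus corresponds to s = 0. In these coordinates
   the separatrix equation becomes dt/ds = G(s) with G = 1/csqrt(Y), and Re G > 0 on the plane slit along
   {i y : |y| >= y_top}, where s = i y_top corresponds to q = 0. Its primitive P is therefore injective on
   the right half plane (Noshiro-Warschawski), and it maps the segment between the two branch points onto
   i(-A, A). The image of the sector |arg v| < 2 pi/3 contains {Re t > 0, |Im t| <= A}: along the boundary
   rays the modulus of Im P exceeds A, and Re P grows logarithmically at infinity, so the image is
   relatively open and closed there. Since P is odd, it has an inverse near the closed strip without its
   two singular points, and q(t) is a rational function of that inverse.
   Near the branch point, in the coordinate w = csqrt(v), t - iA = -i k(w)^3 with k(w) = kap w + O(w^5),
   whence v = w^2 behaves like (t - iA)^(2/3). *)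
theory Submission
  imports Defs
begin

section \<open>Time as a holomorphic function of the coordinate s\<close>

text \<open>The difficulty is global: q solves a first-order equation with a multivalued right-hand
  side, and no other singularity may lie in the closed strip. Inverting one univalent primitive
  replaces analytic continuation of solutions along paths. The choice v = q/(1-q) sends the saddle q
  = 1 to infinity, and s = sqrt(v - v_plus) resolves the turning point, so that t = 0 is a regular
  point and both halves of the orbit lie on one real line. The remaining zeros q = -1, a_plus,
  a_minus become the roots of 14 v^3 + 11 v^2 - 1. The missing linear term of this cubic is used
  twice. On each of the rays arg v = 2 pi/3 and -2 pi/3 its imaginary part has a fixed sign, which
  is why the sector ends there. With v = w^2 its negative starts 1 - 11 w^4, so time at the branch
  point is a pure cube up to relative order w^4. The error (t - iA)^(4/3) in q therefore stems from
  v/(1+v) = v - v^2 + ..., not from the inversion of P.\<close>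

definition v_plus :: real where "v_plus = (2 * sqrt 2 - 1) / 7"
text \<open>\<open>v_plus\<close> and \<open>v_minus\<close> are the images of \<open>a_plus\<close>
  and \<open>a_minus\<close> under q -> q/(1-q); q = -1 goes to -1/2, and q = infinity to
  -1.\<close>

definition v_minus :: real where "v_minus = - (1 + 2 * sqrt 2) / 7"

lemma sqrt2_bounds: "7/5 < sqrt 2" "sqrt 2 < 3/2"
  by (rule real_less_rsqrt; simp add: power2_eq_square) (rule real_less_lsqrt; simp add: power2_eq_square)

lemma v_plus_bounds: "1/4 < v_plus" "v_plus < 1/2"
  using sqrt2_bounds by (auto simp: v_plus_def)

lemma v_minus_bounds: "v_minus < -1/2" "-1 < v_minus"
  using sqrt2_bounds by (auto simp: v_minus_def)

lemma v_roots: "(v - of_real v_plus) * (v - of_real v_minus) = v\<^sup>2 + 2 * v / 7 - (1/7 :: complex)"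
proof -
  have "v_plus * v_minus = -1/7" "v_plus + v_minus = -2/7"
    by (auto simp: v_plus_def v_minus_def field_simps)
  hence "complex_of_real v_plus * of_real v_minus = of_real (-1/7)" 
    "complex_of_real v_plus + of_real v_minus = of_real (-2/7)"
    by (metis of_real_mult, metis of_real_add)
  thus ?thesis by (simp add: power2_eq_square) algebra
qed

definition y_top :: real where "y_top = sqrt v_plus"

lemma y_top_pos: "0 < y_top" and y_top_sq: "y_top\<^sup>2 = v_plus"
  using v_plus_bounds by (auto simp: y_top_def)

definition vmap :: "complex \<Rightarrow> complex" where "vmap s = s\<^sup>2 + of_real v_plus"

text \<open>Along the separatrix (ds/dt)^2 = Y(v). The factor v - v_plus of the cubic has been
  absorbed by s; the pole v = 0 is the singularity q = 0.\<close>

definition Yfun :: "complex \<Rightarrow> complex" where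
  "Yfun v = 21/8 * ((v + 1/2) * (v - of_real v_minus) / v)"

definition Gfun :: "complex \<Rightarrow> complex" where "Gfun s = 1 / csqrt (Yfun (vmap s))"

definition Sig :: "complex set" where "Sig = {s. Re s = 0 \<longrightarrow> \<bar>Im s\<bar> < y_top}"

text \<open>Im v = 2 Re s Im s, so v is real only on the two axes, and on the real axis it is at
  least \<open>v_plus\<close>. The slits are thus the preimage of the cut, which also contains the
  other critical values -1/2, \<open>v_minus\<close> and -1.\<close>

lemma Sig_iff: "s \<in> Sig \<longleftrightarrow> vmap s \<notin> \<real>\<^sub>\<le>\<^sub>0"
proof -
  have re: "Re (vmap s) = (Re s)\<^sup>2 - (Im s)\<^sup>2 + y_top\<^sup>2" and im: "Im (vmap s) = 2 * Re s * Im s"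
    using y_top_sq by (simp_all add: vmap_def power2_eq_square)
  show ?thesis
  proof (cases "Re s = 0")
    case True
    have "\<bar>Im s\<bar> < y_top \<longleftrightarrow> (Im s)\<^sup>2 < y_top\<^sup>2"
      using y_top_pos abs_le_square_iff[of y_top "Im s"] by linarith
    thus ?thesis using True by (auto simp: Sig_def complex_nonpos_Reals_iff re im)
  next
    case False
    have "y_top\<^sup>2 > 0" "(Re s)\<^sup>2 > 0" using y_top_pos False by auto
    hence "\<not> (Re s)\<^sup>2 + y_top\<^sup>2 \<le> 0" by linarith
    thus ?thesis using False by (auto simp: Sig_def complex_nonpos_Reals_iff re im)
  qed
qed

lemma open_Sig: "open Sig"
proof -
  have "Sig = vmap -` (- \<real>\<^sub>\<le>\<^sub>0)" using Sig_iff by auto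
  moreover have "open (vmap -` (- \<real>\<^sub>\<le>\<^sub>0))"
    unfolding vmap_def[abs_def] by (intro open_vimage continuous_intros) (simp add: open_Compl)
  ultimately show ?thesis by simp
qed

lemma closed_segment_0_Sig: "s \<in> Sig \<Longrightarrow> closed_segment 0 s \<subseteq> Sig"
proof
  fix x assume s: "s \<in> Sig" and "x \<in> closed_segment 0 s"
  then obtain u where u: "0 \<le> u" "u \<le> 1" "x = of_real u * s"
    by (auto simp: closed_segment_def scaleR_conv_of_real)
  show "x \<in> Sig" unfolding Sig_def
  proof (clarify)
    assume "Re x = 0"
    hence "u = 0 \<or> Re s = 0" using u by auto
    thus "\<bar>Im x\<bar> < y_top"
    proof
      assume "Re s = 0" hence "\<bar>Im s\<bar> < y_top" using s by (auto simp: Sig_def)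
      moreover have "u * \<bar>Im s\<bar> \<le> \<bar>Im s\<bar>" using u by (simp add: mult_left_le_one_le)
      ultimately show ?thesis using u by (simp add: abs_mult)
    qed (use u y_top_pos in auto)
  qed
qed

lemma zero_in_Sig: "0 \<in> Sig" using y_top_pos by (auto simp: Sig_def)

lemma starlike_Sig: "starlike Sig"
  using closed_segment_0_Sig zero_in_Sig by (auto simp: starlike_def)

lemma connected_Sig: "connected Sig"
  by (rule starlike_imp_connected[OF starlike_Sig])

text \<open>Up to a positive factor Y is v + (1/2 + m) + (m/2)/v with m = -v_minus, a Joukowski-type
  map. If v is not real, a real value forces |v|^2 = m/2, and then the value is 2 Re v + 1/2 + m.
  Here |2 Re v| < sqrt(2 m) <= 1/2 + m by the inequality of arithmetic and geometric means, so it is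
  positive. This yields Re G > 0.\<close>

lemma Yfun_nonpos_Reals:
  assumes "v \<notin> \<real>\<^sub>\<le>\<^sub>0" shows "Yfun v \<notin> \<real>\<^sub>\<le>\<^sub>0"
proof
  assume Y: "Yfun v \<in> \<real>\<^sub>\<le>\<^sub>0"
  define x y where "x = Re v" "y = Im v"
  define m where "m = - v_minus"
  have m: "1/2 < m" using v_minus_bounds by (simp add: m_def)
  have v: "v = Complex x y" by (simp add: x_y_def)
  have nz: "v \<noteq> 0" using assms by auto
  define N where "N = x\<^sup>2 + y\<^sup>2"
  have N: "N > 0" using nz unfolding N_def v by (auto simp: Complex_eq_0 sum_power2_gt_zero_iff complex_eq_iff)
  have eq: "(v + 1/2) * (v - of_real v_minus) / v = v + of_real (1/2 + m) + of_real (m/2) * inverse v"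
    using nz by (simp add: m_def field_simps)
  have inv: "inverse v = Complex (x / N) (- y / N)"
    by (simp add: v N_def complex_inverse)
  have re: "Re (Yfun v) = 21/8 * (x + 1/2 + m + m/2 * (x/N))"
   and im: "Im (Yfun v) = 21/8 * (y - m/2 * (y/N))"
    unfolding Yfun_def eq inv by (simp_all add: v)
  have im0: "y - m/2 * (y/N) = 0" and re0: "x + 1/2 + m + m/2 * (x/N) \<le> 0"
    using Y re im by (auto simp: complex_nonpos_Reals_iff)
  show False
  proof (cases "y = 0")
    case True
    hence "x > 0" using assms by (auto simp: complex_nonpos_Reals_iff v not_le)
    hence "0 < m/2 * (x/N)" using m N by simp
    thus False using re0 m \<open>x > 0\<close> by linarith
  next
    case False
    have "y * (1 - m/2/N) = 0" using im0 by (simp add: algebra_simps)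
    hence "m/2/N = 1" using False by simp
    hence NN: "N = m/2" using N by (simp add: field_simps)
    moreover have "m/2 * (x/N) = x" unfolding NN using m by simp
    ultimately have "2 * x + 1/2 + m \<le> 0" using re0 by linarith
    moreover have "y\<^sup>2 > 0" using False by simp
    moreover have "(2*x)\<^sup>2 = 4 * x\<^sup>2" by (simp add: power_mult_distrib)
    hence "(2*x)\<^sup>2 < 2 * m" using NN N_def \<open>y\<^sup>2 > 0\<close> by linarith
    moreover have "(1/2+m)\<^sup>2 \<ge> 2 * m" using zero_le_power2[of "1/2 - m"] by (simp add: power2_eq_square algebra_simps)
    ultimately have "(2*x)\<^sup>2 < (1/2+m)\<^sup>2" by linarith
    hence "\<bar>2*x\<bar> < 1/2 + m" using m abs_le_square_iff[of "1/2 + m" "2*x"] by linarith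
    thus False using \<open>2 * x + 1/2 + m \<le> 0\<close> by linarith
  qed
qed

lemma Re_csqrt_pos: "z \<notin> \<real>\<^sub>\<le>\<^sub>0 \<Longrightarrow> 0 < Re (csqrt z)"
proof (rule ccontr)
  assume z: "z \<notin> \<real>\<^sub>\<le>\<^sub>0" and "\<not> 0 < Re (csqrt z)"
  hence "Re (csqrt z) = 0" using Re_csqrt[of z] by linarith
  hence "Re ((csqrt z)\<^sup>2) \<le> 0" "Im ((csqrt z)\<^sup>2) = 0" 
    by (simp_all add: power2_eq_square del: power2_csqrt)
  thus False using z by (simp add: complex_nonpos_Reals_iff)
qed

lemma Gfun_nz: "s \<in> Sig \<Longrightarrow> Gfun s \<noteq> 0"
  using Yfun_nonpos_Reals Sig_iff by (force simp: Gfun_def)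

lemma Re_inverse_pos: "0 < Re z \<Longrightarrow> 0 < Re (inverse z)"
  by (simp add: sum_power2_gt_zero_iff)

lemma Re_Gfun_pos: "s \<in> Sig \<Longrightarrow> 0 < Re (Gfun s)"
  using Re_inverse_pos[OF Re_csqrt_pos[OF Yfun_nonpos_Reals]] Sig_iff by (metis Gfun_def inverse_eq_divide)

lemma holomorphic_Gfun: "Gfun holomorphic_on Sig"
proof -
  have v: "\<And>s. s \<in> Sig \<Longrightarrow> vmap s \<noteq> 0" using Sig_iff by auto
  have Y: "\<And>s. s \<in> Sig \<Longrightarrow> Yfun (vmap s) \<notin> \<real>\<^sub>\<le>\<^sub>0" using Sig_iff Yfun_nonpos_Reals by auto
  have "vmap holomorphic_on Sig" unfolding vmap_def[abs_def] by (intro holomorphic_intros)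
  hence "(\<lambda>s. Yfun (vmap s)) holomorphic_on Sig"
    unfolding Yfun_def using v by (intro holomorphic_intros) auto
  hence "(\<lambda>s. 1 / csqrt (Yfun (vmap s))) holomorphic_on Sig"
    using Y by (intro holomorphic_intros) force+
  thus ?thesis by (simp add: Gfun_def[abs_def])
qed

lemma Gfun_minus: "Gfun (- s) = Gfun s"
  by (simp add: Gfun_def vmap_def)

lemma vmap_cnj: "vmap (cnj s) = cnj (vmap s)" by (simp add: vmap_def)
lemma Yfun_cnj: "Yfun (cnj v) = cnj (Yfun v)" by (simp add: Yfun_def)

lemma Sig_cnj [simp]: "cnj s \<in> Sig \<longleftrightarrow> s \<in> Sig"
  and Sig_minus [simp]: "- s \<in> Sig \<longleftrightarrow> s \<in> Sig" by (simp_all add: Sig_def)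

lemma Gfun_cnj: "s \<in> Sig \<Longrightarrow> Gfun (cnj s) = cnj (Gfun s)"
  using Sig_iff Yfun_nonpos_Reals by (simp add: Gfun_def vmap_cnj Yfun_cnj cnj_csqrt)

text \<open>Complex time as a function of s, with the turning point s = 0 at time 0.\<close>

definition Pfun :: "complex \<Rightarrow> complex" where
  "Pfun = (SOME f. f 0 = 0 \<and> (\<forall>s\<in>Sig. (f has_field_derivative Gfun s) (at s)))"

lemma Pfun_0: "Pfun 0 = 0"
  and Pfun_deriv: "s \<in> Sig \<Longrightarrow> (Pfun has_field_derivative Gfun s) (at s)"
proof -
  have "\<exists>g. \<forall>x\<in>Sig. (g has_field_derivative Gfun x) (at x)"
    using holomorphic_Gfun open_Sig starlike_Sig
    by (intro holomorphic_starlike_primitive[where k = "{}"])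
       (auto simp: holomorphic_on_imp_continuous_on holomorphic_on_open field_differentiable_def)
  then obtain g where g: "\<forall>x\<in>Sig. (g has_field_derivative Gfun x) (at x)" by blast
  have "\<exists>f. f 0 = 0 \<and> (\<forall>s\<in>Sig. (f has_field_derivative Gfun s) (at s))"
    by (rule exI[of _ "\<lambda>s. g s - g 0"]) (auto intro!: derivative_eq_intros g[rule_format])
  hence *: "Pfun 0 = 0 \<and> (\<forall>s\<in>Sig. (Pfun has_field_derivative Gfun s) (at s))"
    unfolding Pfun_def by (rule someI_ex)
  show "Pfun 0 = 0" using * by blast
  show "(Pfun has_field_derivative Gfun s) (at s)" if "s \<in> Sig" using * that by blast
qed

lemma holomorphic_Pfun: "Pfun holomorphic_on Sig"
  unfolding holomorphic_on_open[OF open_Sig] using Pfun_deriv by auto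

lemma isCont_Pfun: "s \<in> Sig \<Longrightarrow> isCont Pfun s"
  by (rule DERIV_isCont[OF Pfun_deriv])

text \<open>Serves for the symmetries (P is odd, P and \<open>ufun\<close> commute with conjugation)
  and for gluing P to its explicit form near the branch point.\<close>

lemma primitives_eq:
  fixes f g :: "complex \<Rightarrow> complex"
  assumes "connected S" "open S" "a \<in> S" "f a = g a" "x \<in> S"
    and "\<And>z. z \<in> S \<Longrightarrow> (f has_field_derivative h z) (at z)"
    and "\<And>z. z \<in> S \<Longrightarrow> (g has_field_derivative h z) (at z)"
  shows "f x = g x"
proof -
  obtain c where "\<And>x. x \<in> S \<Longrightarrow> f x - g x = c"
  proof (rule DERIV_zero_connected_constant[OF assms(1,2) finite.emptyI])
    show "continuous_on S (\<lambda>x. f x - g x)"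
      by (intro continuous_intros continuous_at_imp_continuous_on ballI;
          erule DERIV_isCont[OF assms(6)] DERIV_isCont[OF assms(7)])
    show "\<forall>x\<in>S - {}. ((\<lambda>x. f x - g x) has_field_derivative 0) (at x)"
      using DERIV_diff[OF assms(6,7)] by auto
  qed blast
  hence "f x - g x = f a - g a" using assms(3,5) by metis
  thus ?thesis using assms(4) by simp
qed

lemma Pfun_minus: assumes "s \<in> Sig" shows "Pfun (- s) = - Pfun s"
proof -
  have "- Pfun (- s) = Pfun s"
  proof (rule primitives_eq[OF connected_Sig open_Sig zero_in_Sig _ assms])
    fix z assume z: "z \<in> Sig"
    have "((\<lambda>s. Pfun (- s)) has_field_derivative Gfun (-z) * (-1)) (at z)"
      by (rule DERIV_chain2[OF Pfun_deriv]) (use z in \<open>auto intro!: derivative_eq_intros\<close>)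
    from DERIV_minus[OF this]
    show "((\<lambda>s. - Pfun (- s)) has_field_derivative Gfun z) (at z)"
      by (simp add: Gfun_minus)
  qed (auto simp: Pfun_0 Pfun_deriv)
  thus ?thesis by (metis minus_minus)
qed

lemma Pfun_cnj: assumes "s \<in> Sig" shows "Pfun (cnj s) = cnj (Pfun s)"
proof -
  have "cnj (Pfun (cnj s)) = Pfun s"
  proof (rule primitives_eq[OF connected_Sig open_Sig zero_in_Sig _ assms])
    fix z assume z: "z \<in> Sig"
    have "(Pfun has_field_derivative Gfun (cnj z)) (at (cnj z))" using z by (intro Pfun_deriv) auto
    from has_field_derivative_cnj_cnj[OF this]
    show "((\<lambda>s. cnj (Pfun (cnj s))) has_field_derivative Gfun z) (at z)"
      using z by (simp add: Gfun_cnj o_def)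
  qed (auto simp: Pfun_0 Pfun_deriv)
  thus ?thesis by (metis complex_cnj_cnj)
qed

section \<open>Sign of Re P and univalence on the right half plane\<close>

lemma Im_Pfun_real: "Im (Pfun (of_real x)) = 0" if "of_real x \<in> Sig"
  using Pfun_cnj[OF that] by (simp add: complex_eq_iff)

lemma Re_Pfun_imag: "Re (Pfun (\<i> * of_real y)) = 0" if "\<bar>y\<bar> < y_top"
proof -
  have "\<i> * of_real y \<in> Sig" using that by (auto simp: Sig_def)
  from Pfun_minus[OF this] Pfun_cnj[OF this] show ?thesis by (simp add: complex_eq_iff)
qed

text \<open>The difference quotient is the mean of f' over the segment; the proof replaces the
  integral by monotonicity of its real part along the segment. Besides univalence of P this gives
  monotonicity on the imaginary axis, and later injectivity and a sign for
  \<open>kfun\<close>.\<close>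

lemma segment_mono:
  fixes f :: "complex \<Rightarrow> complex"
  assumes "a \<noteq> b" and der: "\<And>z. z \<in> closed_segment a b \<Longrightarrow> (f has_field_derivative f' z) (at z)"
    and pos: "\<And>z. z \<in> closed_segment a b \<Longrightarrow> 0 < Re (f' z)"
  shows "0 < Re ((f b - f a) / (b - a))"
proof -
  define g where "g = (\<lambda>x::real. Re (f (a + of_real x * (b - a)) / (b - a)))"
  have "g 0 < g (1::real)"
  proof (rule DERIV_pos_imp_increasing[of 0 1 g])
    fix x :: real assume x: "0 \<le> x" "x \<le> 1"
    define z where "z = a + of_real x * (b - a)"
    have z: "z \<in> closed_segment a b"
      using x by (auto simp: closed_segment_def z_def scaleR_conv_of_real algebra_simps intro!: exI[of _ x])
    have "((\<lambda>x::real. a + of_real x * (b - a)) has_vector_derivative (b - a)) (at x)"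
      by (auto intro!: derivative_eq_intros)
    from field_vector_diff_chain_at[OF this der[OF z, unfolded z_def]]
    have "((\<lambda>x::real. f (a + of_real x * (b - a))) has_vector_derivative (b - a) * f' z) (at x)"
      by (simp add: o_def z_def)
    hence "((\<lambda>x::real. f (a + of_real x * (b - a)) / (b-a)) has_vector_derivative f' z) (at x)"
      using assms(1) by (auto dest: has_vector_derivative_divide[where a = "b - a"])
    hence "(g has_real_derivative Re (f' z)) (at x)"
      unfolding g_def has_real_derivative_iff_has_vector_derivative
      by (rule bounded_linear.has_vector_derivative[OF bounded_linear_Re])
    thus "\<exists>y. (g has_real_derivative y) (at x) \<and> 0 < y" using pos[OF z] by blast
  qed auto
  thus ?thesis by (simp add: g_def diff_divide_distrib)
qed

lemma Pfun_segment_mono: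
  assumes "a \<noteq> b" "closed_segment a b \<subseteq> Sig"
  shows "0 < Re ((Pfun b - Pfun a) / (b - a))"
  by (rule segment_mono[OF assms(1)]) (use assms(2) Pfun_deriv Re_Gfun_pos in blast)+

text \<open>Compare s with its projection to the imaginary axis, where Re P = 0. The bound on Im s
  keeps the horizontal segment between them away from the slits.\<close>

lemma Re_Pfun_sgn: assumes "\<bar>Im s\<bar> < y_top" shows "sgn (Re (Pfun s)) = sgn (Re s)"
proof (cases "Re s = 0")
  case True
  hence "s = \<i> * of_real (Im s)" by (simp add: complex_eq_iff)
  thus ?thesis using Re_Pfun_imag[OF assms] True by metis
next
  case False
  define a where "a = \<i> * of_real (Im s)"
  have d: "s - a = of_real (Re s)" by (simp add: a_def complex_eq_iff)
  have "closed_segment a s \<subseteq> Sig"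
  proof
    fix x assume "x \<in> closed_segment a s"
    then obtain u where "x = (1 - u) *\<^sub>R a + u *\<^sub>R s" by (auto simp: closed_segment_def)
    hence "Im x = (1 - u) * Im s + u * Im s" by (simp add: a_def)
    hence "Im x = Im s" by (simp add: algebra_simps)
    thus "x \<in> Sig" using assms by (auto simp: Sig_def)
  qed
  moreover have "a \<noteq> s" using False by (auto simp: a_def complex_eq_iff)
  ultimately have "0 < Re ((Pfun s - Pfun a) / (s - a))" by (intro Pfun_segment_mono)
  hence "0 < (Re (Pfun s) - Re (Pfun a)) / Re s"
    unfolding d by simp
  moreover have "Re (Pfun a) = 0" using Re_Pfun_imag[OF assms] by (simp add: a_def)
  ultimately show ?thesis by (auto simp: zero_less_divide_iff sgn_if)
qed

definition Sig_right :: "complex set" where "Sig_right = Sig \<inter> {s. 0 \<le> Re s}"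

text \<open>Beyond Re s >= 0 the only constraint concerns the line Re s = 0, and a convex
  combination of points of the closed half plane lies on that line only if every endpoint of
  positive weight does.\<close>

lemma convex_Sig_right: "convex Sig_right"
proof -
  have "Sig_right = {s. Re s > 0} \<union> {s. 0 \<le> Re s \<and> \<bar>Im s\<bar> < y_top}"
    using y_top_pos by (auto simp: Sig_right_def Sig_def)
  show ?thesis
  proof (rule convexI)
    fix a b :: complex and u v :: real
    assume a: "a \<in> Sig_right" and b: "b \<in> Sig_right" and uv: "0 \<le> u" "0 \<le> v" "u + v = 1"
    have re: "0 \<le> u * Re a" "0 \<le> v * Re b" using a b uv by (auto simp: Sig_right_def)
    have "\<bar>u * Im a + v * Im b\<bar> < y_top" if "u * Re a + v * Re b = 0"
    proof -
      have "u * Re a = 0" "v * Re b = 0" using re that by linarith+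
      hence z: "u = 0 \<or> Re a = 0" "v = 0 \<or> Re b = 0" by auto
      have "Re a = 0 \<Longrightarrow> \<bar>Im a\<bar> \<le> y_top" "Re b = 0 \<Longrightarrow> \<bar>Im b\<bar> \<le> y_top"
        using a b by (auto simp: Sig_right_def Sig_def)
      hence A: "u * \<bar>Im a\<bar> \<le> u * y_top" "v * \<bar>Im b\<bar> \<le> v * y_top"
        using z uv by (metis mult_left_mono mult_zero_left order.refl)+
      \<comment> \<open>A zero weight says nothing about its endpoint, so the bounds
        \<open>A\<close> are weak; strictness comes from an endpoint whose weight is
        positive.\<close>
      have B: "u * \<bar>Im a\<bar> < u * y_top \<or> v * \<bar>Im b\<bar> < v * y_top"
      proof (cases "u = 0")
        case True
        hence "v = 1" "Re b = 0" using uv z by auto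
        thus ?thesis using b by (auto simp: Sig_right_def Sig_def)
      next
        case False
        hence "\<bar>Im a\<bar> < y_top" "u > 0" using a uv z by (auto simp: Sig_right_def Sig_def)
        thus ?thesis by simp
      qed
      have "\<bar>u * Im a + v * Im b\<bar> \<le> u * \<bar>Im a\<bar> + v * \<bar>Im b\<bar>"
        using uv abs_triangle_ineq[of "u * Im a" "v * Im b"] by (simp add: abs_mult)
      also have "\<dots> < u * y_top + v * y_top" using A B by linarith
      also have "\<dots> = y_top" using uv by (metis distrib_right mult_1)
      finally show ?thesis .
    qed
    thus "u *\<^sub>R a + v *\<^sub>R b \<in> Sig_right" using re by (auto simp: Sig_right_def Sig_def)
  qed
qed

lemma inj_on_Pfun_right: "inj_on Pfun Sig_right"
proof (rule inj_onI, rule ccontr)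
  fix a b assume ab: "a \<in> Sig_right" "b \<in> Sig_right" "Pfun a = Pfun b" "a \<noteq> b"
  hence "closed_segment a b \<subseteq> Sig"
    using convex_Sig_right by (metis Int_lower1 Sig_right_def closed_segment_subset subset_trans)
  from Pfun_segment_mono[OF ab(4) this] ab(3) show False by simp
qed

section \<open>A cube root coordinate at the branch point\<close>

text \<open>For v = w^2 this is -14 (v - v_plus)(v + 1/2)(v - v_minus), see
  \<open>Efun_csqrt\<close>; it equals 1 at the branch point w = 0.\<close>

definition Efun :: "complex \<Rightarrow> complex" where "Efun w = 1 - 11 * w ^ 4 - 14 * w ^ 6"

lemma norm_Efun_diff:
  assumes "cmod w < 1/4" shows "cmod (Efun w - 1) \<le> 12 * cmod w ^ 4" "cmod (Efun w - 1) < 1/2"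
proof -
  have w2: "cmod w ^ 2 \<le> 1/16" using power_mono[of "cmod w" "1/4" 2] assms by (simp add: power_divide)
  hence w4: "cmod w ^ 4 \<le> 1/256" using power_mono[of "cmod w ^ 2" "1/16" 2] by (simp add: power_divide flip: power_mult)
  have "cmod (Efun w - 1) = cmod (11 * w ^ 4 + 14 * w ^ 6)"
    by (subst norm_minus_commute) (simp add: Efun_def)
  also have "\<dots> \<le> 11 * cmod w ^ 4 + 14 * cmod w ^ 6"
    by (rule order_trans[OF norm_triangle_ineq]) (simp add: norm_mult norm_power)
  also have "cmod w ^ 6 = cmod w ^ 4 * cmod w ^ 2" by (simp flip: power_add)
  also have "11 * cmod w ^ 4 + 14 * (cmod w ^ 4 * cmod w ^ 2) \<le> 11 * cmod w ^ 4 + 14 * (cmod w ^ 4 * (1/16))"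
    using w2 by (intro add_mono mult_left_mono) auto
  also have "\<dots> \<le> 12 * cmod w ^ 4" by simp
  finally show 1: "cmod (Efun w - 1) \<le> 12 * cmod w ^ 4" .
  show "cmod (Efun w - 1) < 1/2" using 1 w4 by linarith
qed

lemma Efun_cnj: "Efun (cnj w) = cnj (Efun w)" by (simp add: Efun_def)

lemma near_1_nonpos_Reals: "cmod (z - 1) < 1 \<Longrightarrow> z \<notin> \<real>\<^sub>\<le>\<^sub>0"
proof
  assume "cmod (z - 1) < 1" "z \<in> \<real>\<^sub>\<le>\<^sub>0"
  moreover have "\<bar>Re (z - 1)\<bar> \<le> cmod (z - 1)" by (rule abs_Re_le_cmod)
  ultimately show False by (auto simp: complex_nonpos_Reals_iff)
qed

lemma Efun_nonpos_Reals: "cmod w < 1/4 \<Longrightarrow> Efun w \<notin> \<real>\<^sub>\<le>\<^sub>0"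
  using norm_Efun_diff(2)[of w] by (intro near_1_nonpos_Reals) linarith

text \<open>For r = csqrt z one has Re r >= 0, hence |r + 1| >= 1, so r - 1 = (z - 1)/(r + 1) is no
  larger than z - 1. The factor 2 pays for dividing by |r| >= 1/2.\<close>

lemma norm_inverse_csqrt_diff:
  assumes "cmod (z - 1) < 1/2" shows "cmod (1 / csqrt z - 1) \<le> 2 * cmod (z - 1)"
proof -
  define r where "r = csqrt z"
  have r2: "r\<^sup>2 = z" by (simp add: r_def)
  have "0 \<le> Re r" unfolding r_def by (rule Re_csqrt)
  hence "1 \<le> Re (r + 1)" by simp
  hence r1: "1 \<le> cmod (r + 1)" using complex_Re_le_cmod[of "r + 1"] by linarith
  have "cmod (z - 1) = cmod (r - 1) * cmod (r + 1)"
    by (simp add: r2[symmetric] power2_eq_square algebra_simps flip: norm_mult)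
  hence d: "cmod (r - 1) \<le> cmod (z - 1)"
    using r1 mult_left_mono[of 1 "cmod (r+1)" "cmod (r-1)"] by simp
  have "1/2 \<le> cmod r" using d assms norm_triangle_ineq2[of 1 "1 - r"] by (simp add: norm_minus_commute)
  moreover from this have "r \<noteq> 0" by auto
  ultimately have "r \<noteq> 0" and "cmod (r - 1) / cmod r \<le> cmod (r - 1) * 2"
    using divide_left_mono[of "1/2" "cmod r" "cmod (r - 1)"] by auto
  moreover have "cmod (1 / r - 1) = cmod (r - 1) / cmod r"
    using \<open>r \<noteq> 0\<close> by (metis diff_divide_distrib divide_self norm_divide norm_minus_commute)
  ultimately have "cmod (1 / r - 1) \<le> 2 * cmod (z - 1)" using d by linarith
  thus ?thesis by (simp add: r_def)
qed

text \<open>Up to the factor -i this is dt/dw: from dt = dv / (2 s csqrt Y) and v = w^2, using 4 s^2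
  Y v = -(3/4) E(w).\<close>

definition ufun' :: "complex \<Rightarrow> complex" where
  "ufun' w = of_real (4 / sqrt 3) * w\<^sup>2 * (1 / csqrt (Efun w))"

definition ufun :: "complex \<Rightarrow> complex" where
  "ufun = (SOME f. f 0 = 0 \<and> (\<forall>w\<in>ball 0 (1/4). (f has_field_derivative ufun' w) (at w)))"

lemma ufun_0: "ufun 0 = 0"
  and ufun_deriv: "cmod w < 1/4 \<Longrightarrow> (ufun has_field_derivative ufun' w) (at w)"
proof -
  have hol: "ufun' holomorphic_on ball 0 (1/4)"
  proof -
    have "Efun holomorphic_on ball 0 (1/4)" unfolding Efun_def by (intro holomorphic_intros)
    moreover have "\<And>w. w \<in> ball 0 (1/4) \<Longrightarrow> Efun w \<notin> \<real>\<^sub>\<le>\<^sub>0" using Efun_nonpos_Reals by simp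
    ultimately show ?thesis unfolding ufun'_def[abs_def] by (intro holomorphic_intros) force+
  qed
  obtain g where g: "\<And>x. x \<in> ball 0 (1/4) \<Longrightarrow> (g has_field_derivative ufun' x) (at x within ball 0 (1/4))"
    using holomorphic_convex_primitive'[OF convex_ball open_ball hol] by blast
  have g': "(g has_field_derivative ufun' x) (at x)" if "x \<in> ball 0 (1/4)" for x
    using g[OF that] at_within_open[OF that open_ball] by simp
  have "\<exists>f. f 0 = 0 \<and> (\<forall>s\<in>ball 0 (1/4). (f has_field_derivative ufun' s) (at s))"
    by (rule exI[of _ "\<lambda>s. g s - g 0"]) (auto intro!: derivative_eq_intros g')
  hence *: "ufun 0 = 0 \<and> (\<forall>w\<in>ball 0 (1/4). (ufun has_field_derivative ufun' w) (at w))"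
    unfolding ufun_def by (rule someI_ex)
  show "ufun 0 = 0" using * by blast
  show "(ufun has_field_derivative ufun' w) (at w)" if "cmod w < 1/4" using * that by auto
qed

lemma holomorphic_ufun: "ufun holomorphic_on ball 0 (1/4)"
  unfolding holomorphic_on_open[OF open_ball] by (metis mem_ball_0 ufun_deriv)

lemma ufun_cnj: assumes "cmod w < 1/4" shows "ufun (cnj w) = cnj (ufun w)"
proof -
  have "cnj (ufun (cnj w)) = ufun w"
  proof (rule primitives_eq[where S = "ball 0 (1/4)" and a = 0 and f = "\<lambda>w. cnj (ufun (cnj w))" and g = ufun and h = ufun'])
    fix z :: complex assume z: "z \<in> ball 0 (1/4)"
    have "(ufun has_field_derivative ufun' (cnj z)) (at (cnj z))" using z by (intro ufun_deriv) auto
    from has_field_derivative_cnj_cnj[OF this]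
    show "((\<lambda>s. cnj (ufun (cnj s))) has_field_derivative ufun' z) (at z)"
      using Efun_nonpos_Reals[of z] z
      by (simp add: ufun'_def Efun_cnj cnj_csqrt[of "Efun z", symmetric] o_def)
  qed (use assms in \<open>auto simp: ufun_0 ufun_deriv\<close>)
  thus ?thesis by (metis complex_cnj_cnj)
qed

text \<open>The leading term of u: integrating 4/sqrt 3 w^2 gives kap3 w^3.\<close>

definition kap3 :: real where "kap3 = 4 / (3 * sqrt 3)"
definition kap :: real where "kap = root 3 kap3"

lemma kap3_bounds: "3/4 < kap3" "kap3 < 1"
proof -
  have a: "17/10 < sqrt 3" "sqrt 3 < 16/9"
    by (rule real_less_rsqrt; simp add: power2_eq_square) (rule real_less_lsqrt; simp add: power2_eq_square)
  show "3/4 < kap3" "kap3 < 1" using a by (simp_all add: kap3_def pos_less_divide_eq pos_divide_less_eq)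
qed

lemma kap_pos: "0 < kap" and kap_cube: "kap ^ 3 = kap3"
proof -
  have "0 < kap3" using kap3_bounds by linarith
  thus "0 < kap" "kap ^ 3 = kap3" unfolding kap_def
    by (simp_all add: real_root_gt_zero real_root_pow_pos)
qed

text \<open>Since E - 1 = O(w^4), the derivative u' differs from 3 kap3 w^2 by O(w^6), and
  integrating from 0 gains one power. The constant is 2 * 12 * 4 / sqrt 3 = 96 / sqrt 3 <
  60.\<close>

lemma norm_ufun_diff:
  assumes "cmod w < 1/4" shows "cmod (ufun w - of_real kap3 * w ^ 3) \<le> 60 * cmod w ^ 7"
proof -
  define f where "f = (\<lambda>w. ufun w - of_real kap3 * w ^ 3)"
  have s3: "sqrt 3 > 17/10"
    by (rule real_less_rsqrt) (simp add: power2_eq_square)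
  have k3: "3 * kap3 = 4 / sqrt 3" by (simp add: kap3_def)
  have "cmod (f 0 - f w) \<le> (60 * cmod w ^ 6) * cmod (0 - w)"
  proof (rule field_differentiable_bound[of "cball 0 (cmod w)"])
    fix z :: complex assume "z \<in> cball 0 (cmod w)"
    hence zw: "cmod z \<le> cmod w" and z: "cmod z < 1/4" using assms by auto
    have "(f has_field_derivative (ufun' z - of_real kap3 * (3 * z\<^sup>2))) (at z)"
      unfolding f_def by (auto intro!: derivative_eq_intros ufun_deriv[OF z] simp: power2_eq_square)
    also have "ufun' z - of_real kap3 * (3 * z\<^sup>2) = of_real (3 * kap3) * z\<^sup>2 * (1 / csqrt (Efun z) - 1)"
      unfolding k3 by (simp add: ufun'_def ring_distribs kap3_def)
    finally show "(f has_field_derivative of_real (3 * kap3) * z\<^sup>2 * (1 / csqrt (Efun z) - 1)) (at z within cball 0 (cmod w))"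
      by (rule has_field_derivative_at_within)
    have "cmod (1 / csqrt (Efun z) - 1) \<le> 2 * (12 * cmod z ^ 4)"
      using norm_inverse_csqrt_diff[OF norm_Efun_diff(2)[OF z]] norm_Efun_diff(1)[OF z] by linarith
    hence "cmod (of_real (3 * kap3) * z\<^sup>2 * (1 / csqrt (Efun z) - 1)) \<le> 4 / sqrt 3 * cmod z ^ 2 * (24 * cmod z ^ 4)"
      unfolding k3 norm_mult by (intro mult_mono) (auto simp: norm_power norm_divide)
    also have "\<dots> = (96 / sqrt 3) * cmod z ^ 6" by (simp flip: power_add)
    also have "\<dots> \<le> 60 * cmod w ^ 6"
      using s3 by (intro mult_mono power_mono zw) (auto simp: field_simps)
    finally show "cmod (of_real (3 * kap3) * z\<^sup>2 * (1 / csqrt (Efun z) - 1)) \<le> 60 * cmod w ^ 6" .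
  qed auto
  also have "\<dots> = 60 * cmod w ^ 7" by (simp add: power_Suc2[of _ 6, simplified])
  finally show ?thesis by (simp add: f_def ufun_0 norm_minus_commute)
qed

definition hfun :: "complex \<Rightarrow> complex" where
  "hfun w = (if w = 0 then 0 else ufun w / (of_real kap3 * w ^ 3) - 1)"

lemma ufun_eq_hfun: "ufun w = of_real kap3 * w ^ 3 * (1 + hfun w)"
  using kap3_bounds by (simp add: hfun_def ufun_0)

lemma norm_hfun: assumes "cmod w < 1/4" shows "cmod (hfun w) \<le> 80 * cmod w ^ 4" "cmod (hfun w) < 1/2"
proof -
  show 1: "cmod (hfun w) \<le> 80 * cmod w ^ 4"
  proof (cases "w = 0")
    case False
    have "ufun w - of_real kap3 * w ^ 3 = of_real kap3 * w ^ 3 * hfun w"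
      by (simp add: ufun_eq_hfun ring_distribs)
    hence "kap3 * cmod w ^ 3 * cmod (hfun w) \<le> 60 * cmod w ^ 7"
      using norm_ufun_diff[OF assms] kap3_bounds by (simp add: norm_mult norm_power)
    also have "\<dots> = cmod w ^ 3 * (60 * cmod w ^ 4)" by (simp flip: power_add)
    finally have "cmod w ^ 3 * (kap3 * cmod (hfun w)) \<le> cmod w ^ 3 * (60 * cmod w ^ 4)" by (simp add: mult_ac)
    hence "kap3 * cmod (hfun w) \<le> 60 * cmod w ^ 4" using False by simp
    moreover have "3/4 * cmod (hfun w) \<le> kap3 * cmod (hfun w)" using kap3_bounds by (intro mult_right_mono) auto
    ultimately show ?thesis by linarith
  qed (simp add: hfun_def)
  have "cmod w ^ 4 \<le> (1/4) ^ 4" using assms by (intro power_mono) auto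
  thus "cmod (hfun w) < 1/2" using 1 by (simp add: power_divide)
qed

text \<open>\<open>hfun\<close> is the relative error of u against its leading term. The singularity
  at 0 is removable: the bound by 80 |w|^4 makes the prescribed value 0 the limit.\<close>

lemma holomorphic_hfun: "hfun holomorphic_on ball 0 (1/4)"
proof (rule no_isolated_singularity[where K = "{0}" and f = hfun])
  have "ufun holomorphic_on ball 0 (1/4) - {0}"
    by (rule holomorphic_on_subset[OF holomorphic_ufun]) auto
  hence "(\<lambda>w. ufun w / (of_real kap3 * w ^ 3) - 1) holomorphic_on ball 0 (1/4) - {0}"
    using kap3_bounds by (intro holomorphic_intros) auto
  thus hol: "hfun holomorphic_on ball 0 (1/4) - {0}"
    by (rule holomorphic_transform) (auto simp: hfun_def)
  show "continuous_on (ball 0 (1/4)) hfun"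
  proof (rule continuous_at_imp_continuous_on, rule ballI)
    fix z :: complex assume z: "z \<in> ball 0 (1/4)"
    show "isCont hfun z"
    proof (cases "z = 0")
      case False
      have "open (ball 0 (1/4) - {0::complex})" by (intro open_delete open_ball)
      thus ?thesis using z False holomorphic_on_imp_continuous_on[OF hol]
        by (simp add: continuous_on_eq_continuous_at)
    next
      case True
      have "(hfun \<longlongrightarrow> 0) (at 0)"
      proof (rule Lim_null_comparison)
        have "\<forall>\<^sub>F w::complex in at 0. w \<in> ball 0 (1/4)" by (intro eventually_at_in_open') auto
        thus "\<forall>\<^sub>F w in at 0. cmod (hfun w) \<le> 80 * cmod w ^ 4"
          by eventually_elim (rule norm_hfun(1), simp)
        have "isCont (\<lambda>w::complex. 80 * cmod w ^ 4) 0" by (intro continuous_intros)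
        thus "((\<lambda>w::complex. 80 * cmod w ^ 4) \<longlongrightarrow> 0) (at 0)" by (simp add: isCont_def)
      qed
      thus ?thesis using True by (simp add: isCont_def hfun_def)
    qed
  qed
qed auto

lemma hfun_cnj: "cmod w < 1/4 \<Longrightarrow> hfun (cnj w) = cnj (hfun w)"
  by (simp add: hfun_def ufun_cnj)

lemma one_plus_hfun: assumes "cmod w < 1/4" shows "1 + hfun w \<notin> \<real>\<^sub>\<le>\<^sub>0"
  using norm_hfun(2)[OF assms] by (intro near_1_nonpos_Reals) auto

text \<open>A holomorphic cube root of u. The factor w^3 is taken out exactly, and |h| < 1/2 keeps 1
  + h off the cut of the principal logarithm.\<close>

definition kfun :: "complex \<Rightarrow> complex" where
  "kfun w = of_real kap * w * exp (Ln (1 + hfun w) / 3)"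

lemma holomorphic_kfun: "kfun holomorphic_on ball 0 (1/4)"
  unfolding kfun_def[abs_def] using one_plus_hfun
  by (intro holomorphic_intros holomorphic_hfun) auto

lemma kfun_cube: assumes "cmod w < 1/4" shows "kfun w ^ 3 = ufun w"
proof -
  have "1 + hfun w \<noteq> 0" using one_plus_hfun[OF assms] by auto
  hence "exp (Ln (1 + hfun w) / 3) ^ 3 = 1 + hfun w" by (simp flip: exp_of_nat_mult)
  moreover have "complex_of_real kap ^ 3 = of_real kap3" by (simp flip: kap_cube)
  ultimately show ?thesis by (simp add: kfun_def power_mult_distrib ufun_eq_hfun)
qed

lemma kfun_cnj: assumes "cmod w < 1/4" shows "kfun (cnj w) = cnj (kfun w)"
  using one_plus_hfun[OF assms] assms by (simp add: kfun_def hfun_cnj cnj_Ln exp_cnj)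

lemma norm_kfun_diff:
  assumes "cmod w < 1/4" shows "cmod (kfun w - of_real kap * w) \<le> 320 * kap * cmod w ^ 5"
proof -
  define z where "z = exp (Ln (1 + hfun w) / 3)"
  have nz: "1 + hfun w \<noteq> 0" using one_plus_hfun[OF assms] by auto
  have z3: "z ^ 3 = 1 + hfun w" using nz unfolding z_def by (simp flip: exp_of_nat_mult)
  have "\<bar>Im (Ln (1 + hfun w) / 3)\<bar> < pi/2"
    using Im_Ln_le_pi[OF nz] mpi_less_Im_Ln[OF nz] pi_gt_zero by (auto simp: abs_if field_simps)
  hence "0 < cos (Im (Ln (1 + hfun w) / 3))" by (intro cos_gt_zero_pi) (auto simp: abs_if split: if_splits)
  hence rz: "0 < Re z" unfolding z_def by (simp add: Re_exp)
  \<comment> \<open>c and its conjugate are the nonreal cube roots of unity. They have real part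
    -1/2 while Re z > 0, so each is at distance at least 1/2 from z, and z - 1 = h / (z^2 + z + 1)
    costs only a factor 4; hence 320 = 4 * 80.\<close>
  define c where "c = Complex (-1/2) (sqrt 3/2)"
  have f: "z\<^sup>2 + z + 1 = (z - c) * (z - cnj c)"
    by (simp add: c_def complex_eq_iff power2_eq_square algebra_simps)
  have "1/2 \<le> cmod (z - c)" "1/2 \<le> cmod (z - cnj c)"
    using rz complex_Re_le_cmod[of "z - c"] complex_Re_le_cmod[of "z - cnj c"] by (auto simp: c_def)
  hence "1/2 * (1/2) \<le> cmod (z - c) * cmod (z - cnj c)" by (intro mult_mono) auto
  hence q: "1/4 \<le> cmod (z\<^sup>2 + z + 1)" by (simp add: f norm_mult)
  have "(z - 1) * (z\<^sup>2 + z + 1) = hfun w" using z3 by (simp add: power2_eq_square power3_eq_cube algebra_simps)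
  hence "cmod (hfun w) = cmod (z - 1) * cmod (z\<^sup>2 + z + 1)" by (simp flip: norm_mult)
  hence "cmod (z - 1) * (1/4) \<le> cmod (hfun w)" using q mult_left_mono[OF q, of "cmod (z - 1)"] by simp
  hence "cmod (z - 1) \<le> 320 * cmod w ^ 4" using norm_hfun(1)[OF assms] by linarith
  moreover have "kfun w - of_real kap * w = of_real kap * w * (z - 1)" by (simp add: kfun_def z_def ring_distribs)
  ultimately have "cmod (kfun w - of_real kap * w) \<le> kap * cmod w * (320 * cmod w ^ 4)"
    using kap_pos by (auto simp: norm_mult intro!: mult_left_mono)
  also have "\<dots> = 320 * kap * cmod w ^ 5" by (simp add: power_Suc[of _ 4, simplified])
  finally show ?thesis .
qed

section \<open>The primitive near the branch point\<close>

definition top_pt :: complex where "top_pt = \<i> * of_real y_top"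

lemma y_top_bounds: "1/2 < y_top" "y_top < 3/4"
proof -
  have "(1/2)\<^sup>2 < y_top\<^sup>2" "y_top\<^sup>2 < (3/4)\<^sup>2" using y_top_sq v_plus_bounds by (simp_all add: power2_eq_square)
  thus "1/2 < y_top" "y_top < 3/4" using y_top_pos power2_less_imp_less by fastforce+
qed

lemma vmap_factor: "vmap s = (s - top_pt) * (s + top_pt)"
proof -
  have "complex_of_real v_plus = of_real y_top * of_real y_top" 
    using y_top_sq by (simp add: power2_eq_square flip: of_real_mult)
  thus ?thesis by (simp add: vmap_def top_pt_def power2_eq_square algebra_simps)
qed

text \<open>Radius 1/50 gives |v| <= 2/50 < 1/16, so w = csqrt v stays in the disc of radius 1/4 on
  which \<open>ufun\<close> is controlled.\<close>

definition top_nbhd :: "complex set" where "top_nbhd = Sig \<inter> ball top_pt (1/50)"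

lemma top_nbhd_Im: assumes "s \<in> ball top_pt (1/50)" shows "Im s > 0"
proof -
  have "\<bar>Im (s - top_pt)\<bar> < 1/50" using assms abs_Im_le_cmod[of "s - top_pt"]
    by (simp add: dist_norm norm_minus_commute)
  hence "\<bar>Im s - y_top\<bar> < 1/50" by (simp add: top_pt_def)
  thus ?thesis using y_top_bounds by (simp only: abs_less_iff) linarith
qed

lemma norm_vmap_top: assumes "s \<in> ball top_pt r" "r \<le> 1/50" shows "cmod (vmap s) \<le> 2 * cmod (s - top_pt)"
proof -
  have "cmod (s + top_pt) \<le> cmod (s - top_pt) + cmod (2 * top_pt)" 
    using norm_triangle_ineq[of "s - top_pt" "2 * top_pt"] by (simp add: add.commute)
  also have "\<dots> \<le> 1/50 + 2 * y_top" using assms y_top_pos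
    by (simp add: dist_norm norm_minus_commute norm_mult top_pt_def)
  also have "\<dots> \<le> 2" using y_top_bounds by simp
  finally show ?thesis unfolding vmap_factor norm_mult
    by (metis mult.commute mult_right_mono norm_ge_zero)
qed

lemma norm_csqrt_vmap_top: assumes "s \<in> ball top_pt (1/50)" shows "cmod (csqrt (vmap s)) < 1/4"
proof -
  have "cmod (vmap s) < (1/4)\<^sup>2" using norm_vmap_top[OF assms] assms
    by (simp add: dist_norm norm_minus_commute power2_eq_square)
  thus ?thesis unfolding norm_csqrt by (intro real_less_lsqrt) auto
qed

text \<open>Just below the branch point on the imaginary axis: the slit disc is starlike about this
  point, and w is real and positive at it.\<close>

definition top_base :: complex where "top_base = \<i> * of_real (y_top - 1/100)"

lemma top_base_in: "top_base \<in> top_nbhd"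
proof -
  have "cmod (top_pt - top_base) = cmod (\<i> * of_real (1/100))"
    by (simp add: top_pt_def top_base_def algebra_simps)
  also have "\<dots> < 1/50" by (simp add: norm_mult)
  finally show ?thesis using y_top_bounds by (simp add: top_nbhd_def dist_norm top_base_def Sig_def)
qed

lemma open_top_nbhd: "open top_nbhd" unfolding top_nbhd_def by (intro open_Int open_Sig open_ball)

lemma connected_top_nbhd: "connected top_nbhd"
proof (rule starlike_imp_connected)
  show "starlike top_nbhd" unfolding starlike_def
  proof (rule bexI[OF _ top_base_in], intro ballI subsetI)
    fix s x assume s: "s \<in> top_nbhd" and x: "x \<in> closed_segment top_base s"
    have "x \<in> ball top_pt (1/50)"
      using closed_segment_subset[of top_base "ball top_pt (1/50)" s] s top_base_in x by (auto simp: top_nbhd_def)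
    moreover have "x \<in> Sig"
    proof -
      obtain u where u: "0 \<le> u" "u \<le> 1" "x = (1 - u) *\<^sub>R top_base + u *\<^sub>R s"
        using x by (auto simp: closed_segment_def)
      have re: "Re x = u * Re s" and im: "Im x = (1 - u) * (y_top - 1/100) + u * Im s"
        using u by (simp_all add: top_base_def)
      have "Im x < y_top" if "Re x = 0"
      proof (cases "u = 0")
        case True thus ?thesis using im by simp
      next
        case False
        hence "Re s = 0" using re that by simp
        hence "Im s < y_top" using s by (auto simp: top_nbhd_def Sig_def)
        hence "u * Im s < u * y_top" using False u by simp
        moreover have "(1 - u) * (y_top - 1/100) \<le> (1 - u) * y_top" using u by (intro mult_left_mono) auto
        ultimately have "Im x < u * y_top + (1 - u) * y_top" using im by linarith
        thus ?thesis by (simp add: algebra_simps)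
      qed
      thus ?thesis using top_nbhd_Im[OF \<open>x \<in> ball top_pt (1/50)\<close>] by (auto simp: Sig_def)
    qed
    ultimately show "x \<in> top_nbhd" by (simp add: top_nbhd_def)
  qed
qed

definition Gtop :: "complex \<Rightarrow> complex" where
  "Gtop s = - \<i> * ufun' (csqrt (vmap s)) * (s / csqrt (vmap s))"

lemma vmap_nz: "s \<in> Sig \<Longrightarrow> vmap s \<noteq> 0" using Sig_iff by auto

lemma Gtop_deriv:
  assumes "s \<in> top_nbhd"
  shows "((\<lambda>s. - \<i> * ufun (csqrt (vmap s))) has_field_derivative Gtop s) (at s)"
proof -
  have s: "s \<in> Sig" "s \<in> ball top_pt (1/50)" using assms by (auto simp: top_nbhd_def)
  have "((\<lambda>s. s\<^sup>2 + of_real v_plus) has_field_derivative 2 * s) (at s)" by (auto intro!: derivative_eq_intros)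
  hence "(vmap has_field_derivative 2 * s) (at s)" by (simp add: vmap_def[abs_def])
  hence "((\<lambda>s. csqrt (vmap s)) has_field_derivative 2 * s / (2 * csqrt (vmap s))) (at s)"
    using s Sig_iff by (intro has_field_derivative_csqrt') auto
  from DERIV_chain2[OF ufun_deriv[OF norm_csqrt_vmap_top[OF s(2)]] this]
  have "((\<lambda>s. ufun (csqrt (vmap s))) has_field_derivative ufun' (csqrt (vmap s)) * (2 * s / (2 * csqrt (vmap s)))) (at s)" .
  from DERIV_cmult[OF this, of "- \<i>"] show ?thesis by (simp add: Gtop_def mult_ac)
qed

lemma Gfun_square: assumes "s \<in> Sig"
  shows "(Gfun s)\<^sup>2 = 8 * vmap s / (21 * ((vmap s + 1/2) * (vmap s - of_real v_minus)))"
  by (simp add: Gfun_def power_divide Yfun_def)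

lemma Efun_csqrt: "Efun (csqrt v) = - 14 * (v - of_real v_plus) * ((v + 1/2) * (v - of_real v_minus))"
proof -
  have "csqrt v ^ 4 = v ^ 2" "csqrt v ^ 6 = v ^ 3"
    using power_mult[of "csqrt v" 2 2] power_mult[of "csqrt v" 2 3] by simp_all
  hence "Efun (csqrt v) = 1 - 11 * v\<^sup>2 - 14 * v ^ 3" by (simp add: Efun_def)
  also have "\<dots> = - 14 * (v + 1/2) * (v\<^sup>2 + 2 * v / 7 - 1/7)"
    by (simp add: algebra_simps power2_eq_square power3_eq_cube)
  also have "v\<^sup>2 + 2 * v / 7 - 1/7 = (v - of_real v_plus) * (v - of_real v_minus)" using v_roots by simp
  finally show ?thesis by (simp only: mult_ac)
qed

text \<open>The factor s^2 = v - v_plus cancels against the root \<open>v_plus\<close> of E, leaving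
  8 v / (21 (v + 1/2)(v - v_minus)) on both sides.\<close>

lemma Gtop_square: assumes "s \<in> top_nbhd" shows "(Gtop s)\<^sup>2 = (Gfun s)\<^sup>2"
proof -
  have s: "s \<in> Sig" "s \<in> ball top_pt (1/50)" using assms by (auto simp: top_nbhd_def)
  define v where "v = vmap s"
  have v: "v \<noteq> 0" using vmap_nz s v_def by simp
  have "s \<noteq> 0" using top_nbhd_Im[OF s(2)] by auto
  have sv: "v - of_real v_plus = s\<^sup>2" by (simp add: v_def vmap_def)
  have "Efun (csqrt v) \<noteq> 0" using Efun_nonpos_Reals[OF norm_csqrt_vmap_top[OF s(2)]] v_def by auto
  hence E: "(v + 1/2) * (v - of_real v_minus) \<noteq> 0" unfolding Efun_csqrt by auto
  have s3: "(complex_of_real (4 / sqrt 3))\<^sup>2 = 16/3"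
    by (simp add: power_divide flip: of_real_power)
  have "(Gtop s)\<^sup>2 = - (16/3) * (csqrt v ^ 2) ^ 2 * (1 / Efun (csqrt v)) * (s\<^sup>2 / v)"
    unfolding Gtop_def ufun'_def v_def[symmetric] power_mult_distrib power_divide s3 by simp
  also have "\<dots> = 8 * v / (21 * ((v + 1/2) * (v - of_real v_minus)))"
    unfolding Efun_csqrt sv power2_csqrt using v E \<open>s \<noteq> 0\<close> by (simp add: divide_simps power2_eq_square)
  finally show ?thesis using Gfun_square[OF s(1)] by (simp add: v_def)
qed

text \<open>The squares agree, so the continuous quotient takes only the values 1 and -1 and is
  constant on the connected slit disc. At \<open>top_base\<close>, where v, w and E are positive and
  -i s is positive, both functions have positive real part, which excludes -1.\<close>

lemma Gtop_eq: assumes "s \<in> top_nbhd" shows "Gtop s = Gfun s"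
proof -
  have sub: "top_nbhd \<subseteq> Sig" by (auto simp: top_nbhd_def)
  define R where "R = (\<lambda>s. Gtop s / Gfun s)"
  have vm: "continuous_on top_nbhd vmap" unfolding vmap_def[abs_def] by (intro continuous_intros)
  have cs: "continuous_on top_nbhd (\<lambda>s. csqrt (vmap s))"
    using Sig_iff sub by (intro continuous_on_compose2[OF continuous_on_csqrt vm]) auto
  have Ec: "continuous_on top_nbhd (\<lambda>s. Efun (csqrt (vmap s)))"
    unfolding Efun_def by (intro continuous_intros cs)
  have En: "Efun (csqrt (vmap s)) \<notin> \<real>\<^sub>\<le>\<^sub>0" if "s \<in> top_nbhd" for s
    using Efun_nonpos_Reals norm_csqrt_vmap_top that by (auto simp: top_nbhd_def)
  have "continuous_on top_nbhd (\<lambda>s. csqrt (Efun (csqrt (vmap s))))"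
    using En by (intro continuous_on_compose2[OF continuous_on_csqrt Ec]) auto
  moreover have "\<And>s. s \<in> top_nbhd \<Longrightarrow> csqrt (Efun (csqrt (vmap s))) \<noteq> 0" using En by fastforce
  moreover have "\<And>s. s \<in> top_nbhd \<Longrightarrow> csqrt (vmap s) \<noteq> 0" using vmap_nz sub by auto
  ultimately have "continuous_on top_nbhd Gtop"
    unfolding Gtop_def[abs_def] ufun'_def by (intro continuous_intros cs) auto
  moreover have "continuous_on top_nbhd Gfun"
    using holomorphic_on_imp_continuous_on[OF holomorphic_Gfun] sub continuous_on_subset by blast
  moreover have nz: "\<And>s. s \<in> top_nbhd \<Longrightarrow> Gfun s \<noteq> 0" using Gfun_nz sub by blast
  ultimately have contR: "continuous_on top_nbhd R" unfolding R_def by (intro continuous_intros) auto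
  have R1: "R s = 1 \<or> R s = -1" if "s \<in> top_nbhd" for s
  proof -
    have "(R s)\<^sup>2 = 1" unfolding R_def using Gtop_square[OF that] nz[OF that] by (simp add: power_divide)
    thus ?thesis by (simp add: power2_eq_1_iff)
  qed
  have "connected (R ` top_nbhd)" by (rule connected_continuous_image[OF contR connected_top_nbhd])
  moreover have "R ` top_nbhd \<subseteq> {1, -1}" using R1 by auto
  hence "finite (R ` top_nbhd)" by (rule finite_subset) auto
  ultimately obtain c where c: "R ` top_nbhd = {c}"
    using connected_finite_iff_sing top_base_in by (metis empty_iff imageI)
  have "R top_base \<noteq> -1"
  proof
    assume "R top_base = -1"
    hence eq: "Gtop top_base = - Gfun top_base" using nz[OF top_base_in] by (simp add: R_def divide_eq_minus_1_iff)
    define y where "y = y_top - 1/100"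
    have y: "0 < y" using y_top_bounds by (simp add: y_def)
    define x where "x = y_top\<^sup>2 - y\<^sup>2"
    have vx: "vmap top_base = of_real x" using y_top_sq by (simp add: vmap_def top_base_def y_def x_def power_mult_distrib flip: y_top_sq)
    have "y\<^sup>2 < y_top\<^sup>2" using y by (intro power_strict_mono) (auto simp: y_def)
    hence x: "0 < x" by (simp add: x_def)
    have w: "csqrt (vmap top_base) = of_real (sqrt x)" using x by (simp add: vx)
    define e where "e = 1 - 11 * sqrt x ^ 4 - 14 * sqrt x ^ 6"
    have Ee: "Efun (of_real (sqrt x)) = of_real e" by (simp add: Efun_def e_def)
    have "complex_of_real e \<notin> \<real>\<^sub>\<le>\<^sub>0" using En[OF top_base_in] unfolding w Ee .
    hence e: "0 < e" by (auto simp: complex_nonpos_Reals_iff not_le)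
    have "Gtop top_base = of_real (4 / sqrt 3 * (sqrt x)\<^sup>2 * (1 / sqrt e) * (y / sqrt x))"
      unfolding Gtop_def w ufun'_def Ee using e by (simp add: top_base_def y_def mult_ac)
    also have "4 / sqrt 3 * (sqrt x)\<^sup>2 * (1 / sqrt e) * (y / sqrt x) > 0" using x e y by simp
    hence "Re (complex_of_real (4 / sqrt 3 * (sqrt x)\<^sup>2 * (1 / sqrt e) * (y / sqrt x))) > 0" by simp
    ultimately have "Re (Gtop top_base) > 0" by simp
    thus False using eq Re_Gfun_pos[of top_base] top_base_in sub by auto
  qed
  hence "c = 1" using c R1[OF top_base_in] top_base_in by auto
  hence "R s = 1" using c assms by blast
  thus ?thesis using nz[OF assms] by (simp add: R_def)
qed

text \<open>The constant of integration in the branch-point coordinate. As u(0) = 0, it is the limit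
  of P at \<open>top_pt\<close>.\<close>

definition top_val :: complex where "top_val = Pfun top_base + \<i> * ufun (csqrt (vmap top_base))"

lemma Pfun_top: assumes "s \<in> top_nbhd" shows "Pfun s = top_val - \<i> * ufun (csqrt (vmap s))"
proof (rule primitives_eq[where S = top_nbhd and a = top_base and f = Pfun and h = Gfun
      and g = "\<lambda>s. top_val - \<i> * ufun (csqrt (vmap s))"])
  show "\<And>z. z \<in> top_nbhd \<Longrightarrow> (Pfun has_field_derivative Gfun z) (at z)"
    by (rule Pfun_deriv) (simp add: top_nbhd_def)
  show "((\<lambda>s. top_val - \<i> * ufun (csqrt (vmap s))) has_field_derivative Gfun z) (at z)" if "z \<in> top_nbhd" for z
    using DERIV_add[OF DERIV_const[of top_val] Gtop_deriv[OF that]] Gtop_eq[OF that] by simp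
qed (use assms in \<open>auto simp: connected_top_nbhd open_top_nbhd top_base_in top_val_def\<close>)

lemma Re_top_val: "Re top_val = 0"
proof -
  define x where "x = v_plus - (y_top - 1/100)\<^sup>2"
  have vx: "vmap top_base = of_real x" by (simp add: vmap_def top_base_def x_def power_mult_distrib)
  have "(y_top - 1/100)\<^sup>2 < y_top\<^sup>2" using y_top_bounds by (intro power_strict_mono) auto
  hence w: "csqrt (vmap top_base) = of_real (sqrt x)" using y_top_sq by (simp add: vx x_def)
  have "cmod (csqrt (vmap top_base)) < 1/4" using top_base_in norm_csqrt_vmap_top by (simp add: top_nbhd_def)
  from ufun_cnj[OF this] have "Im (ufun (csqrt (vmap top_base))) = 0" unfolding w by (simp add: complex_eq_iff)
  moreover have "Re (Pfun top_base) = 0" unfolding top_base_def using y_top_bounds by (intro Re_Pfun_imag) auto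
  ultimately show ?thesis by (simp add: top_val_def)
qed

definition A_top :: real where "A_top = Im top_val"

lemma top_val_eq: "top_val = \<i> * of_real A_top"
  using Re_top_val by (simp add: A_top_def complex_eq_iff)

text \<open>Formulated for arbitrary sequences in \<open>Sig\<close>, because the branch point is
  approached along the imaginary axis, along the ray of argument 2 pi/3 in v, and by an unspecified
  sequence in the closure argument.\<close>

lemma Pfun_top_lim:
  assumes "\<And>n. s n \<in> Sig" "s \<longlonglongrightarrow> top_pt" shows "(\<lambda>n. Pfun (s n)) \<longlonglongrightarrow> \<i> * of_real A_top"
proof -
  have "\<forall>\<^sub>F n in sequentially. s n \<in> ball top_pt (1/50)"
    using assms(2) by (rule topological_tendstoD) auto
  hence ev: "\<forall>\<^sub>F n in sequentially. Pfun (s n) = top_val - \<i> * ufun (csqrt (vmap (s n)))"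
    by eventually_elim (intro Pfun_top, simp add: top_nbhd_def assms(1))
  have "(\<lambda>n. vmap (s n)) \<longlonglongrightarrow> vmap top_pt" unfolding vmap_def by (intro tendsto_intros assms)
  hence "(\<lambda>n. vmap (s n)) \<longlonglongrightarrow> 0" by (simp add: vmap_factor)
  hence "(\<lambda>n. cmod (csqrt (vmap (s n)))) \<longlonglongrightarrow> sqrt (cmod 0)"
    unfolding norm_csqrt by (intro tendsto_intros)
  hence "(\<lambda>n. cmod (csqrt (vmap (s n)))) \<longlonglongrightarrow> 0" by simp
  hence c: "(\<lambda>n. csqrt (vmap (s n))) \<longlonglongrightarrow> 0" by (rule tendsto_norm_zero_cancel)
  have "isCont ufun 0" by (rule DERIV_isCont[OF ufun_deriv]) simp
  from isCont_tendsto_compose[OF this c]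
  have "(\<lambda>n. top_val - \<i> * ufun (csqrt (vmap (s n)))) \<longlonglongrightarrow> top_val - \<i> * ufun 0" by (intro tendsto_intros)
  hence "(\<lambda>n. top_val - \<i> * ufun (csqrt (vmap (s n)))) \<longlonglongrightarrow> \<i> * of_real A_top" by (simp add: ufun_0 top_val_eq)
  thus ?thesis using tendsto_cong[OF ev] by blast
qed

section \<open>Values of P on the segment between the branch points\<close>

lemma Im_Pfun_imag_mono:
  assumes "0 \<le> x" "x < y" "y < y_top" shows "Im (Pfun (\<i> * of_real x)) < Im (Pfun (\<i> * of_real y))"
proof -
  have "closed_segment (\<i> * of_real x) (\<i> * of_real y) \<subseteq> Sig"
  proof
    fix z assume "z \<in> closed_segment (\<i> * of_real x) (\<i> * complex_of_real y)"
    then obtain u where u: "0 \<le> u" "u \<le> 1" "z = (1 - u) *\<^sub>R (\<i> * of_real x) + u *\<^sub>R (\<i> * of_real y)"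
      by (auto simp: closed_segment_def)
    hence im: "Im z = (1 - u) * x + u * y" by simp
    have "(1 - u) * x \<le> (1 - u) * y" using u assms by (intro mult_left_mono) auto
    hence "Im z \<le> y" unfolding im by (simp add: algebra_simps)
    moreover have "0 \<le> Im z" unfolding im using u assms by (intro add_nonneg_nonneg mult_nonneg_nonneg) auto
    ultimately show "z \<in> Sig" using assms by (simp add: Sig_def)
  qed
  hence "0 < Re ((Pfun (\<i> * of_real y) - Pfun (\<i> * of_real x)) / (\<i> * of_real y - \<i> * of_real x))"
    using assms by (intro Pfun_segment_mono) auto
  also have "\<i> * complex_of_real y - \<i> * of_real x = \<i> * of_real (y - x)" by (simp add: algebra_simps)
  also have "Re ((Pfun (\<i> * of_real y) - Pfun (\<i> * of_real x)) / (\<i> * of_real (y - x)))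
      = (Im (Pfun (\<i> * of_real y)) - Im (Pfun (\<i> * of_real x))) / (y - x)"
    using assms by (simp add: Re_divide power2_eq_square)
  finally show ?thesis using assms by (simp add: zero_less_divide_iff)
qed

text \<open>The shift by 2 keeps the factor strictly between 0 and 1 already at n = 0.\<close>

definition y_seq :: "nat \<Rightarrow> real" where "y_seq n = y_top * (1 - 1 / real (n + 2))"

lemma y_seq_bounds: "0 < y_seq n" "y_seq n < y_top"
proof -
  have "0 < 1 - 1 / real (n + 2)" "1 - 1 / real (n + 2) < 1" by (simp_all add: field_simps)
  thus "0 < y_seq n" "y_seq n < y_top"
    unfolding y_seq_def using y_top_pos mult_strict_left_mono[of _ 1 y_top] by auto
qed

lemma y_seq_lim: "y_seq \<longlonglongrightarrow> y_top"
proof -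
  have "(\<lambda>n. 1 / real (n + 2)) \<longlonglongrightarrow> 0" using LIMSEQ_ignore_initial_segment[OF lim_1_over_n, of 2] by simp
  hence "y_seq \<longlonglongrightarrow> y_top * (1 - 0)" unfolding y_seq_def by (intro tendsto_intros)
  thus ?thesis by simp
qed

lemma Im_Pfun_y_seq: "(\<lambda>n. Im (Pfun (\<i> * of_real (y_seq n)))) \<longlonglongrightarrow> A_top"
proof -
  have "(\<lambda>n. \<i> * complex_of_real (y_seq n)) \<longlonglongrightarrow> \<i> * of_real y_top" by (intro tendsto_intros y_seq_lim)
  hence "(\<lambda>n. Pfun (\<i> * of_real (y_seq n))) \<longlonglongrightarrow> \<i> * of_real A_top"
    using y_seq_bounds by (intro Pfun_top_lim) (simp_all add: top_pt_def Sig_def abs_of_pos)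
  from tendsto_Im[OF this] show ?thesis by simp
qed

lemma Im_Pfun_less_A_top: assumes "0 \<le> y" "y < y_top" shows "Im (Pfun (\<i> * of_real y)) < A_top"
proof -
  \<comment> \<open>The limit along \<open>y_seq\<close> yields only a weak bound; passing through
    the midpoint restores strictness.\<close>
  define z where "z = (y + y_top) / 2"
  have z: "y < z" "z < y_top" "0 \<le> z" using assms by (auto simp: z_def)
  have "\<forall>\<^sub>F n in sequentially. z < y_seq n" by (rule order_tendstoD(1)[OF y_seq_lim z(2)])
  hence "\<forall>\<^sub>F n in sequentially. Im (Pfun (\<i> * of_real z)) \<le> Im (Pfun (\<i> * of_real (y_seq n)))"
    by eventually_elim (use Im_Pfun_imag_mono[OF z(3)] y_seq_bounds in \<open>auto intro: less_imp_le\<close>)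
  hence "Im (Pfun (\<i> * of_real z)) \<le> A_top"
    by (intro tendsto_lowerbound[OF Im_Pfun_y_seq]) auto
  thus ?thesis using Im_Pfun_imag_mono[OF assms(1) z(1,2)] by simp
qed

lemma A_top_pos: "0 < A_top"
  using Im_Pfun_less_A_top[of 0] y_top_pos by (simp add: Pfun_0)

lemma Pfun_imag_surj:
  assumes "\<bar>y\<bar> < A_top" shows "\<exists>x. \<bar>x\<bar> < y_top \<and> Pfun (\<i> * of_real x) = \<i> * of_real y"
proof -
  have *: "\<exists>x. 0 \<le> x \<and> x < y_top \<and> Pfun (\<i> * of_real x) = \<i> * of_real y" if y: "0 \<le> y" "y < A_top" for y
  proof -
    have "\<forall>\<^sub>F n in sequentially. y < Im (Pfun (\<i> * of_real (y_seq n)))"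
      using y Im_Pfun_y_seq by (intro order_tendstoD(1))
    then obtain n where n: "y < Im (Pfun (\<i> * of_real (y_seq n)))" 
      by (auto dest: eventually_happens)
    have "\<exists>x. 0 \<le> x \<and> x \<le> y_seq n \<and> Im (Pfun (\<i> * of_real x)) = y"
    proof (rule IVT)
      show "\<forall>x. 0 \<le> x \<and> x \<le> y_seq n \<longrightarrow> isCont (\<lambda>x. Im (Pfun (\<i> * of_real x))) x"
      proof (intro allI impI)
        fix x assume "0 \<le> x \<and> x \<le> y_seq n"
        hence "\<i> * of_real x \<in> Sig" using y_seq_bounds[of n] by (auto simp: Sig_def)
        hence "isCont Pfun (\<i> * of_real x)" by (rule isCont_Pfun)
        thus "isCont (\<lambda>x. Im (Pfun (\<i> * of_real x))) x"
          by (intro isCont_Im isCont_o2[of x "\<lambda>x. \<i> * complex_of_real x" Pfun] continuous_intros)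
      qed
    qed (use n y y_seq_bounds[of n] in \<open>auto simp: Pfun_0\<close>)
    then obtain x where x: "0 \<le> x" "x \<le> y_seq n" "Im (Pfun (\<i> * of_real x)) = y" by blast
    moreover have "Re (Pfun (\<i> * of_real x)) = 0" using x y_seq_bounds[of n] by (intro Re_Pfun_imag) auto
    ultimately show ?thesis using y_seq_bounds[of n] by (intro exI[of _ x]) (auto simp: complex_eq_iff)
  qed
  show ?thesis
  proof (cases "0 \<le> y")
    case True
    then obtain x where "0 \<le> x" "x < y_top" "Pfun (\<i> * of_real x) = \<i> * of_real y"
      using *[of y] assms by auto
    thus ?thesis by (intro exI[of _ x]) auto
  next
    case False
    then obtain x where x: "0 \<le> x" "x < y_top" "Pfun (\<i> * of_real x) = \<i> * of_real (- y)"
      using *[of "- y"] assms by auto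
    have "\<i> * of_real x \<in> Sig" using x by (auto simp: Sig_def)
    from Pfun_minus[OF this] x show ?thesis by (intro exI[of _ "- x"]) auto
  qed
qed

section \<open>Local inversion of the cube root coordinate\<close>

lemma kfun_deriv_0: "(kfun has_field_derivative of_real kap) (at 0)"
proof -
  have "(\<lambda>w. exp (Ln (1 + hfun w) / 3)) holomorphic_on ball 0 (1/4)"
    using one_plus_hfun by (intro holomorphic_intros holomorphic_hfun) auto
  then obtain d where d: "((\<lambda>w. exp (Ln (1 + hfun w) / 3)) has_field_derivative d) (at 0)"
    unfolding holomorphic_on_open[OF open_ball] by (metis centre_in_ball zero_less_divide_1_iff zero_less_numeral)
  have "((\<lambda>w. of_real kap * w) has_field_derivative of_real kap) (at 0)" by (auto intro!: derivative_eq_intros)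
  from DERIV_mult[OF this d] show ?thesis by (simp add: kfun_def[abs_def] hfun_def)
qed

lemma kfun_local:
  obtains r where "0 < r" "r \<le> 1/10" "\<And>w. cmod w < r \<Longrightarrow> 0 < Re (deriv kfun w)"
proof -
  have "deriv kfun holomorphic_on ball 0 (1/4)" by (intro holomorphic_deriv holomorphic_kfun open_ball)
  hence "isCont (deriv kfun) 0"
    by (metis centre_in_ball continuous_on_eq_continuous_at holomorphic_on_imp_continuous_on open_ball zero_less_divide_1_iff zero_less_numeral)
  hence "isCont (\<lambda>w. Re (deriv kfun w)) 0" by (rule isCont_Re)
  hence "((\<lambda>w. Re (deriv kfun w)) \<longlongrightarrow> kap) (at 0)"
    by (simp add: isCont_def DERIV_imp_deriv[OF kfun_deriv_0])
  hence "\<forall>\<^sub>F w in at 0. 0 < Re (deriv kfun w)" using kap_pos by (rule order_tendstoD(1))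
  then obtain d where d: "d > 0" "\<And>w. w \<noteq> 0 \<Longrightarrow> dist w 0 < d \<Longrightarrow> 0 < Re (deriv kfun w)"
    unfolding eventually_at by blast
  show ?thesis
  proof (rule that[of "min d (1/10)"])
    fix w :: complex assume "cmod w < min d (1/10)"
    thus "0 < Re (deriv kfun w)" using d(2)[of w] kap_pos
      by (cases "w = 0") (auto simp: DERIV_imp_deriv[OF kfun_deriv_0])
  qed (use d in auto)
qed

lemma sgn_Im_sqrt_sum:
  assumes "z\<^sup>2 = c - w\<^sup>2" "Im c = 0" "0 < Re z" "0 < Re w" shows "sgn (Im z) = - sgn (Im w)"
proof -
  have "Im (z\<^sup>2) = - Im (w\<^sup>2)" using assms by simp
  hence "Re z * Im z = - (Re w * Im w)" by (simp add: power2_eq_square mult.commute)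
  hence "sgn (Re z * Im z) = - sgn (Re w * Im w)" by (metis sgn_minus)
  thus ?thesis using assms by (simp add: sgn_mult)
qed

lemma Re_pos_square: assumes "0 < Re w" shows "w\<^sup>2 \<notin> \<real>\<^sub>\<le>\<^sub>0" and "csqrt (w\<^sup>2) = w"
proof -
  have "\<not> Re w * Re w \<le> 0" using assms by (simp add: not_le)
  thus "w\<^sup>2 \<notin> \<real>\<^sub>\<le>\<^sub>0" using assms by (auto simp: complex_nonpos_Reals_iff power2_eq_square)
  show "csqrt (w\<^sup>2) = w" using assms by (intro csqrt_square) auto
qed

text \<open>Solve k(w) = p and put s = i csqrt(v_plus - w^2): then v = w^2 and P s = i A_top - i
  u(w) = i A_top - i p^3. The condition on Re p means |arg p| <= pi/3, the sector on which p^3 makes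
  one full turn; it forces Re w > 0, so that csqrt v = w. The sign clause is what later places s in
  \<open>Uset\<close>.\<close>

lemma top_param:
  obtains \<epsilon> C where "0 < \<epsilon>" "0 \<le> C"
    "\<And>p. \<lbrakk>p \<noteq> 0; cmod p < \<epsilon>; cmod p / 2 \<le> Re p\<rbrakk> \<Longrightarrow>
       \<exists>s\<in>Sig. sgn (Re s) = sgn (Im p) \<and> Pfun s = \<i> * of_real A_top - \<i> * p ^ 3
         \<and> cmod (vmap s - p\<^sup>2 / of_real (kap\<^sup>2)) \<le> C * cmod p ^ 4"
proof -
  obtain r where r: "0 < r" "r \<le> 1/10" and rpos: "\<And>w. cmod w < r \<Longrightarrow> 0 < Re (deriv kfun w)"
    using kfun_local by blast
  have der: "(kfun has_field_derivative deriv kfun z) (at z)" if "cmod z < r" for z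
    using that r by (intro holomorphic_derivI[OF holomorphic_kfun open_ball]) auto
  have inj: "inj_on kfun (ball 0 r)"
  proof (rule inj_onI, rule ccontr)
    fix x y assume xy: "x \<in> ball 0 r" "y \<in> ball 0 r" "kfun x = kfun y" "x \<noteq> y"
    have sub: "closed_segment x y \<subseteq> ball 0 r" using xy by (intro closed_segment_subset) auto
    have "0 < Re ((kfun y - kfun x) / (y - x))"
      by (rule segment_mono[OF xy(4), where f' = "deriv kfun"]) (use sub der rpos in auto)
    thus False using xy by simp
  qed
  have "kfun holomorphic_on ball 0 r" by (rule holomorphic_on_subset[OF holomorphic_kfun]) (use r in auto)
  hence "open (kfun ` ball 0 r)" by (intro open_mapping_thm3 inj open_ball)
  moreover have "0 \<in> kfun ` ball 0 r" using r by (intro image_eqI[of _ _ 0]) (auto simp: kfun_def)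
  ultimately obtain e where e: "e > 0" "ball 0 e \<subseteq> kfun ` ball 0 r" using open_contains_ball by metis
  show ?thesis
  proof (rule that[of e "960 * (2 / kap) ^ 4"])
    show "0 < e" by fact
    show "0 \<le> 960 * (2 / kap) ^ 4" by simp
    fix p assume p: "p \<noteq> 0" "cmod p < e" "cmod p / 2 \<le> Re p"
    then obtain w where w: "cmod w < r" "kfun w = p" using e by force
    have w10: "cmod w < 1/10" and w4: "cmod w < 1/4" using w r by auto
    have wn: "w \<noteq> 0" using w p by (auto simp: kfun_def)
    have "cmod w ^ 4 \<le> (1/10) ^ 4" using w10 by (intro power_mono) auto
    hence "320 * cmod w ^ 4 \<le> 1/20" by (simp add: power_divide)
    hence "320 * cmod w ^ 4 * (kap * cmod w) \<le> 1/20 * (kap * cmod w)" 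
      using kap_pos by (intro mult_right_mono) auto
    moreover have "320 * kap * cmod w ^ 5 = 320 * cmod w ^ 4 * (kap * cmod w)"
      by (simp add: power_Suc2[of _ 4, simplified])
    ultimately have d: "cmod (p - of_real kap * w) \<le> (1/20) * (kap * cmod w)" using norm_kfun_diff[OF w4] unfolding w(2) by linarith
    have kw: "cmod (of_real kap * w) = kap * cmod w" using kap_pos by (simp add: norm_mult)
    have pn: "19/20 * (kap * cmod w) \<le> cmod p" "cmod p \<le> 2 * (kap * cmod w)"
      using norm_triangle_ineq2[of "of_real kap * w" "of_real kap * w - p"] norm_triangle_ineq[of "p - of_real kap * w" "of_real kap * w"]
        d kw by (auto simp: norm_minus_commute)
    have kwpos: "0 < kap * cmod w" using wn kap_pos by simp
    have "\<bar>Re (p - of_real kap * w)\<bar> \<le> 1/20 * (kap * cmod w)" using d abs_Re_le_cmod order_trans by blast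
    hence "\<bar>Re p - kap * Re w\<bar> \<le> 1/20 * (kap * cmod w)" by simp
    \<comment> \<open>Re p >= |p|/2 >= (19/40) kap |w|, which exceeds the error kap |w| / 20 of the
      linear approximation.\<close>
    hence "0 < kap * Re w" using p(3) pn(1) kwpos unfolding abs_le_iff by linarith
    hence Rew: "0 < Re w" using kap_pos by (simp add: zero_less_mult_iff)
    \<comment> \<open>k is real on the real axis and Re k' > 0, so the vertical segment from Re w to
      w carries the sign of Im w over to Im (k w).\<close>
    have sgnw: "sgn (Im p) = sgn (Im w)"
    proof (cases "Im w = 0")
      case True
      hence "cnj w = w" by (simp add: complex_eq_iff)
      hence "kfun w = cnj (kfun w)" using kfun_cnj[OF w4] by simp
      hence "Im p = 0" using w by (simp add: complex_eq_iff)
      thus ?thesis using True by simp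
    next
      case False
      define a where "a = complex_of_real (Re w)"
      have "cmod a \<le> cmod w" by (simp add: a_def abs_Re_le_cmod)
      hence a: "cmod a < r" using w by simp
      have wa: "w - a = \<i> * of_real (Im w)" by (simp add: a_def complex_eq_iff)
      have sub: "closed_segment a w \<subseteq> ball 0 r" using a w by (intro closed_segment_subset) auto
      have "a \<noteq> w" using False by (auto simp: a_def complex_eq_iff)
      hence "0 < Re ((kfun w - kfun a) / (w - a))"
        by (rule segment_mono[where f' = "deriv kfun"]) (use sub der rpos in auto)
      also have "Re ((kfun w - kfun a) / (w - a)) = (Im (kfun w) - Im (kfun a)) / Im w"
        unfolding wa using False by (simp add: Re_divide power2_eq_square)
      finally have pos: "0 < (Im (kfun w) - Im (kfun a)) / Im w" .
      have "kfun a = cnj (kfun a)" using kfun_cnj[of a] a r by (simp add: a_def)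
      hence "Im (kfun a) = 0" by (simp add: complex_eq_iff)
      with pos show ?thesis using w by (auto simp: zero_less_divide_iff sgn_if)
    qed
    \<comment> \<open>Of the two solutions of v = w^2 this choice, with Re z > 0 and so Im s > 0, is
      the one near \<open>top_pt\<close> and not near its negative.\<close>
    define z where "z = csqrt (of_real v_plus - w\<^sup>2)"
    define s where "s = \<i> * z"
    have z2: "z\<^sup>2 = of_real v_plus - w\<^sup>2" by (simp add: z_def)
    have w2: "cmod (w\<^sup>2) < 1/100" using w10 power_strict_mono[of "cmod w" "1/10" 2] by (simp add: norm_power power_divide)
    have "Re (w\<^sup>2) < 1/100" using w2 complex_Re_le_cmod[of "w\<^sup>2"] by linarith
    hence "of_real v_plus - w\<^sup>2 \<notin> \<real>\<^sub>\<le>\<^sub>0" using v_plus_bounds by (auto simp: complex_nonpos_Reals_iff)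
    hence Rez: "0 < Re z" unfolding z_def by (rule Re_csqrt_pos)
    have vs: "vmap s = w\<^sup>2" by (simp add: vmap_def s_def power_mult_distrib z2)
    have sSig: "s \<in> Sig" unfolding Sig_iff vs by (rule Re_pos_square(1)[OF Rew])
    have "cmod (s - top_pt) * cmod (s + top_pt) < 1/100" using w2 by (simp add: vs[symmetric] vmap_factor norm_mult)
    moreover have "1/2 \<le> cmod (s + top_pt)"
      using abs_Im_le_cmod[of "s + top_pt"] Rez y_top_bounds by (simp add: s_def top_pt_def)
    hence "cmod (s - top_pt) * (1/2) \<le> cmod (s - top_pt) * cmod (s + top_pt)" by (intro mult_left_mono) auto
    ultimately have "cmod (s - top_pt) < 1/50" by simp
    hence nb: "s \<in> top_nbhd" using sSig by (simp add: top_nbhd_def dist_norm norm_minus_commute)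
    show "\<exists>s\<in>Sig. sgn (Re s) = sgn (Im p) \<and> Pfun s = \<i> * of_real A_top - \<i> * p ^ 3
         \<and> cmod (vmap s - p\<^sup>2 / of_real (kap\<^sup>2)) \<le> 960 * (2 / kap) ^ 4 * cmod p ^ 4"
    proof (intro bexI[OF _ sSig] conjI)
      show "sgn (Re s) = sgn (Im p)"
        using sgn_Im_sqrt_sum[OF z2 _ Rez Rew] sgnw by (simp add: s_def)
      show "Pfun s = \<i> * of_real A_top - \<i> * p ^ 3"
        using Pfun_top[OF nb] kfun_cube[OF w4] w Re_pos_square(2)[OF Rew] by (simp add: vs top_val_eq)
      have kn: "complex_of_real kap \<noteq> 0" using kap_pos by simp
      have "vmap s - p\<^sup>2 / of_real (kap\<^sup>2) = - ((p - of_real kap * w) * (p + of_real kap * w)) / of_real (kap\<^sup>2)"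
        using kn by (simp add: vs field_simps power2_eq_square)
      hence "cmod (vmap s - p\<^sup>2 / of_real (kap\<^sup>2)) = cmod (p - of_real kap * w) * cmod (p + of_real kap * w) / kap\<^sup>2"
        by (simp add: norm_divide norm_mult norm_power)
      \<comment> \<open>The second factor uses |p| <= 2 kap |w|; this is the origin of 960 = 320 *
        3. Afterwards |w| <= 2 |p| / kap returns to p.\<close>
      also have "\<dots> \<le> (320 * kap * cmod w ^ 5) * (3 * (kap * cmod w)) / kap\<^sup>2"
        using norm_kfun_diff[OF w4] w pn kw norm_triangle_ineq[of p "of_real kap * w"] kap_pos
        by (intro divide_right_mono mult_mono) auto
      also have "\<dots> = 960 * cmod w ^ 6" using kap_pos by (simp add: field_simps power2_eq_square eval_nat_numeral)
      also have "\<dots> \<le> 960 * cmod w ^ 4" using w10 by (intro mult_left_mono power_decreasing) auto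
      also have "cmod w ^ 4 \<le> (2 / kap * cmod p) ^ 4"
        using pn(1) kap_pos kwpos by (intro power_mono) (auto simp: field_simps)
      also have "(2 / kap * cmod p) ^ 4 = (2 / kap) ^ 4 * cmod p ^ 4" by (rule power_mult_distrib)
      finally show "cmod (vmap s - p\<^sup>2 / of_real (kap\<^sup>2)) \<le> 960 * (2 / kap) ^ 4 * cmod p ^ 4"
        by (simp only: mult.assoc)
    qed
  qed
qed

section \<open>The width of the strip\<close>

lemma a_plus_bounds: "1/5 < a_plus" "a_plus < 1/4"
  using sqrt2_bounds by (auto simp: a_plus_def)

lemma a_minus_neg: "a_minus < -1" 
  using sqrt2_bounds by (auto simp: a_minus_def)

lemma a_roots: "(x - a_plus) * (x - a_minus) = x\<^sup>2 + x - 1/4"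
  by (simp add: a_plus_def a_minus_def field_simps power2_eq_square)

lemma v_plus_a_plus: "v_plus = a_plus / (1 - a_plus)"
proof -
  have "sqrt 2 * sqrt 2 = 2" by simp
  moreover have "1 - a_plus \<noteq> 0" using a_plus_bounds by simp
  ultimately show ?thesis by (simp add: v_plus_def a_plus_def field_simps)
qed

text \<open>On s = i y with y^2 = v_plus - x/(1-x) one has dy/dx = -1/(2 y (1-x)^2), so this is the
  change of variables between dt = i G dy and the integrand of \<open>A_width\<close>. Both sides
  are nonnegative, hence it suffices to compare squares.\<close>

lemma Gfun_imag_integrand:
  assumes "0 < x" "x < a_plus"
  defines "v \<equiv> x / (1 - x)"
  defines "y \<equiv> sqrt (v_plus - v)"
  shows "Gfun (\<i> * of_real y) = of_real (2 * y * (1 - x)\<^sup>2 * 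
      ((1 / (1 - x)) * sqrt (x / (3 * (x + 1) * (a_plus - x) * (x - a_minus)))))"
    and "0 < y" "y < y_top" "0 < v" "v < v_plus"
proof -
  have x1: "0 < 1 - x" using assms a_plus_bounds by simp
  show v: "0 < v" using assms x1 by (simp add: v_def)
  show vlt: "v < v_plus"
    unfolding v_def v_plus_a_plus using assms(1,2) a_plus_bounds by (intro frac_less) auto
  show y: "0 < y" using vlt by (simp add: y_def)
  have y2: "y\<^sup>2 = v_plus - v" using vlt by (simp add: y_def)
  show ylt: "y < y_top" unfolding y_def y_top_def using v by (intro real_sqrt_less_mono) auto
  define R where "R = 2 * y * (1 - x)\<^sup>2 * ((1 / (1 - x)) * sqrt (x / (3 * (x + 1) * (a_plus - x) * (x - a_minus))))"
  define D where "D = (x + 1) * (a_plus - x) * (x - a_minus)"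
  have D: "0 < D" using assms a_minus_neg by (simp add: D_def)
  have S: "\<i> * complex_of_real y \<in> Sig" using y ylt by (simp add: Sig_def)
  have vm: "vmap (\<i> * of_real y) = of_real v" using y2 by (simp add: vmap_def power_mult_distrib flip: of_real_power)
  define g where "g = 1 / sqrt (21/8 * ((v + 1/2) * (v - v_minus) / v))"
  have vmm: "0 < v - v_minus" using v v_minus_bounds by simp
  have Ypos: "0 < 21/8 * ((v + 1/2) * (v - v_minus) / v)" using v vmm by simp
  have "Yfun (of_real v) = of_real (21/8 * ((v + 1/2) * (v - v_minus) / v))" by (simp add: Yfun_def)
  hence G: "Gfun (\<i> * of_real y) = of_real g" unfolding Gfun_def vm g_def using Ypos by simp
  have g0: "0 \<le> g" unfolding g_def using Ypos by simp
  have g2: "g\<^sup>2 = 1 / (21/8 * ((v + 1/2) * (v - v_minus) / v))"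
    unfolding g_def power_divide using Ypos by simp
  have "3 * (x + 1) * (a_plus - x) * (x - a_minus) = 3 * D" by (simp only: D_def mult.assoc)
  hence arg0: "0 \<le> x / (3 * (x + 1) * (a_plus - x) * (x - a_minus))" using D assms(1) by simp
  have R0: "0 \<le> R" unfolding R_def using y x1
    by (intro mult_nonneg_nonneg real_sqrt_ge_zero arg0) auto
  have R2: "R\<^sup>2 = 4 * y\<^sup>2 * (1 - x)\<^sup>2 * (x / (3 * D))"
  proof -
    from arg0 have "(sqrt (x / (3 * (x + 1) * (a_plus - x) * (x - a_minus))))\<^sup>2 = x / (3 * D)"
      by (simp add: D_def mult.assoc)
    hence "R\<^sup>2 = 4 * y\<^sup>2 * ((1 - x)\<^sup>2)\<^sup>2 * ((1 / (1 - x))\<^sup>2 * (x / (3 * D)))"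
      unfolding R_def power_mult_distrib by simp
    thus ?thesis using x1 by (simp add: power2_eq_square)
  qed
  \<comment> \<open>Multiplying by (1-x)^3 clears denominators in the cubic in v and gives back the
    cubic in x = q.\<close>
  have key: "(v_plus - v) * ((v + 1/2) * (v - v_minus)) * (7 * (1 - x) ^ 3) = 2 * D"
  proof -
    have "(v - v_plus) * (v - v_minus) = v\<^sup>2 + 2 * v / 7 - 1/7"
      by (simp add: v_plus_def v_minus_def field_simps power2_eq_square)
    moreover have "(v_plus - v) * (h * (v - v_minus)) = - (h * ((v - v_plus) * (v - v_minus)))" for h
      by (simp add: algebra_simps)
    ultimately have "(v_plus - v) * ((v + 1/2) * (v - v_minus)) = - ((v + 1/2) * (v\<^sup>2 + 2 * v / 7 - 1/7))" by simp
    also have "\<dots> = (1 - 11 * v\<^sup>2 - 14 * v ^ 3) / 14" by (simp add: field_simps power2_eq_square power3_eq_cube)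
    finally have "(v_plus - v) * ((v + 1/2) * (v - v_minus)) * (7 * (1 - x) ^ 3) = (1 - 11 * v\<^sup>2 - 14 * v ^ 3) / 2 * (1 - x) ^ 3"
      by simp
    also have "\<dots> = ((1 - x) ^ 3 - 11 * (v * (1 - x))\<^sup>2 * (1 - x) - 14 * (v * (1 - x)) ^ 3) / 2"
      by (simp add: power2_eq_square power3_eq_cube algebra_simps)
    also have "v * (1 - x) = x" using x1 by (simp add: v_def)
    also have "((1 - x) ^ 3 - 11 * x\<^sup>2 * (1 - x) - 14 * x ^ 3) / 2 = - 2 * ((x + 1) * (x\<^sup>2 + x - 1/4))"
      by (simp add: power2_eq_square power3_eq_cube field_simps)
    also have "\<dots> = 2 * D" unfolding D_def a_roots[symmetric] by (simp add: algebra_simps)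
    finally show ?thesis .
  qed
  have "g\<^sup>2 = 8 * v / (21 * ((v + 1/2) * (v - v_minus)))" unfolding g2 by simp
  moreover have "4 * (v_plus - v) * (1 - x)\<^sup>2 * (x / (3 * D)) = 8 * v / (21 * ((v + 1/2) * (v - v_minus)))"
  proof -
    have nz: "(v + 1/2) * (v - v_minus) \<noteq> 0" using v vmm by simp
    have xv: "x = v * (1 - x)" using x1 by (simp add: v_def)
    have "4 * (v_plus - v) * (1 - x)\<^sup>2 * x * (21 * ((v + 1/2) * (v - v_minus))) 
        = 12 * v * ((v_plus - v) * ((v + 1/2) * (v - v_minus)) * (7 * (1 - x) ^ 3))"
    proof -
      have "12 * v * ((v_plus - v) * ((v + 1/2) * (v - v_minus)) * (7 * (1 - x) ^ 3))
        = 4 * (v_plus - v) * (1 - x)\<^sup>2 * (v * (1 - x)) * (21 * ((v + 1/2) * (v - v_minus)))"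
        by (simp only: power2_eq_square power3_eq_cube mult_ac)
      thus ?thesis unfolding xv[symmetric] by (rule sym)
    qed
    also have "\<dots> = 8 * v * (3 * D)" unfolding key by simp
    finally have e: "4 * (v_plus - v) * (1 - x)\<^sup>2 * x * (21 * ((v + 1/2) * (v - v_minus))) = 8 * v * (3 * D)" .
    have "4 * (v_plus - v) * (1 - x)\<^sup>2 * x / (3 * D) = 8 * v / (21 * ((v + 1/2) * (v - v_minus)))"
      using nz D e by (subst frac_eq_eq) auto
    thus ?thesis by simp
  qed
  ultimately have "g\<^sup>2 = R\<^sup>2" using R2 y2 by simp
  hence "g = R" using g0 R0 by simp
  thus "Gfun (\<i> * of_real y) = of_real (2 * y * (1 - x)\<^sup>2 * 
      ((1 / (1 - x)) * sqrt (x / (3 * (x + 1) * (a_plus - x) * (x - a_minus)))))"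
    using G R_def by simp
qed

text \<open>The real integral equals the increase of Im P from s = 0 to the upper branch point. The
  fundamental theorem is used in the form asking for the derivative only in the interior, since the
  integrand is unbounded at \<open>a_plus\<close>, where y = 0.\<close>

lemma A_width_eq: "A_width = A_top"
proof -
  define yy where "yy = (\<lambda>x. sqrt (v_plus - x / (1 - x)))"
  \<comment> \<open>x = 0 corresponds to the branch point, which is outside \<open>Sig\<close>; the
    value there is the limit provided by \<open>Pfun_top_lim\<close>.\<close>
  define \<Phi> where "\<Phi> = (\<lambda>x. if x = 0 then - A_top else - Im (Pfun (\<i> * of_real (yy x))))"
  define f where "f = (\<lambda>x. (1 / (1 - x)) * sqrt (x / (3 * (x + 1) * (a_plus - x) * (x - a_minus))))"
  have yy0: "0 \<le> yy x" "yy x < y_top" if "0 < x" "x \<le> a_plus" for x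
  proof -
    have "x / (1 - x) \<le> a_plus / (1 - a_plus)" using that a_plus_bounds by (intro frac_le) auto
    thus "0 \<le> yy x" by (simp add: yy_def v_plus_a_plus)
    show "yy x < y_top" unfolding yy_def y_top_def using that a_plus_bounds by (intro real_sqrt_less_mono) auto
  qed
  have inSig: "\<i> * of_real (yy x) \<in> Sig" if "0 < x" "x \<le> a_plus" for x
    using yy0[OF that] by (auto simp: Sig_def)
  have yycont: "continuous_on {0..a_plus} yy"
    unfolding yy_def using a_plus_bounds by (intro continuous_intros) auto
  have "(f has_integral (\<Phi> a_plus - \<Phi> 0)) {0..a_plus}"
  proof (rule fundamental_theorem_of_calculus_interior)
    show "0 \<le> a_plus" using a_plus_bounds by simp
    show "continuous_on {0..a_plus} \<Phi>"
      unfolding continuous_on_def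
    proof
      fix x assume x: "x \<in> {0..a_plus}"
      show "(\<Phi> \<longlongrightarrow> \<Phi> x) (at x within {0..a_plus})"
      proof (cases "x = 0")
        case True
        show ?thesis unfolding tendsto_at_iff_sequentially
        proof (intro allI impI)
          fix X assume X: "\<forall>i. X i \<in> {0..a_plus} - {x}" "X \<longlonglongrightarrow> x"
          have Xp: "0 < X i" "X i \<le> a_plus" for i using X(1) True by (auto simp: less_le)
          have "\<forall>\<^sub>F i in sequentially. X i \<in> {0..a_plus}" using X(1) by (intro always_eventually) auto
          hence "(\<lambda>i. yy (X i)) \<longlonglongrightarrow> yy x" by (intro continuous_on_tendsto_compose[OF yycont X(2) x])
          hence "(\<lambda>i. yy (X i)) \<longlonglongrightarrow> yy 0" using True by simp
          hence "(\<lambda>i. yy (X i)) \<longlonglongrightarrow> y_top" by (simp add: yy_def y_top_def)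
          hence "(\<lambda>i. \<i> * complex_of_real (yy (X i))) \<longlonglongrightarrow> top_pt" unfolding top_pt_def by (intro tendsto_intros)
          hence "(\<lambda>i. Pfun (\<i> * of_real (yy (X i)))) \<longlonglongrightarrow> \<i> * of_real A_top"
            by (intro Pfun_top_lim inSig Xp)
          from tendsto_minus[OF tendsto_Im[OF this]]
          moreover have "X i \<noteq> 0" for i using Xp(1)[of i] by simp
          ultimately show "(\<Phi> \<circ> X) \<longlonglongrightarrow> \<Phi> x" using True by (simp add: \<Phi>_def o_def)
        qed
      next
        case False
        hence xp: "0 < x" "x \<le> a_plus" using x by auto
        have cP: "isCont Pfun (\<i> * of_real (yy x))" by (intro isCont_Pfun inSig xp)
        have "((\<lambda>x. \<i> * complex_of_real (yy x)) \<longlongrightarrow> \<i> * of_real (yy x)) (at x within {0..a_plus})"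
          using yycont x by (intro tendsto_intros) (auto simp: continuous_on_def)
        from tendsto_minus[OF tendsto_Im[OF isCont_tendsto_compose[OF cP this]]]
        have T: "((\<lambda>x. - Im (Pfun (\<i> * of_real (yy x)))) \<longlongrightarrow> - Im (Pfun (\<i> * of_real (yy x)))) (at x within {0..a_plus})" .
        have "((\<lambda>x. x) \<longlongrightarrow> x) (at x within {0..a_plus})" by (rule tendsto_ident_at)
        hence "\<forall>\<^sub>F z in at x within {0..a_plus}. 0 < z" using xp(1) by (rule order_tendstoD(1))
        hence "\<forall>\<^sub>F z in at x within {0..a_plus}. - Im (Pfun (\<i> * of_real (yy z))) = \<Phi> z"
          by eventually_elim (simp add: \<Phi>_def)
        from Lim_transform_eventually[OF T this] show ?thesis using False by (simp add: \<Phi>_def)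
      qed
    qed
    fix x assume x: "x \<in> {0<..<a_plus}"
    hence x': "0 < x" "x < a_plus" by auto
    note G = Gfun_imag_integrand[OF x', folded yy_def]
    have yx: "yy x = sqrt (v_plus - x / (1 - x))" by (simp add: yy_def)
    have yn: "yy x \<noteq> 0" using G(2) unfolding yx by (rule less_imp_neq[THEN not_sym])
    have x1: "1 - x \<noteq> 0" using x' a_plus_bounds by simp
    have dpos: "0 < v_plus - x / (1 - x)" using G(5) by simp
    have "((\<lambda>x. v_plus - x / (1 - x)) has_real_derivative (- (1 / (1 - x)\<^sup>2))) (at x)"
      using x1 by (auto intro!: derivative_eq_intros simp: field_simps power2_eq_square)
    hence "((\<lambda>x. sqrt (v_plus - x / (1 - x))) has_real_derivative 
        (inverse (sqrt (v_plus - x / (1 - x))) / 2 * - (1 / (1 - x)\<^sup>2))) (at x)"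
      using DERIV_chain2[where f = sqrt and g = "\<lambda>x. v_plus - x / (1 - x)", OF DERIV_real_sqrt[OF dpos]] by blast
    hence yd: "(yy has_real_derivative (inverse (yy x) / 2 * - (1 / (1 - x)\<^sup>2))) (at x)"
      by (simp only: yy_def)
    have "((\<lambda>x. \<i> * complex_of_real (yy x)) has_vector_derivative (\<i> * of_real (inverse (yy x) / 2 * - (1 / (1 - x)\<^sup>2)))) (at x)"
      by (intro has_vector_derivative_mult_right has_vector_derivative_of_real yd)
    from field_vector_diff_chain_at[OF this Pfun_deriv[OF inSig]] x'
    have "((\<lambda>x. Pfun (\<i> * of_real (yy x))) has_vector_derivative
       (\<i> * of_real (inverse (yy x) / 2 * - (1 / (1 - x)\<^sup>2))) * Gfun (\<i> * of_real (yy x))) (at x)"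
      by (simp add: o_def)
    also have "Gfun (\<i> * of_real (yy x)) = of_real (2 * yy x * (1 - x)\<^sup>2 * f x)"
      using G(1) by (simp add: f_def yx)
    also have "(\<i> * of_real (inverse (yy x) / 2 * - (1 / (1 - x)\<^sup>2))) * of_real (2 * yy x * (1 - x)\<^sup>2 * f x)
        = \<i> * of_real ((inverse (yy x) / 2 * - (1 / (1 - x)\<^sup>2)) * (2 * yy x * (1 - x)\<^sup>2 * f x))"
      by simp
    also have "(inverse (yy x) / 2 * - (1 / (1 - x)\<^sup>2)) * (2 * yy x * (1 - x)\<^sup>2 * f x) = - f x"
      using yn x1 by (simp add: divide_simps)
    finally have "((\<lambda>x. - Im (Pfun (\<i> * of_real (yy x)))) has_vector_derivative (- Im (\<i> * complex_of_real (- f x)))) (at x)"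
      by (intro has_vector_derivative_minus bounded_linear.has_vector_derivative[OF bounded_linear_Im])
    hence "((\<lambda>x. - Im (Pfun (\<i> * of_real (yy x)))) has_vector_derivative f x) (at x)" by simp
    thus "(\<Phi> has_vector_derivative f x) (at x)"
    proof (rule has_vector_derivative_transform_within_open[where S = "{0<..<a_plus}"])
      show "\<And>x. x \<in> {0<..<a_plus} \<Longrightarrow> - Im (Pfun (\<i> * of_real (yy x))) = \<Phi> x" by (simp add: \<Phi>_def)
    qed (use x in auto)
  qed
  hence "integral {0..a_plus} f = \<Phi> a_plus - \<Phi> 0" by (rule integral_unique)
  moreover have "yy a_plus = 0" by (simp add: yy_def v_plus_a_plus)
  hence "\<Phi> a_plus = 0" using a_plus_bounds by (simp add: \<Phi>_def Pfun_0)
  ultimately show ?thesis by (simp add: A_width_def f_def \<Phi>_def)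
qed

section \<open>Boundary rays and growth at infinity\<close>

lemma cubic_v: "(v - of_real v_plus) * ((v + 1/2) * (v - of_real v_minus)) = v ^ 3 + 11/14 * v\<^sup>2 - (1/14 :: complex)"
proof -
  have "(v - of_real v_plus) * ((v + 1/2) * (v - of_real v_minus)) = (v + 1/2) * ((v - of_real v_plus) * (v - of_real v_minus))"
    by (simp only: mult_ac)
  also have "\<dots> = (v + 1/2) * (v\<^sup>2 + 2 * v / 7 - 1/7)" by (simp only: v_roots)
  also have "\<dots> = v ^ 3 + 11/14 * v\<^sup>2 - 1/14" by (simp add: field_simps power2_eq_square power3_eq_cube)
  finally show ?thesis .
qed

text \<open>Polar coordinates in v: the point over v = r u in the closed right half plane.\<close>

definition sig :: "complex \<Rightarrow> real \<Rightarrow> complex" where "sig u r = csqrt (of_real r * u - of_real v_plus)"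

lemma vmap_sig: "vmap (sig u r) = of_real r * u" by (simp add: vmap_def sig_def)

lemma sig_cone:
  assumes "cmod u = 1" "-1/2 \<le> Re u" "0 < r" "Im u \<noteq> 0 \<or> v_plus < r"
  shows "of_real r * u - of_real v_plus \<notin> \<real>\<^sub>\<le>\<^sub>0" "0 < Re (sig u r)" "sig u r \<in> Sig"
proof -
  show 1: "of_real r * u - of_real v_plus \<notin> \<real>\<^sub>\<le>\<^sub>0"
  proof (cases "Im u = 0")
    case True
    hence "\<bar>Re u\<bar> = 1" using assms(1) by (simp add: cmod_def)
    hence "Re u = 1" using assms(2) by linarith
    thus ?thesis using True assms by (auto simp: complex_nonpos_Reals_iff)
  qed (use assms in \<open>auto simp: complex_nonpos_Reals_iff\<close>)
  show "0 < Re (sig u r)" unfolding sig_def by (rule Re_csqrt_pos[OF 1])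
  thus "sig u r \<in> Sig" by (auto simp: Sig_def)
qed

lemma Pfun_sig_deriv:
  assumes "cmod u = 1" "-1/2 \<le> Re u" "0 < r" "Im u \<noteq> 0 \<or> v_plus < r"
  shows "((\<lambda>r. Pfun (sig u r)) has_vector_derivative (u / (2 * sig u r * csqrt (Yfun (of_real r * u))))) (at r)"
proof -
  note sc = sig_cone[OF assms]
  have "((\<lambda>r. of_real r * u - of_real v_plus) has_vector_derivative u) (at r)"
    by (auto intro!: derivative_eq_intros)
  from field_vector_diff_chain_at[OF this has_field_derivative_csqrt[OF sc(1)]]
  have "((\<lambda>r. sig u r) has_vector_derivative (u * inverse (2 * sig u r))) (at r)"
    by (simp add: o_def sig_def)
  from field_vector_diff_chain_at[OF this Pfun_deriv[OF sc(3)]]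
  have "((\<lambda>r. Pfun (sig u r)) has_vector_derivative (u * inverse (2 * sig u r) * Gfun (sig u r))) (at r)"
    by (simp only: o_def)
  also have "u * inverse (2 * sig u r) * Gfun (sig u r) = u / (2 * sig u r * csqrt (Yfun (of_real r * u)))"
    by (simp add: Gfun_def vmap_sig inverse_eq_divide)
  finally show ?thesis .
qed

lemma sig_vmap: assumes "0 < Re s" "vmap s = of_real r * u" shows "sig u r = s"
proof -
  have "of_real r * u - of_real v_plus = s\<^sup>2" unfolding assms(2)[symmetric] by (simp add: vmap_def)
  thus ?thesis unfolding sig_def using csqrt_square[of s] assms(1) by simp
qed

definition om :: complex where "om = Complex (-1/2) (sqrt 3 / 2)"

lemma om_facts: "cmod om = 1" "om\<^sup>2 = Complex (-1/2) (- sqrt 3 / 2)" "om ^ 3 = 1"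
  by (auto simp: om_def cmod_def power_divide complex_eq_iff power2_eq_square power3_eq_cube)

text \<open>On the ray of argument 2 pi/3 the term 14 v^3 is real, so the sign of the imaginary part of
  14 v^3 + 11 v^2 - 1 is that of Im (v^2).\<close>
lemma Im_ray_deriv_pos:
  assumes "0 < r" shows "0 < Im (om / (2 * sig om r * csqrt (Yfun (of_real r * om))))"
proof -
  define v where "v = of_real r * om"
  define \<sigma> where "\<sigma> = sig om r"
  define Y where "Y = csqrt (Yfun v)"
  define X where "X = om / (2 * \<sigma> * Y)"
  have c: "cmod om = 1" "-1/2 \<le> Re om" "0 < r" "Im om \<noteq> 0 \<or> v_plus < r"
    using assms om_facts by (auto simp: om_def)
  note sc = sig_cone[OF c, folded \<sigma>_def]
  have vn: "v \<notin> \<real>\<^sub>\<le>\<^sub>0" using assms by (auto simp: v_def om_def complex_nonpos_Reals_iff)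
  have v0: "v \<noteq> 0" using vn by auto
  have ReY: "0 < Re Y" unfolding Y_def by (intro Re_csqrt_pos Yfun_nonpos_Reals vn)
  have nz: "\<sigma> \<noteq> 0" "Y \<noteq> 0" "om \<noteq> 0" using ReY sc(2) om_facts by auto
  have s2: "\<sigma>\<^sup>2 = v - of_real v_plus" by (simp add: \<sigma>_def sig_def v_def)
  have Y2: "Y\<^sup>2 = 21/8 * ((v + 1/2) * (v - of_real v_minus) / v)" by (simp add: Y_def Yfun_def)
  have "4 * \<sigma>\<^sup>2 * Y\<^sup>2 = 21/2 * ((v - of_real v_plus) * ((v + 1/2) * (v - of_real v_minus))) / v"
  proof -
    have "4 * a * (21/8 * (b / v)) = 21/2 * (a * b) / v" for a b :: complex by simp
    thus ?thesis unfolding s2 Y2 .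
  qed
  also have "21/2 * ((v - of_real v_plus) * ((v + 1/2) * (v - of_real v_minus))) = 3/4 * (14 * v ^ 3 + 11 * v\<^sup>2 - 1)"
    unfolding cubic_v by (simp add: field_simps)
  finally have sY: "4 * \<sigma>\<^sup>2 * Y\<^sup>2 * v = 3/4 * (14 * v ^ 3 + 11 * v\<^sup>2 - 1)" using v0 by simp
  define D where "D = 14 * v ^ 3 + 11 * v\<^sup>2 - 1"
  have D: "D = of_real (14 * r ^ 3 - 1) + of_real (11 * r\<^sup>2) * om\<^sup>2"
    by (simp add: D_def v_def power_mult_distrib om_facts(3))
  have ImD: "Im D < 0" unfolding D using assms by (simp add: om_facts(2))
  hence Dn: "D \<noteq> 0" by auto
  have "X\<^sup>2 = om\<^sup>2 / (4 * \<sigma>\<^sup>2 * Y\<^sup>2)" by (simp add: X_def power_divide power_mult_distrib)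
  also have "\<dots> = om\<^sup>2 * v / (3/4 * D)" unfolding D_def sY[symmetric] using v0 nz by simp
  also have "om\<^sup>2 * v = of_real r" using om_facts(3) by (simp add: v_def power2_eq_square power3_eq_cube mult_ac)
  finally have X2: "X\<^sup>2 = of_real (4 * r / 3) * inverse D" by (simp add: field_simps)
  have "0 < (Re D)\<^sup>2 + (Im D)\<^sup>2" using ImD by (simp add: sum_power2_gt_zero_iff)
  hence iD: "0 < Im (inverse D)" using ImD by (simp add: divide_neg_pos)
  have "0 < 4 * r / 3 * Im (inverse D)" by (rule mult_pos_pos[OF _ iD]) (use assms in simp)
  moreover have "Im (of_real k * z) = k * Im z" for k z by simp
  hence "Im (X\<^sup>2) = 4 * r / 3 * Im (inverse D)" unfolding X2 .
  ultimately have "0 < Im (X\<^sup>2)" by (simp only:)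
  hence RI: "0 < Re X * Im X" by (simp add: power2_eq_square mult.commute)
  \<comment> \<open>Im (X^2) > 0 leaves X in the open first or third quadrant. Z = Y X lies in the
    first quadrant, and Re (Z cnj X) = |X|^2 Re Y > 0, which excludes the third.\<close>
  define Z where "Z = om / (2 * \<sigma>)"
  have Im_s2: "Im (\<sigma>\<^sup>2) > 0" and Re_s2: "Re (\<sigma>\<^sup>2) < 0"
    unfolding s2 v_def using assms v_plus_bounds by (auto simp: om_def)
  have ims: "0 < Im \<sigma>" using Im_s2 sc(2) by (simp add: power2_eq_square zero_less_mult_iff)
  have "(Re \<sigma>)\<^sup>2 < (Im \<sigma>)\<^sup>2" using Re_s2 by (simp add: power2_eq_square)
  hence lt: "Re \<sigma> < Im \<sigma>" by (rule power2_less_imp_less) (use ims in simp)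
  have s3: "1 < sqrt 3" by (rule real_less_rsqrt) simp
  have "Im \<sigma> * 1 < Im \<sigma> * sqrt 3" using ims s3 by (intro mult_strict_left_mono)
  hence a: "0 < - (1/2) * Re \<sigma> + sqrt 3 / 2 * Im \<sigma>" using lt by (simp add: mult.commute)
  have b: "0 < sqrt 3 / 2 * Re \<sigma> + 1/2 * Im \<sigma>" using ims sc(2) by (intro add_pos_pos) auto
  define n where "n = 2 * ((Re \<sigma>)\<^sup>2 + (Im \<sigma>)\<^sup>2)"
  have "0 < (Re \<sigma>)\<^sup>2 + (Im \<sigma>)\<^sup>2" using ims by (simp add: sum_power2_gt_zero_iff)
  hence n: "0 < n" unfolding n_def by (intro mult_pos_pos) auto
  have "complex_of_real n = 2 * (\<sigma> * cnj \<sigma>)" by (simp add: n_def complex_mult_cnj)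
  hence "Z = om * cnj \<sigma> / of_real n" using nz(1) by (simp add: Z_def)
  hence "Re Z = (- (1/2) * Re \<sigma> + sqrt 3 / 2 * Im \<sigma>) / n" "Im Z = (sqrt 3 / 2 * Re \<sigma> + 1/2 * Im \<sigma>) / n"
    by (simp_all add: om_def)
  hence Z: "0 < Re Z" "0 < Im Z" using a b n by simp_all
  have "Z = Y * X" using nz by (simp add: Z_def X_def)
  hence "Re Z * Re X + Im Z * Im X = Re Y * ((Re X)\<^sup>2 + (Im X)\<^sup>2)"
    by (simp add: power2_eq_square algebra_simps)
  moreover have "0 < (Re X)\<^sup>2 + (Im X)\<^sup>2" using RI by (auto simp: sum_power2_gt_zero_iff)
  ultimately have "0 < Re Z * Re X + Im Z * Im X" using ReY by simp
  have "0 < Im X"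
  proof (rule ccontr)
    assume "\<not> 0 < Im X"
    hence "Im X < 0" "Re X < 0" using RI by (auto simp: zero_less_mult_iff)
    hence "Re Z * Re X < 0" "Im Z * Im X < 0" using Z by (auto simp: mult_less_0_iff)
    thus False using \<open>0 < Re Z * Re X + Im Z * Im X\<close> by linarith
  qed
  thus ?thesis by (simp add: X_def \<sigma>_def Y_def v_def)
qed

lemma Im_Pfun_ray_mono:
  assumes "0 < r" "r < r'" shows "Im (Pfun (sig om r)) < Im (Pfun (sig om r'))"
proof (rule DERIV_pos_imp_increasing[of r r' "\<lambda>r. Im (Pfun (sig om r))"])
  fix x assume "r \<le> x" "x \<le> r'"
  hence x: "0 < x" using assms by simp
  have "((\<lambda>r. Pfun (sig om r)) has_vector_derivative (om / (2 * sig om x * csqrt (Yfun (of_real x * om))))) (at x)"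
    using x om_facts by (intro Pfun_sig_deriv) (auto simp: om_def)
  hence "((\<lambda>r. Im (Pfun (sig om r))) has_real_derivative (Im (om / (2 * sig om x * csqrt (Yfun (of_real x * om)))))) (at x)"
    unfolding has_real_derivative_iff_has_vector_derivative
    by (rule bounded_linear.has_vector_derivative[OF bounded_linear_Im])
  thus "\<exists>y. ((\<lambda>r. Im (Pfun (sig om r))) has_real_derivative y) (at x) \<and> 0 < y"
    using Im_ray_deriv_pos[OF x] by blast
qed (use assms in auto)

text \<open>Im P increases strictly along the ray, and at its foot v = 0, the branch point, it tends
  to \<open>A_top\<close>. The intermediate parameter r/2 keeps the inequality strict after the
  limit.\<close>

lemma Im_Pfun_ray_gt: assumes "0 < r" shows "A_top < Im (Pfun (sig om r))"
proof -
  have Sg: "sig om x \<in> Sig" "0 < Re (sig om x)" if "0 < x" for x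
    using that om_facts sig_cone[of om x] by (auto simp: om_def)
  define q where "q = r / 2"
  define X where "X = (\<lambda>n. q / real (n + 1))"
  have X: "0 < X n" "X n \<le> q" for n using assms by (auto simp: X_def q_def field_simps)
  have X0: "X \<longlonglongrightarrow> 0" unfolding X_def
    using LIMSEQ_ignore_initial_segment[OF lim_const_over_n[of q], of 1] by simp
  \<comment> \<open>The ray stays in Im s > 0, so |s + top_pt| >= 1/2, and |v| = |s - top_pt| |s +
    top_pt| controls the distance to the branch point.\<close>
  have bd: "cmod (sig om (X n) - top_pt) \<le> 2 * X n" for n
  proof -
    have "0 < Im ((sig om (X n))\<^sup>2)" using X(1)[of n] by (simp add: sig_def om_def)
    hence "0 < Re (sig om (X n)) * Im (sig om (X n))" by (simp add: power2_eq_square mult.commute)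
    hence "0 < Im (sig om (X n))" using Sg(2)[OF X(1)[of n]] by (rule zero_less_mult_pos)
    hence "1/2 \<le> cmod (sig om (X n) + top_pt)"
      using abs_Im_le_cmod[of "sig om (X n) + top_pt"] y_top_bounds by (simp add: top_pt_def)
    hence "cmod (sig om (X n) - top_pt) * (1/2) \<le> cmod (sig om (X n) - top_pt) * cmod (sig om (X n) + top_pt)"
      by (intro mult_left_mono) auto
    also have "\<dots> = cmod (vmap (sig om (X n)))" by (simp add: vmap_factor norm_mult)
    also have "\<dots> = X n" using X(1)[of n] om_facts by (simp add: vmap_sig norm_mult)
    finally show ?thesis by simp
  qed
  have "(\<lambda>n. sig om (X n) - top_pt) \<longlonglongrightarrow> 0"
  proof (rule Lim_null_comparison)
    show "\<forall>\<^sub>F n in sequentially. cmod (sig om (X n) - top_pt) \<le> 2 * X n" using bd by simp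
    show "(\<lambda>n. 2 * X n) \<longlonglongrightarrow> 0" using tendsto_mult_left[OF X0, of 2] by simp
  qed
  hence "(\<lambda>n. sig om (X n)) \<longlonglongrightarrow> top_pt" by (simp add: LIM_zero_iff)
  hence "(\<lambda>n. Pfun (sig om (X n))) \<longlonglongrightarrow> \<i> * of_real A_top" by (intro Pfun_top_lim Sg X)
  from tendsto_Im[OF this] have "(\<lambda>n. Im (Pfun (sig om (X n)))) \<longlonglongrightarrow> A_top" by simp
  moreover have "Im (Pfun (sig om (X n))) \<le> Im (Pfun (sig om q))" for n
    using Im_Pfun_ray_mono[of "X n" q] X[of n] by (cases "X n = q") auto
  ultimately have "A_top \<le> Im (Pfun (sig om q))" by (intro LIMSEQ_le_const2) auto
  also have "\<dots> < Im (Pfun (sig om r))" using assms by (intro Im_Pfun_ray_mono) (auto simp: q_def)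
  finally show ?thesis .
qed

text \<open>The equation describes both rays arg v = 2 pi/3 and -2 pi/3; conjugation carries the
  lower one to the upper.\<close>

lemma abs_Im_Pfun_ray:
  assumes "0 < Re s" "Re (vmap s) = - cmod (vmap s) / 2" shows "A_top < \<bar>Im (Pfun s)\<bar>"
proof -
  have *: "A_top < Im (Pfun s)" if s: "0 < Re s" "Re (vmap s) = - cmod (vmap s) / 2" "0 \<le> Im (vmap s)" for s
  proof -
    have "s \<in> Sig" using s by (auto simp: Sig_def)
    define r where "r = cmod (vmap s)"
    have r: "0 < r" using vmap_nz[OF \<open>s \<in> Sig\<close>] by (simp add: r_def)
    have "r\<^sup>2 = (Re (vmap s))\<^sup>2 + (Im (vmap s))\<^sup>2" by (simp add: r_def cmod_power2)
    hence "(Im (vmap s))\<^sup>2 = 3/4 * r\<^sup>2" using s(2) by (simp add: r_def power_divide)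
    also have "\<dots> = (sqrt 3 / 2 * r)\<^sup>2" by (simp add: power_mult_distrib power_divide)
    finally have "Im (vmap s) = sqrt 3 / 2 * r" using s(3) r by simp
    hence "vmap s = of_real r * om" using s(2) by (simp add: complex_eq_iff om_def r_def)
    hence "sig om r = s" by (rule sig_vmap[OF s(1)])
    thus ?thesis using Im_Pfun_ray_gt[OF r] by simp
  qed
  show ?thesis
  proof (cases "0 \<le> Im (vmap s)")
    case True thus ?thesis using *[of s] assms by simp
  next
    case False
    have S: "s \<in> Sig" using assms by (auto simp: Sig_def)
    have "A_top < Im (Pfun (cnj s))" using assms False by (intro *) (auto simp: vmap_cnj)
    thus ?thesis using Pfun_cnj[OF S] by simp
  qed
qed

text \<open>Closeness of squares determines the roots only up to sign; Re a > 0 and the sector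
  condition give |a + w| >= |w|/2, so this factor may be divided out of a^2 - w^2.\<close>

lemma near_root:
  assumes "0 < Re a" "cmod w / 2 \<le> Re w" "w \<noteq> 0" "cmod (a\<^sup>2 - w\<^sup>2) \<le> e * cmod (w\<^sup>2)"
  shows "cmod (a / w - 1) \<le> 2 * e"
proof -
  have w: "0 < cmod w" using assms by simp
  have "cmod w / 2 \<le> cmod (a + w)" using complex_Re_le_cmod[of "a + w"] assms(1,2) by simp
  hence "cmod (a - w) * (cmod w / 2) \<le> cmod (a - w) * cmod (a + w)" by (intro mult_left_mono) auto
  also have "\<dots> = cmod (a\<^sup>2 - w\<^sup>2)" by (simp add: power2_eq_square algebra_simps flip: norm_mult)
  also have "\<dots> \<le> e * cmod (w\<^sup>2)" by fact
  also have "\<dots> = (2 * e * cmod w) * (cmod w / 2)" by (simp add: norm_mult power2_eq_square)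
  finally have "cmod (a - w) \<le> 2 * e * cmod w" using w by simp
  moreover have "cmod (a / w - 1) = cmod (a - w) / cmod w" using assms(3) by (simp add: diff_divide_distrib flip: norm_divide)
  ultimately show ?thesis using w by (simp add: pos_divide_le_eq)
qed

lemma Re_inverse_near_1:
  assumes "cmod (z - 1) \<le> 1/4" shows "12/25 \<le> Re (inverse z)"
proof -
  have r: "3/4 \<le> Re z" using abs_Re_le_cmod[of "z - 1"] assms by simp
  have "cmod z \<le> 5/4" using norm_triangle_ineq[of "z - 1" 1] assms by simp
  hence "(cmod z)\<^sup>2 \<le> (5/4)\<^sup>2" by (intro power_mono) auto
  moreover have "z \<noteq> 0" using r by auto
  ultimately have "(3/4) / (5/4)\<^sup>2 \<le> Re z / (cmod z)\<^sup>2" using r by (intro frac_le) auto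
  hence "12/25 \<le> Re z / (cmod z)\<^sup>2" by (simp add: power2_eq_square)
  also have "Re z / (cmod z)\<^sup>2 = Re (inverse z)" by (simp add: cmod_power2)
  finally show ?thesis .
qed

text \<open>For large r both s and Y^(1/2) / c with c = sqrt(21/8) are close to csqrt v, so the
  derivative is close to 1/(2 c r). The threshold 40 makes the error in the squares, at most 2, no
  larger than r/20; then 12/25 / (2 c) >= 12/100 > 1/10 because c <= 2.\<close>

lemma growth_deriv:
  assumes "cmod u = 1" "-1/2 \<le> Re u" "40 \<le> r"
  shows "1 / (10 * r) \<le> Re (u / (2 * sig u r * csqrt (Yfun (of_real r * u))))"
proof -
  define v where "v = of_real r * u"
  define \<sigma> where "\<sigma> = sig u r"
  define w where "w = csqrt v"
  define Y where "Y = csqrt (Yfun v)"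
  define c where "c = sqrt (21/8)"
  have c: "0 < c" "c \<le> 2" "c\<^sup>2 = 21/8" by (auto simp: c_def intro!: real_le_lsqrt)
  have r: "0 < r" "Im u \<noteq> 0 \<or> v_plus < r" using assms v_plus_bounds by auto
  note sc = sig_cone[OF assms(1,2) r, folded \<sigma>_def]
  have vS: "vmap \<sigma> = v" by (simp add: \<sigma>_def v_def vmap_sig)
  have vn: "v \<notin> \<real>\<^sub>\<le>\<^sub>0" using sc(3) Sig_iff vS by auto
  have cv: "cmod v = r" using assms by (simp add: v_def norm_mult)
  have v0: "v \<noteq> 0" using vn by auto
  have w2: "w\<^sup>2 = v" by (simp add: w_def)
  have w0: "w \<noteq> 0" using v0 by (simp add: w_def)
  have ReY: "0 < Re Y" unfolding Y_def by (intro Re_csqrt_pos Yfun_nonpos_Reals vn)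
  have "-1/2 * r \<le> Re u * r" using assms by (intro mult_right_mono) auto
  hence "r / 4 \<le> (r + Re v) / 2" by (simp add: v_def mult.commute)
  hence "sqrt (r / 4) \<le> sqrt ((cmod v + Re v) / 2)" unfolding cv by simp
  hence Rw: "cmod w / 2 \<le> Re w" by (simp add: w_def cv real_sqrt_divide)
  have "cmod (\<sigma>\<^sup>2 - w\<^sup>2) = v_plus" using v_plus_bounds by (simp add: w2 \<sigma>_def sig_def v_def)
  also have "\<dots> \<le> 1/20 * cmod (w\<^sup>2)" using v_plus_bounds assms by (simp add: w2 cv)
  finally have e1: "cmod (\<sigma> / w - 1) \<le> 1/10" using near_root[OF sc(2) Rw w0] by fastforce
  have Yc2: "(Y / of_real c)\<^sup>2 = (v + 1/2) * (v - of_real v_minus) / v"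
  proof -
    have "complex_of_real (c\<^sup>2) = of_real (21/8)" using c(3) by (simp only:)
    hence c2: "(complex_of_real c)\<^sup>2 = 21/8" by simp
    show ?thesis unfolding power_divide Y_def power2_csqrt Yfun_def c2 by simp
  qed
  have "(Y / of_real c)\<^sup>2 - w\<^sup>2 = of_real (1/2 - v_minus) - of_real (v_minus / 2) / v"
    unfolding w2 Yc2 using v0 by (simp add: field_simps)
  also have "cmod \<dots> \<le> cmod (of_real (1/2 - v_minus)) + cmod (of_real (v_minus / 2) / v)" by (rule norm_triangle_ineq4)
  also have "\<dots> = \<bar>1/2 - v_minus\<bar> + \<bar>v_minus\<bar> / 2 / r" by (simp only: norm_of_real norm_divide cv abs_divide)
  also have "\<bar>v_minus\<bar> / 2 / r \<le> (1/2) / 1" using v_minus_bounds assms by (intro frac_le) auto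
  also have "\<bar>1/2 - v_minus\<bar> + (1/2) / 1 \<le> 1/20 * cmod (w\<^sup>2)" using v_minus_bounds assms by (simp add: w2 cv)
  finally have "cmod ((Y / of_real c)\<^sup>2 - w\<^sup>2) \<le> 1/20 * cmod (w\<^sup>2)" by simp
  moreover have "0 < Re (Y / of_real c)" using ReY c by simp
  ultimately have e2: "cmod (Y / of_real c / w - 1) \<le> 1/10" using near_root[OF _ Rw w0] by fastforce
  define a b where "a = \<sigma> / w" and "b = Y / of_real c / w"
  have ab: "cmod (a * b - 1) \<le> 1/4"
  proof -
    have "a * b - 1 = (a - 1) * (b - 1) + (a - 1) + (b - 1)" by (simp add: algebra_simps)
    hence "cmod (a * b - 1) \<le> cmod ((a - 1) * (b - 1)) + cmod (a - 1) + cmod (b - 1)"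
      using norm_triangle_ineq[of "(a - 1) * (b - 1) + (a - 1)" "b - 1"] norm_triangle_ineq[of "(a - 1) * (b - 1)" "a - 1"]
      by (simp only:)
    also have "\<dots> = cmod (a - 1) * cmod (b - 1) + cmod (a - 1) + cmod (b - 1)" by (simp only: norm_mult)
    also have "\<dots> \<le> 1/10 * (1/10) + 1/10 + 1/10"
      using e1 e2 unfolding a_def[symmetric] b_def[symmetric] by (intro add_mono mult_mono) auto
    finally show ?thesis by simp
  qed
  have nz: "\<sigma> \<noteq> 0" "Y \<noteq> 0" using sc(2) ReY by auto
  have "u / (2 * \<sigma> * Y) = of_real (1 / (2 * c * r)) * inverse (a * b)"
  proof -
    have "a * b = \<sigma> * Y / (of_real c * v)" by (simp add: a_def b_def power2_eq_square flip: w2)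
    hence "inverse (a * b) = of_real c * v / (\<sigma> * Y)" by simp
    thus ?thesis using c r by (simp add: v_def)
  qed
  hence "Re (u / (2 * \<sigma> * Y)) = 1 / (2 * c * r) * Re (inverse (a * b))" by simp
  also have "1 / (2 * c * r) * Re (inverse (a * b)) \<ge> 1 / (2 * c * r) * (12/25)"
    using Re_inverse_near_1[OF ab] c r by (intro mult_left_mono) auto
  moreover have "1 / (10 * r) \<le> 1 / (2 * c * r) * (12/25)"
    using c r by (simp add: field_simps)
  ultimately show ?thesis unfolding \<sigma>_def Y_def v_def by linarith
qed

text \<open>On each ray of the closed sector Re P - ln r / 10 is nondecreasing from r = 40 on, and
  its value at r = 40 is bounded below uniformly, since the directions form a compact arc.\<close>

lemma Re_Pfun_growth:
  obtains R where "\<And>s. \<lbrakk>0 < Re s; - cmod (vmap s) / 2 \<le> Re (vmap s); R < cmod (vmap s)\<rbrakk> \<Longrightarrow> K < Re (Pfun s)"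
proof -
  define S where "S = {u::complex. cmod u = 1} \<inter> {u. -1/2 \<le> Re u}"
  have Sg: "of_real r * u - of_real v_plus \<notin> \<real>\<^sub>\<le>\<^sub>0" "sig u r \<in> Sig" if "u \<in> S" "40 \<le> r" for u r
    using sig_cone[of u r] that v_plus_bounds by (auto simp: S_def)
  have "compact S" unfolding S_def
    by (intro compact_Int_closed closed_halfspace_Re_ge) (use compact_sphere[of "0::complex" 1] in \<open>simp add: sphere_def dist_norm\<close>)
  moreover have "continuous_on S (\<lambda>u. Pfun (sig u 40))"
  proof (rule continuous_on_compose2[OF holomorphic_on_imp_continuous_on[OF holomorphic_Pfun]])
    show "continuous_on S (\<lambda>u. sig u 40)" unfolding sig_def
      by (rule continuous_on_compose2[OF continuous_on_csqrt]) (use Sg[of _ 40] in \<open>auto intro!: continuous_intros\<close>)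
  qed (use Sg in auto)
  ultimately have "bounded ((\<lambda>u. Pfun (sig u 40)) ` S)" by (intro compact_imp_bounded compact_continuous_image)
  then obtain B where B: "\<And>u. u \<in> S \<Longrightarrow> cmod (Pfun (sig u 40)) \<le> B" by (auto simp: bounded_iff)
  show ?thesis
  \<comment> \<open>The exponential solves -B + (ln r - ln 40) / 10 = K for r.\<close>
  proof (rule that[of "max 40 (40 * exp (10 * (K + B)))"])
    fix s assume s: "0 < Re s" "- cmod (vmap s) / 2 \<le> Re (vmap s)" "max 40 (40 * exp (10 * (K + B))) < cmod (vmap s)"
    define r where "r = cmod (vmap s)"
    define u where "u = vmap s / of_real r"
    have r: "40 < r" "40 * exp (10 * (K + B)) < r" using s(3) by (auto simp: r_def)
    have vu: "vmap s = of_real r * u" using r by (simp add: u_def)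
    have "- r / 2 / r \<le> Re (vmap s) / r" using s(2) r by (intro divide_right_mono) (auto simp: r_def)
    hence u: "u \<in> S" using r by (auto simp: S_def u_def norm_divide r_def)
    define f where "f = (\<lambda>r. Re (Pfun (sig u r)) - ln r / 10)"
    have "f 40 \<le> f r"
    proof (rule DERIV_nonneg_imp_nondecreasing[of 40 r f])
      fix x assume x: "40 \<le> x" "x \<le> r"
      define d where "d = u / (2 * sig u x * csqrt (Yfun (of_real x * u)))"
      have "((\<lambda>r. Pfun (sig u r)) has_vector_derivative d) (at x)"
        unfolding d_def using u x v_plus_bounds by (intro Pfun_sig_deriv) (auto simp: S_def)
      hence "((\<lambda>r. Re (Pfun (sig u r))) has_real_derivative Re d) (at x)"
        unfolding has_real_derivative_iff_has_vector_derivative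
        by (rule bounded_linear.has_vector_derivative[OF bounded_linear_Re])
      moreover have "((\<lambda>r. ln r / 10) has_real_derivative (1 / x / 10)) (at x)"
        using x by (auto intro!: derivative_eq_intros)
      ultimately have "(f has_real_derivative (Re d - 1 / x / 10)) (at x)"
        unfolding f_def by (rule DERIV_diff)
      moreover have "0 \<le> Re d - 1 / x / 10" using growth_deriv[of u x] u x by (simp add: d_def S_def mult.commute)
      ultimately show "\<exists>y. (f has_real_derivative y) (at x) \<and> 0 \<le> y" by blast
    qed (use r in auto)
    moreover have "- B \<le> Re (Pfun (sig u 40))" using B[OF u] abs_Re_le_cmod[of "Pfun (sig u 40)"] by linarith
    moreover have "10 * (K + B) < ln r - ln 40"
    proof -
      have "ln (40 * exp (10 * (K + B))) < ln r" using r by (subst ln_less_cancel_iff) auto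
      thus ?thesis by (simp add: ln_mult)
    qed
    ultimately have "K < Re (Pfun (sig u r))" by (simp add: f_def)
    thus "K < Re (Pfun s)" using sig_vmap[OF s(1) vu] by simp
  qed
qed

section \<open>The inverse of the primitive\<close>

text \<open>The sector |arg v| < 2 pi/3 over the right half plane, written through Re v and |v| so
  that openness and passage to limits need no argument function.\<close>

definition Vset :: "complex set" where
  "Vset = {s. 0 < Re s \<and> - cmod (vmap s) / 2 < Re (vmap s)}"

lemma open_Vset: "open Vset"
proof -
  have c: "continuous_on UNIV vmap" unfolding vmap_def[abs_def] by (intro continuous_intros)
  have eq: "Vset = {s. 0 < Re s} \<inter> {s. - cmod (vmap s) / 2 < Re (vmap s)}" by (auto simp: Vset_def)
  have "open {s. - cmod (vmap s) / 2 < Re (vmap s)}"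
    by (intro open_Collect_less continuous_intros c) auto
  thus ?thesis unfolding eq by (rule open_Int[OF open_halfspace_Re_gt])
qed

lemma Vset_Sig_right: "Vset \<subseteq> Sig_right"
  by (auto simp: Vset_def Sig_right_def Sig_def)

lemma open_Pfun_Vset: "open (Pfun ` Vset)"
proof (rule open_mapping_thm3[OF _ open_Vset])
  show "Pfun holomorphic_on Vset"
    by (rule holomorphic_on_subset[OF holomorphic_Pfun]) (use Vset_Sig_right in \<open>auto simp: Sig_right_def\<close>)
  show "inj_on Pfun Vset" by (rule inj_on_subset[OF inj_on_Pfun_right Vset_Sig_right])
qed

lemma Pfun_top_lim':
  assumes "\<And>n. s n \<in> Sig" "s \<longlonglongrightarrow> l" "Re l = 0" "\<bar>Im l\<bar> = y_top"
  shows "(\<lambda>n. Re (Pfun (s n))) \<longlonglongrightarrow> 0"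
proof (cases "0 \<le> Im l")
  case True
  hence "l = top_pt" using assms(3,4) by (simp add: top_pt_def complex_eq_iff)
  from tendsto_Re[OF Pfun_top_lim[OF assms(1) assms(2)[unfolded this]]] show ?thesis by simp
next
  case False
  hence l: "- l = top_pt" using assms(3,4) by (simp add: top_pt_def complex_eq_iff)
  have "(\<lambda>n. - s n) \<longlonglongrightarrow> top_pt" unfolding l[symmetric] by (intro tendsto_intros assms)
  hence "(\<lambda>n. Pfun (- s n)) \<longlonglongrightarrow> \<i> * of_real A_top" by (intro Pfun_top_lim) (use assms in auto)
  from tendsto_minus[OF tendsto_Re[OF this]] show ?thesis using assms(1) by (simp add: Pfun_minus)
qed

text \<open>The growth of Re P bounds the preimages of a sequence converging to t, so a subsequence
  converges to some l in the closed sector. The limit cannot lie on a bounding ray, where |Im P| >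
  A_top, nor on the imaginary axis or at a branch point, where the limit of Re P would be 0.\<close>

lemma closure_Pfun_Vset:
  assumes "t \<in> closure (Pfun ` Vset)" "0 < Re t" "\<bar>Im t\<bar> \<le> A_top"
  shows "t \<in> Pfun ` Vset"
proof -
  obtain x where x: "\<And>n. x n \<in> Pfun ` Vset" "x \<longlonglongrightarrow> t"
    using assms(1) closure_sequential by blast
  from x(1) have "\<forall>n. \<exists>s. s \<in> Vset \<and> x n = Pfun s" by blast
  then obtain s0 where s0: "\<And>n. s0 n \<in> Vset" "\<And>n. x n = Pfun (s0 n)" by metis
  obtain R where R: "\<And>s. \<lbrakk>0 < Re s; - cmod (vmap s) / 2 \<le> Re (vmap s); R < cmod (vmap s)\<rbrakk> \<Longrightarrow> Re t + 1 < Re (Pfun s)"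
    using Re_Pfun_growth[of "Re t + 1"] by blast
  have "\<forall>\<^sub>F n in sequentially. Re (x n) < Re t + 1"
    by (rule order_tendstoD(2)[OF tendsto_Re[OF x(2)]]) simp
  then obtain N where N: "\<And>n. n \<ge> N \<Longrightarrow> Re (x n) < Re t + 1" by (auto simp: eventually_sequentially)
  define s1 where "s1 = (\<lambda>n. s0 (n + N))"
  have s1: "s1 n \<in> Vset" "Re (Pfun (s1 n)) < Re t + 1" for n
    using s0(1)[of "n + N"] s0(2)[of "n + N"] N[of "n + N"] by (auto simp: s1_def)
  have lim1: "(\<lambda>n. Pfun (s1 n)) \<longlonglongrightarrow> t"
    using LIMSEQ_ignore_initial_segment[OF x(2), of N] s0(2) by (simp add: s1_def)
  have bd: "cmod (s1 n) \<le> sqrt (R + v_plus)" for n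
  proof -
    have "cmod (vmap (s1 n)) \<le> R" using R[of "s1 n"] s1[of n] by (force simp: Vset_def)
    moreover have "s1 n ^ 2 = vmap (s1 n) - of_real v_plus" by (simp add: vmap_def)
    hence "cmod (s1 n) ^ 2 \<le> cmod (vmap (s1 n)) + cmod (of_real v_plus)"
      using norm_triangle_ineq4[of "vmap (s1 n)" "of_real v_plus"] by (simp flip: norm_power)
    ultimately have "cmod (s1 n) ^ 2 \<le> R + v_plus" using v_plus_bounds by simp
    thus ?thesis by (rule real_le_rsqrt)
  qed
  hence "bounded (range s1)" by (auto simp: bounded_iff)
  then obtain l r where r: "strict_mono r" "(s1 \<circ> r) \<longlonglongrightarrow> l"
    using bounded_imp_convergent_subsequence by blast
  define s where "s = s1 \<circ> r"
  have sV: "s n \<in> Vset" for n using s1(1) by (simp add: s_def)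
  hence sS: "s n \<in> Sig" for n using Vset_Sig_right by (auto simp: Sig_right_def)
  have sl: "s \<longlonglongrightarrow> l" using r by (simp add: s_def)
  have Ps: "(\<lambda>n. Pfun (s n)) \<longlonglongrightarrow> t"
    using LIMSEQ_subseq_LIMSEQ[OF lim1 r(1)] by (simp add: s_def o_def)
  have Rel: "0 \<le> Re l"
    by (rule LIMSEQ_le_const[OF tendsto_Re[OF sl]]) (use sV in \<open>auto simp: Vset_def intro: less_imp_le\<close>)
  have vl: "(\<lambda>n. vmap (s n)) \<longlonglongrightarrow> vmap l" unfolding vmap_def by (intro tendsto_intros sl)
  have cone: "- cmod (vmap l) / 2 \<le> Re (vmap l)"
  proof (rule LIMSEQ_le[OF _ tendsto_Re[OF vl]])
    show "(\<lambda>n. - cmod (vmap (s n)) / 2) \<longlonglongrightarrow> - cmod (vmap l) / 2" by (intro tendsto_intros vl) auto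
    show "\<exists>N. \<forall>n\<ge>N. - cmod (vmap (s n)) / 2 \<le> Re (vmap (s n))"
      using sV by (auto simp: Vset_def intro: less_imp_le)
  qed
  show ?thesis
  proof (cases "l \<in> Sig")
    case True
    have "(\<lambda>n. Pfun (s n)) \<longlonglongrightarrow> Pfun l" by (rule isCont_tendsto_compose[OF isCont_Pfun[OF True] sl])
    hence t: "t = Pfun l" using Ps LIMSEQ_unique by blast
    have "Re l \<noteq> 0"
    proof
      assume 0: "Re l = 0"
      hence "\<bar>Im l\<bar> < y_top" using True by (simp add: Sig_def)
      from Re_Pfun_sgn[OF this] 0 t assms(2) show False by simp
    qed
    hence pos: "0 < Re l" using Rel by simp
    have "Re (vmap l) \<noteq> - cmod (vmap l) / 2" using abs_Im_Pfun_ray[OF pos] t assms(3) by force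
    hence "l \<in> Vset" using pos cone by (simp add: Vset_def)
    thus ?thesis using t by blast
  next
    case False
    \<comment> \<open>Beyond the branch points the slits have v < 0, outside the closed sector; so l
      can only be a branch point.\<close>
    hence l0: "Re l = 0" "y_top \<le> \<bar>Im l\<bar>" by (auto simp: Sig_def)
    have "\<bar>Im l\<bar> = y_top"
    proof (rule ccontr)
      assume "\<bar>Im l\<bar> \<noteq> y_top"
      hence "y_top < \<bar>Im l\<bar>" using l0 by simp
      hence "y_top\<^sup>2 < \<bar>Im l\<bar>\<^sup>2" using y_top_pos by (intro power_strict_mono) auto
      hence neg: "v_plus - (Im l)\<^sup>2 < 0" using y_top_sq by simp
      have "vmap l = of_real (v_plus - (Im l)\<^sup>2)" using l0 by (simp add: vmap_def complex_eq_iff power2_eq_square)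
      hence "Re (vmap l) = v_plus - (Im l)\<^sup>2" "cmod (vmap l) = - (v_plus - (Im l)\<^sup>2)"
        using neg by (simp_all only: norm_of_real Re_complex_of_real abs_of_neg)
      thus False using cone neg by simp
    qed
    from Pfun_top_lim'[OF sS sl l0(1) this] tendsto_Re[OF Ps] have "Re t = 0" using LIMSEQ_unique by blast
    thus ?thesis using assms(2) by simp
  qed
qed

text \<open>The half strip is connected, and its intersection with P(Vset) is relatively open by the
  open mapping theorem, relatively closed by \<open>closure_Pfun_Vset\<close>, and contains
  P(1).\<close>

lemma Pfun_right_surj:
  assumes "0 < Re t" "\<bar>Im t\<bar> \<le> A_top" shows "\<exists>s. 0 < Re s \<and> Pfun s = t"
proof -
  define R where "R = {t. 0 < Re t} \<inter> ({t. Im t \<le> A_top} \<inter> {t. - A_top \<le> Im t})"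
  have "convex R" unfolding R_def
    by (intro convex_Int convex_halfspace_Re_gt convex_halfspace_Im_le) (rule convex_halfspace_Im_ge)
  hence "connected R" by (rule convex_connected)
  moreover have "openin (top_of_set R) (R \<inter> Pfun ` Vset)" by (rule openin_open_Int[OF open_Pfun_Vset])
  moreover have "R \<inter> Pfun ` Vset = R \<inter> closure (Pfun ` Vset)"
    using closure_Pfun_Vset closure_subset[of "Pfun ` Vset"] by (auto simp: R_def)
  hence "closedin (top_of_set R) (R \<inter> Pfun ` Vset)" using closedin_closed_Int[OF closed_closure] by metis
  ultimately have "R \<inter> Pfun ` Vset = {} \<or> R \<inter> Pfun ` Vset = R" unfolding connected_clopen by blast
  moreover have "Pfun 1 \<in> R \<inter> Pfun ` Vset"
  proof -
    have "vmap 1 = of_real (1 + v_plus)" by (simp add: vmap_def)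
    hence "cmod (vmap 1) = 1 + v_plus" "Re (vmap 1) = 1 + v_plus"
      using v_plus_bounds by (simp_all only: norm_of_real Re_complex_of_real)
    moreover have "0 < 1 + v_plus" using v_plus_bounds by linarith
    hence "- ((1 + v_plus) / 2) < 1 + v_plus" by (smt (verit) divide_pos_pos)
    ultimately have "1 \<in> Vset" by (simp add: Vset_def)
    moreover have "sgn (Re (Pfun 1)) = 1" using Re_Pfun_sgn[of 1] y_top_pos by simp
    hence "0 < Re (Pfun 1)" by (simp add: sgn_1_pos)
    moreover have "Im (Pfun 1) = 0" using Im_Pfun_real[of 1] by (simp add: Sig_def)
    ultimately show ?thesis using A_top_pos by (simp add: R_def)
  qed
  ultimately have "R \<subseteq> Pfun ` Vset" by blast
  moreover have "t \<in> R" using assms by (auto simp: R_def)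
  ultimately show ?thesis by (auto simp: Vset_def)
qed

text \<open>Near the slits there are points with Re s > 0 and Re (P s) < 0, so P is not injective on all of
  \<^term>\<open>Sig\<close>; the sign condition removes them.\<close>
definition Uset :: "complex set" where
  "Uset = {s \<in> Sig. sgn (Re (Pfun s)) = sgn (Re s)}"

lemma Uset_strip: "\<bar>Im s\<bar> < y_top \<Longrightarrow> s \<in> Uset"
  using Re_Pfun_sgn by (simp add: Uset_def Sig_def)

lemma Uset_Sig: "Uset \<subseteq> Sig" by (auto simp: Uset_def)

text \<open>The sign condition is not visibly open at Re s = 0. There |Im s| < y_top, and the whole
  open strip around such points lies in \<open>Uset\<close>.\<close>

lemma open_Uset: "open Uset"
proof -
  define W where "W = {s. \<bar>Im s\<bar> < y_top} \<union> (Sig \<inter> {s. 0 < Re s} \<inter> Pfun -` {t. 0 < Re t}) 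
     \<union> (Sig \<inter> {s. Re s < 0} \<inter> Pfun -` {t. Re t < 0})"
  have eq: "Uset = W"
  proof (intro equalityI subsetI)
    fix s assume s: "s \<in> Uset"
    hence "Re s = 0 \<Longrightarrow> \<bar>Im s\<bar> < y_top" by (auto simp: Uset_def Sig_def)
    thus "s \<in> W" using s by (auto simp: Uset_def W_def sgn_if split: if_splits)
  next
    fix s assume "s \<in> W" thus "s \<in> Uset" using Uset_strip by (auto simp: Uset_def W_def)
  qed
  have "open {s. \<bar>Im s\<bar> < y_top}"
    by (intro open_Collect_less continuous_intros)
  moreover have "open (Sig \<inter> A \<inter> Pfun -` B)" if "open A" "open B" for A B
    by (intro continuous_open_preimage open_Int open_Sig that
        continuous_on_subset[OF holomorphic_on_imp_continuous_on[OF holomorphic_Pfun] Int_lower1])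
  note this[OF open_halfspace_Re_gt[of 0] open_halfspace_Re_gt[of 0]]
    this[OF open_halfspace_Re_lt[of 0] open_halfspace_Re_lt[of 0]]
  ultimately show ?thesis unfolding eq W_def by (intro open_Un)
qed

text \<open>On \<open>Uset\<close> the value of P determines the sign of Re s. Two points with one
  value thus lie both in \<open>Sig_right\<close>, or their negatives do and P is odd.\<close>

lemma inj_on_Pfun_Uset: "inj_on Pfun Uset"
proof (rule inj_onI)
  fix a b assume a: "a \<in> Uset" and b: "b \<in> Uset" and eq: "Pfun a = Pfun b"
  hence sg: "sgn (Re a) = sgn (Re b)" by (auto simp: Uset_def)
  have S: "a \<in> Sig" "b \<in> Sig" using a b Uset_Sig by auto
  show "a = b"
  proof (cases "0 \<le> Re a")
    case True
    hence "0 \<le> Re b" using sg by (auto simp: sgn_if split: if_splits)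
    thus ?thesis using inj_onD[OF inj_on_Pfun_right eq] True S by (simp add: Sig_right_def)
  next
    case False
    hence "Re b < 0" using sg by (auto simp: sgn_if split: if_splits)
    moreover have "Pfun (- a) = Pfun (- b)" using eq S by (simp add: Pfun_minus)
    ultimately have "- a = - b" using inj_onD[OF inj_on_Pfun_right, of "- a" "- b"] False S by (simp add: Sig_right_def)
    thus ?thesis by simp
  qed
qed

lemma Uset_minus: "s \<in> Uset \<Longrightarrow> - s \<in> Uset"
  by (simp add: Uset_def Pfun_minus sgn_minus)

lemma Uset_cnj: "s \<in> Uset \<Longrightarrow> cnj s \<in> Uset"
  by (simp add: Uset_def Pfun_cnj)

definition Wset :: "complex set" where "Wset = Pfun ` Uset"

text \<open>The right half strip comes from \<open>Pfun_right_surj\<close>, the left one from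
  oddness, the imaginary segment from the intermediate value theorem; only the two branch values are
  left out.\<close>

lemma Wset_strip:
  assumes "\<bar>Im t\<bar> \<le> A_top" "Re t \<noteq> 0 \<or> \<bar>Im t\<bar> < A_top" shows "t \<in> Wset"
proof -
  have right: "t \<in> Wset" if t: "0 < Re t" "\<bar>Im t\<bar> \<le> A_top" for t
  proof -
    obtain s where s: "0 < Re s" "Pfun s = t" using Pfun_right_surj[OF t] by blast
    hence "s \<in> Uset" using t by (simp add: Uset_def Sig_def)
    thus ?thesis using s by (auto simp: Wset_def)
  qed
  consider "0 < Re t" | "Re t = 0" | "Re t < 0" by linarith
  thus ?thesis
  proof cases
    case 1 thus ?thesis using right assms by blast
  next
    case 2
    then obtain x where x: "\<bar>x\<bar> < y_top" "Pfun (\<i> * of_real x) = \<i> * of_real (Im t)"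
      using Pfun_imag_surj[of "Im t"] assms by auto
    have U: "\<i> * of_real x \<in> Uset" using x by (intro Uset_strip) auto
    have "Pfun (\<i> * of_real x) = t" using 2 x(2) by (simp add: complex_eq_iff)
    thus ?thesis using imageI[OF U, of Pfun] by (simp add: Wset_def)
  next
    case 3
    hence "- t \<in> Pfun ` Uset" using right[of "- t"] assms unfolding Wset_def by simp
    then obtain s where s: "- t = Pfun s" "s \<in> Uset" by (rule imageE)
    have "s \<in> Sig" using s(2) Uset_Sig by blast
    hence "Pfun (- s) = t" using Pfun_minus[of s] s(1) by (metis minus_minus)
    thus ?thesis using imageI[OF Uset_minus[OF s(2)], of Pfun] by (simp add: Wset_def)
  qed
qed

section \<open>The analytic extension of q\<close>

definition Qfun :: "complex \<Rightarrow> complex" where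
  "Qfun t = (let v = vmap (the_inv_into Uset Pfun t) in v / (1 + v))"

lemma Qfun_Pfun: "s \<in> Uset \<Longrightarrow> Qfun (Pfun s) = vmap s / (1 + vmap s)"
  by (simp add: Qfun_def the_inv_into_f_f[OF inj_on_Pfun_Uset] Let_def)

lemma holomorphic_Pfun_Uset: "Pfun holomorphic_on Uset"
  by (rule holomorphic_on_subset[OF holomorphic_Pfun Uset_Sig])

lemma open_Wset: "open Wset"
  unfolding Wset_def by (rule open_mapping_thm3[OF holomorphic_Pfun_Uset open_Uset inj_on_Pfun_Uset])

text \<open>The possible pole v = -1 lies on the cut that v avoids on \<open>Sig\<close>.\<close>

lemma holomorphic_Qfun: "Qfun holomorphic_on Wset"
proof -
  obtain g where g0: "g holomorphic_on Pfun ` Uset" and g2: "\<And>z. z \<in> Uset \<Longrightarrow> g (Pfun z) = z"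
    by (rule holomorphic_has_inverse[OF holomorphic_Pfun_Uset open_Uset inj_on_Pfun_Uset]) blast
  have g1: "g holomorphic_on Wset" using g0 by (simp only: Wset_def)
  have gU: "g t \<in> Uset" if tW: "t \<in> Wset" for t
  proof -
    obtain s where "t = Pfun s" "s \<in> Uset" using tW unfolding Wset_def by (rule imageE)
    thus ?thesis using g2 by simp
  qed
  have nz: "1 + vmap (g t) \<noteq> 0" if "t \<in> Wset" for t
  proof
    assume "1 + vmap (g t) = 0"
    hence "vmap (g t) = -1" by (simp add: add_eq_0_iff)
    hence "vmap (g t) \<in> \<real>\<^sub>\<le>\<^sub>0" by (simp add: complex_nonpos_Reals_iff)
    moreover have "g t \<in> Sig" using gU[OF that] Uset_Sig by blast
    ultimately show False using Sig_iff by blast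
  qed
  have "(\<lambda>t. vmap (g t)) holomorphic_on Wset" unfolding vmap_def by (intro holomorphic_intros g1)
  hence "(\<lambda>t. vmap (g t) / (1 + vmap (g t))) holomorphic_on Wset" using nz by (intro holomorphic_intros) auto
  thus ?thesis
  proof (rule holomorphic_transform)
    fix t assume "t \<in> Wset"
    then obtain s where "t = Pfun s" "s \<in> Uset" unfolding Wset_def by (rule imageE)
    thus "vmap (g t) / (1 + vmap (g t)) = Qfun t" using g2 Qfun_Pfun by simp
  qed
qed

lemma Qfun_cnj: assumes "t \<in> Wset" shows "cnj t \<in> Wset" "Qfun (cnj t) = cnj (Qfun t)"
proof -
  obtain s where s: "s \<in> Uset" "t = Pfun s" using assms by (auto simp: Wset_def)
  hence c: "Pfun (cnj s) = cnj t" using Uset_Sig by (auto simp: Pfun_cnj)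
  show "cnj t \<in> Wset" unfolding c[symmetric] Wset_def by (rule imageI[OF Uset_cnj[OF s(1)]])
  show "Qfun (cnj t) = cnj (Qfun t)"
    using Qfun_Pfun[OF s(1)] Qfun_Pfun[OF Uset_cnj[OF s(1)]] c s(2) by (simp add: vmap_cnj)
qed

section \<open>The separatrix on the real line\<close>

text \<open>On (0, pi) the root in V equals 2 q, and the energy relation becomes 3 q L^2 = 5 q - 4
  q^3 - 1, a cubic with roots 1, \<open>a_plus\<close>, \<open>a_minus\<close>. The left side is
  nonnegative, which forces q >= a_plus.\<close>

lemma pend_energy:
  assumes "0 < l" "l < pi" "H_pend l L = - 1/2"
  defines "q \<equiv> cos (l / 2)"
  shows "0 < q" "q < 1" "3 * q * L\<^sup>2 = 4 * (1 - q) * (q - a_plus) * (q - a_minus)" "a_plus \<le> q"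
proof -
  show q0: "0 < q" unfolding q_def using assms by (intro cos_gt_zero_pi) auto
  have "cos (l / 2) < cos 0" using assms by (intro cos_monotone_0_pi) auto
  thus q1: "q < 1" by (simp add: q_def)
  have cl: "cos l = 2 * q\<^sup>2 - 1" using cos_double_cos[of "l / 2"] by (simp add: q_def)
  have u: "2 + 2 * cos l = (2 * q)\<^sup>2" by (simp add: cl power_mult_distrib)
  have "sqrt (2 + 2 * cos l) = 2 * q" unfolding u real_sqrt_abs using q0 by simp
  hence V: "V_pend l = 2 - 2 * q\<^sup>2 - 1 / (2 * q)" by (simp add: V_pend_def cl)
  have "- (3/2) * L\<^sup>2 + (2 - 2 * q\<^sup>2 - 1 / (2 * q)) = - 1/2" using assms(3) unfolding H_pend_def V .
  hence "L\<^sup>2 = (2/3) * (5/2 - 2 * q\<^sup>2 - 1 / (2 * q))" by (simp add: field_simps)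
  hence "3 * q * L\<^sup>2 = 2 * q * (5/2 - 2 * q\<^sup>2 - 1 / (2 * q))" by simp
  also have "\<dots> = 5 * q - 4 * q ^ 3 - 1" using q0 by (simp add: field_simps power2_eq_square power3_eq_cube)
  also have "\<dots> = 4 * (1 - q) * (q\<^sup>2 + q - 1/4)" by (simp add: field_simps power2_eq_square power3_eq_cube)
  also have "\<dots> = 4 * (1 - q) * ((q - a_plus) * (q - a_minus))" by (simp only: a_roots)
  finally show e: "3 * q * L\<^sup>2 = 4 * (1 - q) * (q - a_plus) * (q - a_minus)" by (simp only: mult.assoc)
  show "a_plus \<le> q"
  proof (rule ccontr)
    assume "\<not> a_plus \<le> q"
    hence "(4 * (1 - q) * (q - a_minus)) * (q - a_plus) < 0" using q0 q1 a_minus_neg by (intro mult_pos_neg mult_pos_pos) auto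
    moreover have "0 \<le> 3 * q * L\<^sup>2" using q0 by simp
    ultimately show False unfolding e by (simp add: mult_ac)
  qed
qed

text \<open>V' = sin l (1 - 1/(8 q^3)) and q = a_plus < 1/4. So the momentum has positive derivative
  whenever it vanishes, which decides its sign for t > 0.\<close>

lemma deriv_V_pend_neg:
  assumes "0 < l" "l < pi" "cos (l / 2) = a_plus" shows "deriv V_pend l < 0"
proof -
  define q where "q = cos (l / 2)"
  have q: "0 < q" "q < 1/4" using assms a_plus_bounds by (auto simp: q_def)
  have cl: "cos l = 2 * q\<^sup>2 - 1" using cos_double_cos[of "l / 2"] by (simp add: q_def)
  have u: "2 + 2 * cos l = (2 * q)\<^sup>2" by (simp add: cl power_mult_distrib)
  have s: "sqrt (2 + 2 * cos l) = 2 * q" unfolding u real_sqrt_abs using q by simp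
  have up: "0 < 2 + 2 * cos l" unfolding u using q by simp
  have "((\<lambda>l. 2 + 2 * cos l) has_real_derivative (- 2 * sin l)) (at l)" by (auto intro!: derivative_eq_intros)
  hence d: "((\<lambda>l. sqrt (2 + 2 * cos l)) has_real_derivative (inverse (2 * q) / 2 * (- 2 * sin l))) (at l)"
    using DERIV_chain2[where f = sqrt and g = "\<lambda>l. 2 + 2 * cos l", OF DERIV_real_sqrt[OF up]] unfolding s by blast
  have "(V_pend has_real_derivative (sin l - (- (inverse (2 * q) / 2 * (- 2 * sin l)) / (2 * q)\<^sup>2))) (at l)"
    unfolding V_pend_def[abs_def] using q up
    by (auto intro!: derivative_eq_intros d simp: s power2_eq_square)
  moreover have "sin l - (- (inverse (2 * q) / 2 * (- 2 * sin l)) / (2 * q)\<^sup>2) = sin l * (1 - 1 / (8 * q ^ 3))"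
    using q by (simp add: field_simps power2_eq_square power3_eq_cube)
  ultimately have "deriv V_pend l = sin l * (1 - 1 / (8 * q ^ 3))" by (simp add: DERIV_imp_deriv)
  moreover have "0 < sin l" using assms by (intro sin_gt_zero)
  moreover have "q ^ 3 < (1/4) ^ 3" using q by (intro power_strict_mono) auto
  hence "8 * q ^ 3 < 1" by (simp add: power3_eq_cube)
  hence "1 - 1 / (8 * q ^ 3) < 0" using q by (simp add: field_simps)
  ultimately show ?thesis by (simp add: mult_pos_neg)
qed

text \<open>At the first zero after 0 the function would arrive from positive values, contradicting
  its positive derivative there.\<close>

lemma pos_after_zero:
  fixes f :: "real \<Rightarrow> real"
  assumes "f 0 = 0" "\<And>t. (f has_real_derivative f' t) (at t)" "\<And>t. f t = 0 \<Longrightarrow> 0 < f' t" "0 < t"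
  shows "0 < f t"
proof (rule ccontr)
  assume nt: "\<not> 0 < f t"
  have "0 < f' 0" using assms by blast
  then obtain d where d: "0 < d" "\<And>h. 0 < h \<Longrightarrow> h < d \<Longrightarrow> f 0 < f (0 + h)"
    using DERIV_pos_inc_right[OF assms(2)[of 0]] by blast
  define e where "e = min (d / 2) t"
  have e: "0 < e" "e \<le> t" "e < d" using d(1) assms(4) by (auto simp: e_def)
  have cont: "continuous_on {e..t} f" by (rule DERIV_continuous_on[OF has_field_derivative_at_within[OF assms(2)]])
  have "{x \<in> {e..t}. f x \<le> 0} = {e..t} \<inter> f -` {..0}" by auto
  moreover have "closed ({e..t} \<inter> f -` {..0})" by (intro continuous_closed_preimage cont) auto
  ultimately have cl: "closed {x \<in> {e..t}. f x \<le> 0}" by simp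
  have "compact ({e..t} \<inter> {x \<in> {e..t}. f x \<le> 0})" by (intro compact_Int_closed cl) auto
  moreover have "t \<in> {e..t} \<inter> {x \<in> {e..t}. f x \<le> 0}" using nt e by auto
  ultimately obtain s where s: "s \<in> {e..t} \<inter> {x \<in> {e..t}. f x \<le> 0}" "\<And>x. x \<in> {e..t} \<inter> {x \<in> {e..t}. f x \<le> 0} \<Longrightarrow> s \<le> x"
    using compact_attains_inf[of "{e..t} \<inter> {x \<in> {e..t}. f x \<le> 0}"] by blast
  have fe: "0 < f e" using d(2)[OF e(1,3)] assms(1) by simp
  have se: "e < s" using s(1) fe by (cases "s = e") auto
  have before: "0 < f x" if "e \<le> x" "x < s" for x
  proof (rule ccontr)
    assume "\<not> 0 < f x"
    hence "s \<le> x" using s(1) that by (intro s(2)) auto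
    thus False using that by simp
  qed
  have "f s = 0"
  proof (rule ccontr)
    assume "f s \<noteq> 0"
    hence "f s < 0" using s(1) by auto
    hence "\<exists>x\<ge>e. x \<le> s \<and> f x = 0" 
      using fe se by (intro IVT2') (auto intro!: DERIV_continuous_on[OF has_field_derivative_at_within[OF assms(2)]])
    then obtain x where x: "e \<le> x" "x \<le> s" "f x = 0" by blast
    hence "x < s" using \<open>f s < 0\<close> by (cases "x = s") auto
    thus False using before[OF x(1)] x(3) by simp
  qed
  then obtain d' where d': "0 < d'" "\<And>h. 0 < h \<Longrightarrow> h < d' \<Longrightarrow> f (s - h) < f s"
    using DERIV_pos_inc_left[OF assms(2)[of s]] assms(3) by blast
  define h where "h = min (d' / 2) (s - e)"
  have "0 < h" "h < d'" "e \<le> s - h" "s - h < s" using d'(1) se by (auto simp: h_def)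
  thus False using d'(2)[of h] before[of "s - h"] \<open>f s = 0\<close> by simp
qed

lemma Gfun_real:
  assumes "0 \<le> x" defines "v \<equiv> x\<^sup>2 + v_plus"
  shows "Gfun (of_real x) = of_real (1 / sqrt (21/8 * ((v + 1/2) * (v - v_minus) / v)))"
    "0 < 21/8 * ((v + 1/2) * (v - v_minus) / v)"
proof -
  have v: "0 < v" "0 < v - v_minus" using v_plus_bounds v_minus_bounds zero_le_power2[of x] unfolding v_def by linarith+
  thus pos: "0 < 21/8 * ((v + 1/2) * (v - v_minus) / v)" by simp
  have "vmap (of_real x) = of_real v" by (simp add: vmap_def v_def)
  moreover have "Yfun (of_real v) = of_real (21/8 * ((v + 1/2) * (v - v_minus) / v))" by (simp add: Yfun_def)
  ultimately show "Gfun (of_real x) = of_real (1 / sqrt (21/8 * ((v + 1/2) * (v - v_minus) / v)))"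
    using pos by (simp add: Gfun_def)
qed

text \<open>The left side is the square of dv/dt. As v = s^2 + v_plus, the identity says (ds/dt)^2 =
  Y(v).\<close>

lemma flow_algebra:
  fixes q L S v :: real
  assumes "0 < q" "q < 1" "3 * q * L\<^sup>2 = 4 * (1 - q) * (q - a_plus) * (q - a_minus)" "S\<^sup>2 = 1 - q\<^sup>2" "v = q / (1 - q)"
  shows "(3/2 * S * L / (1 - q)\<^sup>2)\<^sup>2 = 4 * (v - v_plus) * (21/8 * ((v + 1/2) * (v - v_minus) / v))"
proof -
  have v: "0 < v" using assms by simp
  have q1: "1 - q \<noteq> 0" using assms by simp
  have vv: "(v - v_plus) * (v - v_minus) = v\<^sup>2 + 2 * v / 7 - 1/7"
    by (simp add: v_plus_def v_minus_def field_simps power2_eq_square)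
  have e: "3 * q * L\<^sup>2 = 4 * (1 - q) * (q\<^sup>2 + q - 1/4)" 
    using assms(3) a_roots[of q] by (simp only: mult.assoc)
  have "4 * (v - v_plus) * (21/8 * ((v + 1/2) * (v - v_minus) / v)) = 21/2 * (v + 1/2) * ((v - v_plus) * (v - v_minus)) / v"
  proof -
    have "4 * a * (21/8 * (b * d / c)) = 21/2 * b * (a * d) / c" for a b c d :: real by simp
    thus ?thesis .
  qed
  also have "21/2 * (v + 1/2) * ((v - v_plus) * (v - v_minus)) = 3/4 * ((2 * v + 1) * (7 * v\<^sup>2 + 2 * v - 1))"
    unfolding vv by (simp add: field_simps)
  also have "3/4 * ((2 * v + 1) * (7 * v\<^sup>2 + 2 * v - 1)) / v
      = 3/4 * ((2 * v + 1) * (7 * v\<^sup>2 + 2 * v - 1) * (1 - q) ^ 3) / (v * (1 - q) ^ 3)"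
  proof -
    have "a * X / v = a * (X * k) / (v * k)" if "k \<noteq> 0" for a X k :: real using that by simp
    moreover have "(1 - q) ^ 3 \<noteq> 0" using q1 by simp
    ultimately show ?thesis by blast
  qed
  also have "(2 * v + 1) * (7 * v\<^sup>2 + 2 * v - 1) * (1 - q) ^ 3 
      = (2 * (v * (1 - q)) + (1 - q)) * (7 * (v * (1 - q))\<^sup>2 + 2 * (v * (1 - q)) * (1 - q) - (1 - q)\<^sup>2)"
    by (simp add: power2_eq_square power3_eq_cube algebra_simps)
  also have vq: "v * (1 - q) = q" using assms by simp
  also have "(2 * q + (1 - q)) * (7 * q\<^sup>2 + 2 * q * (1 - q) - (1 - q)\<^sup>2) = 4 * (1 + q) * (q\<^sup>2 + q - 1/4)"
    by (simp add: power2_eq_square field_simps)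
  also have "v * (1 - q) ^ 3 = q * (1 - q)\<^sup>2" 
    using vq by (simp add: power2_eq_square power3_eq_cube flip: mult.assoc)
  finally have R0: "4 * (v - v_plus) * (21/8 * ((v + 1/2) * (v - v_minus) / v)) = 3/4 * (4 * (1 + q) * (q\<^sup>2 + q - 1/4)) / (q * (1 - q)\<^sup>2)" .
  have R: "4 * (v - v_plus) * (21/8 * ((v + 1/2) * (v - v_minus) / v)) = 3 * (1 + q) * (q\<^sup>2 + q - 1/4) / (q * (1 - q)\<^sup>2)"
  proof -
    have "3/4 * (4 * a * b) / d = 3 * a * b / d" for a b d :: real by simp
    from R0[unfolded this] show ?thesis .
  qed
  have "(3/2 * S * L / (1 - q)\<^sup>2)\<^sup>2 = 9/4 * S\<^sup>2 * L\<^sup>2 / ((1 - q)\<^sup>2)\<^sup>2"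
    by (simp add: power_mult_distrib power_divide)
  also have "\<dots> = 3/4 * S\<^sup>2 * (3 * q * L\<^sup>2) / (q * ((1 - q)\<^sup>2)\<^sup>2)" using assms(1) by simp
  also have "\<dots> = 3/4 * ((1 - q) * (1 + q)) * (4 * (1 - q) * (q\<^sup>2 + q - 1/4)) / (q * ((1 - q)\<^sup>2)\<^sup>2)"
    unfolding e assms(4) by (simp add: power2_eq_square algebra_simps)
  also have "\<dots> = (3 * (1 + q) * (q\<^sup>2 + q - 1/4)) * (1 - q)\<^sup>2 / (q * (1 - q)\<^sup>2 * (1 - q)\<^sup>2)"
    by (simp add: power2_eq_square mult_ac)
  also have "\<dots> = 3 * (1 + q) * (q\<^sup>2 + q - 1/4) / (q * (1 - q)\<^sup>2)" using q1 by simp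
  finally show ?thesis using R by simp
qed

text \<open>For t > 0 the momentum is positive, so v increases and s = sqrt(v - v_plus) satisfies
  ds/dt = sqrt Y, the reciprocal of G. Hence P along the orbit advances at unit speed.\<close>

lemma flow_half:
  fixes lh Lh :: "real \<Rightarrow> real"
  assumes ode1: "\<And>t. (lh has_real_derivative (- 3 * Lh t)) (at t)"
    and ode2: "\<And>t. (Lh has_real_derivative (- deriv V_pend (lh t))) (at t)"
    and range: "\<And>t. 0 < lh t \<and> lh t < pi"
    and energy: "\<And>t. H_pend (lh t) (Lh t) = - 1/2"
    and init: "Lh 0 = 0" and T: "0 \<le> T"
  defines "v \<equiv> \<lambda>t. cos (lh t / 2) / (1 - cos (lh t / 2))"
  shows "v_plus \<le> v T" "Pfun (of_real (sqrt (v T - v_plus))) = of_real T"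
proof -
  define q where "q = (\<lambda>t. cos (lh t / 2))"
  have vq: "v t = q t / (1 - q t)" for t by (simp add: v_def q_def)

  have q: "0 < q t" "q t < 1" "3 * q t * (Lh t)\<^sup>2 = 4 * (1 - q t) * (q t - a_plus) * (q t - a_minus)" "a_plus \<le> q t" for t
    using pend_energy[of "lh t" "Lh t"] range energy unfolding q_def by auto
  have vp: "v_plus \<le> v t" for t
    unfolding vq v_plus_a_plus using q[of t] a_plus_bounds by (intro frac_le) auto
  show "v_plus \<le> v T" by (rule vp)
  have zero: "q t = a_plus" if "Lh t = 0" for t
    using q[of t] that a_minus_neg a_plus_bounds by auto
  have Lpos: "0 < Lh t" if "0 < t" for t
  proof (rule pos_after_zero[OF init ode2 _ that])
    fix t assume "Lh t = 0"
    hence "cos (lh t / 2) = a_plus" using zero by (simp add: q_def)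
    thus "0 < - deriv V_pend (lh t)" using deriv_V_pend_neg range by simp
  qed
  have vgt: "v_plus < v t" if "0 < t" for t
  proof -
    have "q t \<noteq> a_plus" using q(1,3)[of t] Lpos[OF that] by auto
    hence "a_plus < q t" using q(4)[of t] by simp
    thus ?thesis unfolding vq v_plus_a_plus using q[of t] a_plus_bounds by (intro frac_less) auto
  qed
  have qd: "(q has_real_derivative (3/2 * sin (lh t / 2) * Lh t)) (at t)" for t
    unfolding q_def by (auto intro!: derivative_eq_intros ode1)
  have vd: "(v has_real_derivative (3/2 * sin (lh t / 2) * Lh t / (1 - q t)\<^sup>2)) (at t)" for t
  proof -
    have "((\<lambda>t. q t / (1 - q t)) has_real_derivative (3/2 * sin (lh t / 2) * Lh t / (1 - q t)\<^sup>2)) (at t)"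
      using q(2)[of t] by (auto intro!: derivative_eq_intros qd simp: field_simps power2_eq_square)
    moreover have "v = (\<lambda>t. q t / (1 - q t))" by (rule ext) (rule vq)
    ultimately show ?thesis by (simp only:)
  qed
  define x where "x = (\<lambda>t. sqrt (v t - v_plus))"
  \<comment> \<open>The derivative of the root x is computed only for t > 0, where v > v_plus; at t
    = 0 continuity of F is enough to conclude that F is constant.\<close>
  define F where "F = (\<lambda>t. Re (Pfun (of_real (x t))) - t)"
  have Sg: "complex_of_real r \<in> Sig" for r using y_top_pos by (simp add: Sig_def)
  have xcont: "isCont x t" for t
    unfolding x_def by (intro continuous_intros DERIV_isCont[OF vd])
  have xd: "(x has_real_derivative sqrt (21/8 * ((v t + 1/2) * (v t - v_minus) / v t))) (at t)" if "0 < t" for t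
  proof -
    have pos: "0 < v t - v_plus" using vgt[OF that] by simp
    have "((\<lambda>t. v t - v_plus) has_real_derivative (3/2 * sin (lh t / 2) * Lh t / (1 - q t)\<^sup>2)) (at t)"
      using DERIV_diff[OF vd DERIV_const] by simp
    hence "(x has_real_derivative (inverse (sqrt (v t - v_plus)) / 2 * (3/2 * sin (lh t / 2) * Lh t / (1 - q t)\<^sup>2))) (at t)"
      unfolding x_def using DERIV_chain2[where f = sqrt and g = "\<lambda>t. v t - v_plus", OF DERIV_real_sqrt[OF pos]] by blast
    also have "inverse (sqrt (v t - v_plus)) / 2 * (3/2 * sin (lh t / 2) * Lh t / (1 - q t)\<^sup>2) 
        = sqrt (21/8 * ((v t + 1/2) * (v t - v_minus) / v t))"
    proof (rule real_sqrt_unique[symmetric])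
      have sq: "(sin (lh t / 2))\<^sup>2 = 1 - (q t)\<^sup>2" by (simp add: q_def sin_squared_eq)
      have "(inverse (sqrt (v t - v_plus)) / 2 * (3/2 * sin (lh t / 2) * Lh t / (1 - q t)\<^sup>2))\<^sup>2
        = (3/2 * sin (lh t / 2) * Lh t / (1 - q t)\<^sup>2)\<^sup>2 / (4 * (v t - v_plus))"
        using pos by (simp only: power_mult_distrib power_divide power_inverse) (simp add: divide_simps)
      also have "\<dots> = 21/8 * ((v t + 1/2) * (v t - v_minus) / v t)"
        unfolding flow_algebra[OF q(1,2,3) sq vq] using pos by simp
      finally show "(inverse (sqrt (v t - v_plus)) / 2 * (3/2 * sin (lh t / 2) * Lh t / (1 - q t)\<^sup>2))\<^sup>2
        = 21/8 * ((v t + 1/2) * (v t - v_minus) / v t)" .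
      have "0 < sin (lh t / 2)" using range[of t] by (intro sin_gt_zero) auto
      thus "0 \<le> inverse (sqrt (v t - v_plus)) / 2 * (3/2 * sin (lh t / 2) * Lh t / (1 - q t)\<^sup>2)"
        using Lpos[OF that] pos by simp
    qed
    finally show ?thesis .
  qed
  have "F T = F 0"
  proof (cases "T = 0")
    case False
    show ?thesis
    proof (rule DERIV_isconst_end[of 0 T F])
      show "0 < T" using T False by simp
      have "isCont (\<lambda>t. Pfun (of_real (x t))) t" for t
        by (rule isCont_o2[where f = "\<lambda>t. complex_of_real (x t)" and g = Pfun])
          (intro continuous_intros xcont isCont_Pfun[OF Sg])+
      hence "isCont F t" for t unfolding F_def by (intro continuous_intros isCont_Re)
      thus "continuous_on {0..T} F" by (intro continuous_at_imp_continuous_on) auto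
      fix t assume t: "0 < t" "t < T"
      define Y where "Y = 21/8 * ((v t + 1/2) * (v t - v_minus) / v t)"
      have x2: "(x t)\<^sup>2 + v_plus = v t" using vp[of t] by (simp add: x_def)
      have G: "Gfun (of_real (x t)) = of_real (1 / sqrt Y)" "0 < Y"
        using Gfun_real[of "x t"] vp[of t] unfolding x2 Y_def by (auto simp: x_def)
      have "((\<lambda>t. complex_of_real (x t)) has_vector_derivative of_real (sqrt Y)) (at t)"
        using xd[OF t(1)] unfolding Y_def[symmetric] by (rule has_vector_derivative_of_real)
      from field_vector_diff_chain_at[OF this Pfun_deriv[OF Sg]]
      have "((\<lambda>t. Pfun (of_real (x t))) has_vector_derivative (of_real (sqrt Y) * Gfun (of_real (x t)))) (at t)"
        by (simp only: o_def)
      also have "of_real (sqrt Y) * Gfun (of_real (x t)) = 1" unfolding G(1) using G(2) by simp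
      finally have "((\<lambda>t. Re (Pfun (of_real (x t)))) has_vector_derivative (Re 1)) (at t)"
        by (rule bounded_linear.has_vector_derivative[OF bounded_linear_Re])
      hence "((\<lambda>t. Re (Pfun (of_real (x t)))) has_real_derivative 1) (at t)"
        unfolding has_real_derivative_iff_has_vector_derivative by simp
      from DERIV_diff[OF this DERIV_ident] show "(F has_real_derivative 0) (at t)" unfolding F_def by simp
    qed
  qed simp
  moreover have "x 0 = 0" using zero[OF init] by (simp add: x_def vq v_plus_a_plus)
  hence "F 0 = 0" by (simp add: F_def Pfun_0)
  ultimately have "Re (Pfun (of_real (x T))) = T" by (simp add: F_def)
  moreover have "Im (Pfun (of_real (x T))) = 0" by (rule Im_Pfun_real[OF Sg])
  ultimately show "Pfun (of_real (sqrt (v T - v_plus))) = of_real T" by (simp add: x_def complex_eq_iff)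
qed

lemma Qfun_real:
  fixes lh Lh :: "real \<Rightarrow> real"
  assumes ode1: "\<And>t. (lh has_real_derivative (- 3 * Lh t)) (at t)"
    and ode2: "\<And>t. (Lh has_real_derivative (- deriv V_pend (lh t))) (at t)"
    and range: "\<And>t. 0 < lh t \<and> lh t < pi"
    and energy: "\<And>t. H_pend (lh t) (Lh t) = - 1/2"
    and init: "Lh 0 = 0"
  shows "Qfun (of_real t) = of_real (cos (lh t / 2))"
proof -
  define q where "q = cos (lh t / 2)"
  define v where "v = q / (1 - q)"
  define s where "s = (if 0 \<le> t then complex_of_real (sqrt (v - v_plus)) else - complex_of_real (sqrt (v - v_plus)))"
  have q1: "1 - q \<noteq> 0" using pend_energy(2)[of "lh t" "Lh t"] range energy by (simp add: q_def)
  have main: "v_plus \<le> v \<and> Pfun s = of_real t"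
  proof (cases "0 \<le> t")
    case True
    thus ?thesis using flow_half[OF ode1 ode2 range energy init True] by (simp add: s_def v_def q_def)
  next
    case False
    \<comment> \<open>The reversed orbit (lh (-t), -Lh (-t)) solves the same system with the same
      energy; the negative half is matched through oddness of P.\<close>
    have d1: "((\<lambda>t. lh (- t)) has_real_derivative (- 3 * (- Lh (- t)))) (at t)" for t
      using DERIV_chain2[where f = lh and g = uminus, OF ode1 DERIV_minus[OF DERIV_ident]] by simp
    have d2: "((\<lambda>t. - Lh (- t)) has_real_derivative (- deriv V_pend (lh (- t)))) (at t)" for t
      using DERIV_minus[OF DERIV_chain2[where f = Lh and g = uminus, OF ode2 DERIV_minus[OF DERIV_ident]]] by simp
    have en: "H_pend (lh (- t)) (- Lh (- t)) = - 1/2" for t using energy[of "- t"] by (simp add: H_pend_def)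
    have "0 \<le> - t" using False by simp
    note * = flow_half[OF d1 d2 range en _ this]
    have "v_plus \<le> v" using *(1) init by (simp add: v_def q_def)
    moreover have "Pfun (of_real (sqrt (v - v_plus))) = of_real (- t)" using *(2) init by (simp add: v_def q_def)
    moreover have "complex_of_real r \<in> Sig" for r using y_top_pos by (simp add: Sig_def)
    ultimately show ?thesis using False by (simp add: s_def Pfun_minus)
  qed
  have "s \<in> Uset" using y_top_pos by (intro Uset_strip) (simp add: s_def)
  hence "Qfun (Pfun s) = vmap s / (1 + vmap s)" by (rule Qfun_Pfun)
  moreover have "vmap s = of_real v"
  proof -
    have "s\<^sup>2 = of_real ((sqrt (v - v_plus))\<^sup>2)" by (simp add: s_def)
    also have "(sqrt (v - v_plus))\<^sup>2 = v - v_plus" using main by simp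
    finally show ?thesis by (simp add: vmap_def)
  qed

  ultimately have "Qfun (Pfun s) = of_real v / (1 + of_real v)" by simp
  also have "\<dots> = of_real (v / (1 + v))" by simp
  also have "v / (1 + v) = q" using q1 by (simp add: v_def field_simps)
  finally show ?thesis using main by (simp add: q_def)
qed

section \<open>Singularities on the boundary of the strip\<close>

text \<open>Apply \<open>top_param\<close> to the cube root p of i (t - iA): then P s = t and q =
  v/(1+v) with v close to p^2 / kap^2.\<close>

lemma Qfun_expansion:
  obtains \<nu> C where "0 < \<nu>" "0 \<le> C"
    "\<And>r th. \<lbrakk>0 < r; r < \<nu>; - 3 * pi / 2 < th; th < pi / 2\<rbrakk> \<Longrightarrow>
       \<i> * of_real A_top + of_real r * cis th \<in> Wset \<and>
       cmod (Qfun (\<i> * of_real A_top + of_real r * cis th)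
         - cis (pi / 3) / of_real (kap\<^sup>2) * of_real (r powr (2/3)) * cis (2 * th / 3)) \<le> C * r powr (4/3)"
proof -
  obtain e C where e: "0 < e" and C: "0 \<le> C" and par:
    "\<And>p. \<lbrakk>p \<noteq> 0; cmod p < e; cmod p / 2 \<le> Re p\<rbrakk> \<Longrightarrow>
       \<exists>s\<in>Sig. sgn (Re s) = sgn (Im p) \<and> Pfun s = \<i> * of_real A_top - \<i> * p ^ 3
         \<and> cmod (vmap s - p\<^sup>2 / of_real (kap\<^sup>2)) \<le> C * cmod p ^ 4"
    using top_param by blast
  \<comment> \<open>|v| <= D rho^2 for rho = |p|. The bound e' <= 1/(2 D) then keeps |v| <= 1/2, and
    replacing v/(1+v) by v costs at most 2 |v|^2 <= 2 D^2 rho^4.\<close>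
  define D where "D = 1 / kap\<^sup>2 + C"
  have D: "0 < D" using kap_pos C by (simp add: D_def add_pos_nonneg)
  define e' where "e' = min e (min 1 (1 / (2 * D)))"
  have e': "0 < e'" "e' \<le> e" "e' \<le> 1" "e' \<le> 1 / (2 * D)" using e D by (auto simp: e'_def)
  show ?thesis
  proof (rule that[of "e' ^ 3" "2 * D\<^sup>2 + C"])
    show "0 < e' ^ 3" "0 \<le> 2 * D\<^sup>2 + C" using e' C by auto
    fix r th :: real assume r: "0 < r" "r < e' ^ 3" and th: "- 3 * pi / 2 < th" "th < pi / 2"
    define \<rho> where "\<rho> = r powr (1/3)"
    define \<phi> where "\<phi> = (th + pi / 2) / 3"
    define p where "p = of_real \<rho> * cis \<phi>"
    have \<rho>: "0 < \<rho>" using r by (simp add: \<rho>_def)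
    have powk: "\<rho> ^ k = r powr (real k / 3)" for k
    proof -
      have "\<rho> ^ k = \<rho> powr real k" by (rule powr_realpow[OF \<rho>, symmetric])
      also have "\<dots> = r powr (real k / 3)" by (simp add: \<rho>_def powr_powr)
      finally show ?thesis .
    qed
    have \<rho>3: "\<rho> ^ 3 = r" using powk[of 3] r by simp
    have \<rho>e: "\<rho> < e'"
      by (rule power_less_imp_less_base[of _ 3]) (use \<rho>3 r(2) e'(1) in auto)
    have cp: "cmod p = \<rho>" using \<rho> by (simp add: p_def norm_mult)
    have p0: "p \<noteq> 0" using \<rho> cp by auto
    have phi: "- (pi / 3) < \<phi>" "\<phi> < pi / 3" using th by (auto simp: \<phi>_def field_simps)
    have "cos (pi / 3) \<le> cos \<phi>"
    proof -
      have "cos (pi / 3) \<le> cos \<bar>\<phi>\<bar>" using phi by (intro cos_monotone_0_pi_le) auto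
      thus ?thesis by simp
    qed
    hence "\<rho> * (1/2) \<le> \<rho> * cos \<phi>" using \<rho> by (intro mult_left_mono) (auto simp: cos_60)
    hence Rp: "cmod p / 2 \<le> Re p" unfolding cp by (simp add: p_def)
    obtain s where s: "s \<in> Sig" "sgn (Re s) = sgn (Im p)" "Pfun s = \<i> * of_real A_top - \<i> * p ^ 3"
      "cmod (vmap s - p\<^sup>2 / of_real (kap\<^sup>2)) \<le> C * cmod p ^ 4"
      using par[OF p0 _ Rp] cp \<rho>e e'(2) by force
    have "cis \<phi> ^ 3 = cis (real 3 * \<phi>)" by (rule Complex.DeMoivre)
    also have "real 3 * \<phi> = th + pi / 2" by (simp add: \<phi>_def)
    finally have p3: "p ^ 3 = of_real r * cis (th + pi / 2)"
      by (simp add: p_def power_mult_distrib \<rho>3[symmetric])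
    have "cis (th + pi / 2) = \<i> * cis th" by (simp add: cis_mult[symmetric])
    hence Ps: "Pfun s = \<i> * of_real A_top + of_real r * cis th" unfolding s(3) p3 by (simp add: complex_eq_iff)
    \<comment> \<open>Re (P s) = r cos th = r sin (3 phi) with 3 phi in (-pi, pi), so both signs are
      that of phi. This is membership in \<open>Uset\<close>.\<close>
    have "sgn (Im p) = sgn (Re (Pfun s))"
    proof -
      have sg: "sgn (sin x) = sgn x" if "- pi < x" "x < pi" for x :: real
        using that sin_gt_zero[of x] sin_gt_zero[of "- x"] by (cases "x = 0"; cases "0 < x") auto
      have "sgn (Im p) = sgn (sin \<phi>)" using \<rho> by (simp add: p_def sgn_mult)
      also have "\<dots> = sgn \<phi>" using phi pi_gt_zero by (intro sg) linarith+
      also have "\<dots> = sgn (th + pi / 2)" by (simp add: \<phi>_def sgn_if)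
      also have "\<dots> = sgn (sin (th + pi / 2))" using th by (intro sg[symmetric]) auto
      also have "\<dots> = sgn (Re (Pfun s))" unfolding Ps using r by (simp add: sin_add sgn_mult)
      finally show ?thesis .
    qed
    hence U: "s \<in> Uset" using s by (simp add: Uset_def)
    define v where "v = vmap s"
    define v0 where "v0 = p\<^sup>2 / of_real (kap\<^sup>2)"
    have vd: "cmod (v - v0) \<le> C * \<rho> ^ 4" using s(4) by (simp add: v_def v0_def cp)
    have "\<rho> ^ 4 \<le> \<rho>\<^sup>2" using \<rho> \<rho>e e'(3) by (intro power_decreasing) auto
    hence "C * \<rho> ^ 4 \<le> C * \<rho>\<^sup>2" using C by (rule mult_left_mono)
    moreover have "cmod v0 = \<rho>\<^sup>2 / kap\<^sup>2" by (simp add: v0_def norm_divide norm_power cp)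
    moreover have "cmod v \<le> cmod (v - v0) + cmod v0" using norm_triangle_ineq[of "v - v0" v0] by simp
    ultimately have vD: "cmod v \<le> D * \<rho>\<^sup>2" using vd by (simp add: D_def algebra_simps)
    have "\<rho>\<^sup>2 \<le> \<rho>" using \<rho> \<rho>e e'(3) by (simp add: power2_eq_square mult_left_le)
    hence "D * \<rho>\<^sup>2 \<le> D * (1 / (2 * D))" using D \<rho>e e'(4) by (intro mult_left_mono) auto
    hence vh: "cmod v \<le> 1/2" using vD D by simp
    have h: "1/2 \<le> cmod (1 + v)" using norm_triangle_ineq2[of 1 "- v"] vh by simp
    hence nz: "1 + v \<noteq> 0" by auto
    have "v / (1 + v) - v = - (v * v) / (1 + v)" using nz by (simp add: field_simps)
    hence "cmod (v / (1 + v) - v) = cmod v * cmod v / cmod (1 + v)" by (simp add: norm_divide norm_mult)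
    also have "\<dots> \<le> cmod v * cmod v / (1/2)" using h by (intro divide_left_mono) auto
    also have "\<dots> \<le> 2 * ((D * \<rho>\<^sup>2) * (D * \<rho>\<^sup>2))" using mult_mono[OF vD vD] D by simp
    also have "\<dots> = 2 * D\<^sup>2 * \<rho> ^ 4" by (simp add: power2_eq_square eval_nat_numeral)
    finally have "cmod (v / (1 + v) - v) \<le> 2 * D\<^sup>2 * \<rho> ^ 4" .
    hence "cmod (v / (1 + v) - v0) \<le> 2 * D\<^sup>2 * \<rho> ^ 4 + C * \<rho> ^ 4"
      using vd norm_triangle_ineq[of "v / (1 + v) - v" "v - v0"] by simp
    also have "\<dots> = (2 * D\<^sup>2 + C) * r powr (4/3)" using powk[of 4] by (simp add: algebra_simps)
    finally have fin: "cmod (v / (1 + v) - v0) \<le> (2 * D\<^sup>2 + C) * r powr (4/3)" .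
    have "p\<^sup>2 = of_real (\<rho>\<^sup>2) * cis (2 * \<phi>)" by (simp add: p_def power_mult_distrib Complex.DeMoivre)
    also have "\<rho>\<^sup>2 = r powr (2/3)" using powk[of 2] by simp
    also have "2 * \<phi> = pi / 3 + 2 * th / 3" by (simp add: \<phi>_def)
    also have "cis (pi / 3 + 2 * th / 3) = cis (pi / 3) * cis (2 * th / 3)" by (simp add: cis_mult)
    finally have "v0 = cis (pi / 3) / of_real (kap\<^sup>2) * of_real (r powr (2/3)) * cis (2 * th / 3)"
      by (simp add: v0_def mult_ac)
    moreover have "Qfun (Pfun s) = v / (1 + v)" unfolding v_def by (rule Qfun_Pfun[OF U])
    moreover have "Pfun s \<in> Wset" unfolding Wset_def using U by (rule imageI)
    ultimately show "\<i> * of_real A_top + of_real r * cis th \<in> Wset \<and>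
       cmod (Qfun (\<i> * of_real A_top + of_real r * cis th)
         - cis (pi / 3) / of_real (kap\<^sup>2) * of_real (r powr (2/3)) * cis (2 * th / 3)) \<le> (2 * D\<^sup>2 + C) * r powr (4/3)"
      using fin unfolding Ps by simp
  qed
qed

text \<open>Along z = w + tau^3 u the bound gives g(w) = 0. Differentiability at w then makes g(z)
  of order tau^3, so g(z)/tau^2 tends both to c and to 0.\<close>

lemma no_holomorphic_two_thirds:
  fixes g :: "complex \<Rightarrow> complex"
  assumes g: "g holomorphic_on ball w r" "0 < r" and u: "cmod u = 1" and d: "0 < d"
    and bd: "\<And>\<tau>. \<lbrakk>0 < \<tau>; \<tau> < d\<rbrakk> \<Longrightarrow> cmod (g (w + of_real (\<tau> ^ 3) * u) - c * of_real (\<tau>\<^sup>2)) \<le> C * \<tau> ^ 4"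
  shows "c = 0"
proof -
  have "g field_differentiable at w" using g by (intro holomorphic_on_imp_differentiable_at[OF g(1) open_ball]) auto
  then obtain g' where g': "(g has_field_derivative g') (at w)" unfolding field_differentiable_def by blast
  hence cg: "isCont g w" by (rule DERIV_isCont)
  define z where "z = (\<lambda>\<tau>::real. w + of_real (\<tau> ^ 3) * u)"
  have u0: "u \<noteq> 0" using u by auto
  have cz: "(z \<longlongrightarrow> w) (at_right 0)"
  proof -
    have "((\<lambda>\<tau>::real. w + of_real (\<tau> ^ 3) * u) \<longlongrightarrow> w + of_real (0 ^ 3) * u) (at_right 0)"
      by (intro tendsto_intros)
    thus ?thesis by (simp add: z_def)
  qed
  have gz: "((\<lambda>\<tau>. g (z \<tau>)) \<longlongrightarrow> g w) (at_right 0)" by (rule isCont_tendsto_compose[OF cg cz])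
  have evd: "\<forall>\<^sub>F \<tau> in at_right (0::real). 0 < \<tau> \<and> \<tau> < d"
    using d by (auto simp: eventually_at_right_field)
  have "((\<lambda>\<tau>. g (z \<tau>) - c * of_real (\<tau>\<^sup>2)) \<longlongrightarrow> 0) (at_right (0::real))"
  proof (rule Lim_null_comparison)
    show "\<forall>\<^sub>F \<tau> in at_right 0. cmod (g (z \<tau>) - c * of_real (\<tau>\<^sup>2)) \<le> C * \<tau> ^ 4"
      using evd by eventually_elim (use bd in \<open>simp add: z_def\<close>)
    have "((\<lambda>\<tau>::real. C * \<tau> ^ 4) \<longlongrightarrow> C * 0 ^ 4) (at_right 0)" by (intro tendsto_intros)
    thus "((\<lambda>\<tau>::real. C * \<tau> ^ 4) \<longlongrightarrow> 0) (at_right 0)" by simp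
  qed
  moreover have "((\<lambda>\<tau>. g (z \<tau>) - c * of_real (\<tau>\<^sup>2)) \<longlongrightarrow> g w - c * of_real (0\<^sup>2)) (at_right (0::real))"
    by (intro tendsto_intros gz)
  ultimately have "0 = g w - c * of_real (0\<^sup>2)" by (rule tendsto_unique[OF trivial_limit_at_right_real])
  hence gw: "g w = 0" by simp
  have "((\<lambda>x. (g x - g w) / (x - w)) \<longlongrightarrow> g') (at w)" using g' by (simp add: has_field_derivative_iff)
  moreover have "filterlim z (at w) (at_right 0)"
    unfolding filterlim_at using cz evd u0 by (auto simp: z_def elim!: eventually_mono)
  ultimately have q: "((\<lambda>\<tau>. (g (z \<tau>) - g w) / (z \<tau> - w)) \<longlongrightarrow> g') (at_right 0)"
    by (rule filterlim_compose)
  have "((\<lambda>\<tau>. (g (z \<tau>) - g w) / (z \<tau> - w) * (of_real \<tau> * u)) \<longlongrightarrow> g' * (of_real 0 * u)) (at_right (0::real))"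
    by (intro tendsto_intros q)
  hence q0: "((\<lambda>\<tau>. (g (z \<tau>) - g w) / (z \<tau> - w) * (of_real \<tau> * u)) \<longlongrightarrow> 0) (at_right (0::real))" by simp
  have "((\<lambda>\<tau>::real. (g (z \<tau>) - g w) / (z \<tau> - w) * (of_real \<tau> * u) - c) \<longlongrightarrow> 0) (at_right 0)"
  proof (rule Lim_null_comparison)
    show "\<forall>\<^sub>F \<tau> in at_right 0. cmod ((g (z \<tau>) - g w) / (z \<tau> - w) * (of_real \<tau> * u) - c) \<le> C * \<tau>\<^sup>2"
      using evd
    proof eventually_elim
      case (elim \<tau>)
      hence t: "0 < \<tau>" "\<tau> < d" by auto
      have "(g (z \<tau>) - g w) / (z \<tau> - w) * (of_real \<tau> * u) - c = (g (z \<tau>) - c * of_real (\<tau>\<^sup>2)) / of_real (\<tau>\<^sup>2)"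
        using t u0 by (simp add: gw z_def divide_simps power2_eq_square power3_eq_cube)
      hence "cmod ((g (z \<tau>) - g w) / (z \<tau> - w) * (of_real \<tau> * u) - c) = cmod (g (z \<tau>) - c * of_real (\<tau>\<^sup>2)) / \<tau>\<^sup>2"
        by (simp add: norm_divide norm_power)
      also have "\<dots> \<le> C * \<tau> ^ 4 / \<tau>\<^sup>2" using bd[OF t] by (intro divide_right_mono) (auto simp: z_def)
      also have "\<dots> = C * \<tau>\<^sup>2" using t by (simp add: eval_nat_numeral)
      finally show ?case .
    qed
    have "((\<lambda>\<tau>::real. C * \<tau>\<^sup>2) \<longlongrightarrow> C * 0\<^sup>2) (at_right 0)" by (intro tendsto_intros)
    thus "((\<lambda>\<tau>::real. C * \<tau>\<^sup>2) \<longlongrightarrow> 0) (at_right 0)" by simp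
  qed
  from tendsto_diff[OF q0 this] have "((\<lambda>\<tau>::real. c) \<longlongrightarrow> 0) (at_right 0)" by simp
  thus ?thesis using tendsto_unique[OF trivial_limit_at_right_real tendsto_const] by blast
qed

lemma strip_PiA_subset: "strip_PiA \<subseteq> Wset"
  using Wset_strip by (auto simp: strip_PiA_def A_width_eq)

text \<open>Approach the point along the imaginary axis from inside the strip. At the upper point th
  = -pi/2, whose factor cis(-pi/3) cancels cis(pi/3) and leaves the nonzero coefficient 1/kap^2; the
  lower point follows by conjugation.\<close>

lemma Qfun_not_extendable:
  assumes w: "w = \<i> * of_real A_width \<or> w = - \<i> * of_real A_width" and r: "0 < r"
    and g: "g holomorphic_on ball w r" and gQ: "\<And>z. z \<in> ball w r \<inter> strip_PiA \<Longrightarrow> g z = Qfun z"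
  shows False
proof -
  obtain \<nu> C where nu: "0 < \<nu>" "0 \<le> C" and ex:
    "\<And>r th. \<lbrakk>0 < r; r < \<nu>; - 3 * pi / 2 < th; th < pi / 2\<rbrakk> \<Longrightarrow>
       \<i> * of_real A_top + of_real r * cis th \<in> Wset \<and>
       cmod (Qfun (\<i> * of_real A_top + of_real r * cis th)
         - cis (pi / 3) / of_real (kap\<^sup>2) * of_real (r powr (2/3)) * cis (2 * th / 3)) \<le> C * r powr (4/3)"
    using Qfun_expansion by blast
  have down: "cmod (Qfun (\<i> * of_real (A_top - x)) - of_real (1 / kap\<^sup>2) * of_real (x powr (2/3))) \<le> C * x powr (4/3)"
    "\<i> * of_real (A_top - x) \<in> Wset" if "0 < x" "x < \<nu>" for x
  proof -
    have z: "\<i> * of_real A_top + of_real x * cis (- pi / 2) = \<i> * of_real (A_top - x)"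
      by (simp add: complex_eq_iff)
    have "cis (pi / 3) * cis (2 * (- pi / 2) / 3) = 1" by (simp add: cis_mult)
    hence c: "cis (pi / 3) / of_real (kap\<^sup>2) * of_real (x powr (2/3)) * cis (2 * (- pi / 2) / 3)
        = of_real (1 / kap\<^sup>2) * of_real (x powr (2/3))"
      by (simp add: divide_simps mult_ac)
    have "\<i> * of_real A_top + of_real x * cis (- pi / 2) \<in> Wset \<and>
       cmod (Qfun (\<i> * of_real A_top + of_real x * cis (- pi / 2))
         - cis (pi / 3) / of_real (kap\<^sup>2) * of_real (x powr (2/3)) * cis (2 * (- pi / 2) / 3)) \<le> C * x powr (4/3)"
      by (rule ex[OF that]) (use pi_gt_zero in auto)
    thus "cmod (Qfun (\<i> * of_real (A_top - x)) - of_real (1 / kap\<^sup>2) * of_real (x powr (2/3))) \<le> C * x powr (4/3)"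
      "\<i> * of_real (A_top - x) \<in> Wset" unfolding z c by auto
  qed
  define d where "d = min 1 (min \<nu> (min r A_top))"
  have d: "0 < d" "d \<le> 1" "d \<le> \<nu>" "d \<le> r" "d \<le> A_top" using nu r A_top_pos by (auto simp: d_def)
  define u where "u = (if w = \<i> * of_real A_width then - \<i> else \<i>)"
  have "complex_of_real (1 / kap\<^sup>2) = 0"
  proof (rule no_holomorphic_two_thirds[OF g r, of u d _ C])
    show "cmod u = 1" by (simp add: u_def)
    show "0 < d" by (rule d(1))
    fix \<tau> :: real assume t: "0 < \<tau>" "\<tau> < d"
    define x where "x = \<tau> ^ 3"
    have "\<tau> ^ 3 \<le> \<tau> ^ 1" using t d by (intro power_decreasing) auto
    hence x: "0 < x" "x < d" using t by (auto simp: x_def)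
    have xp: "x powr (real k / 3) = \<tau> ^ k" for k
    proof -
      have "x = \<tau> powr real 3" unfolding x_def by (rule powr_realpow[OF t(1), symmetric])
      hence "x powr (real k / 3) = \<tau> powr real k" by (simp add: powr_powr)
      also have "\<dots> = \<tau> ^ k" by (rule powr_realpow[OF t(1)])
      finally show ?thesis .
    qed
    have x2: "x powr (2/3) = \<tau>\<^sup>2" and x4: "x powr (4/3) = \<tau> ^ 4" using xp[of 2] xp[of 4] by simp_all
    have A: "cmod (Qfun (\<i> * of_real (A_top - x)) - of_real (1 / kap\<^sup>2) * of_real (\<tau>\<^sup>2)) \<le> C * \<tau> ^ 4"
      using down(1)[of x] x d unfolding x2 x4 by simp
    have B: "w + of_real (\<tau> ^ 3) * u \<in> ball w r \<inter> strip_PiA"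
    proof -
      have "dist w (w + of_real x * u) = x" using x by (simp add: dist_norm norm_mult u_def)
      moreover have "w + of_real x * u \<in> strip_PiA"
        using w x d A_top_pos by (auto simp: strip_PiA_def u_def A_width_eq)
      ultimately show ?thesis using x d by (simp add: x_def)
    qed
    show "cmod (g (w + of_real (\<tau> ^ 3) * u) - complex_of_real (1 / kap\<^sup>2) * of_real (\<tau>\<^sup>2)) \<le> C * \<tau> ^ 4"
    proof (cases "w = \<i> * of_real A_width")
      case True
      hence "w + of_real (\<tau> ^ 3) * u = \<i> * of_real (A_top - x)" by (simp add: u_def A_width_eq x_def algebra_simps)
      thus ?thesis using A gQ[OF B] by simp
    next
      case False
      hence e: "w + of_real (\<tau> ^ 3) * u = cnj (\<i> * of_real (A_top - x))"
        using w by (auto simp: u_def A_width_eq x_def algebra_simps)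
      have "Qfun (w + of_real (\<tau> ^ 3) * u) = cnj (Qfun (\<i> * of_real (A_top - x)))"
        unfolding e using down(2)[of x] x d by (intro Qfun_cnj(2)) auto
      hence "g (w + of_real (\<tau> ^ 3) * u) - complex_of_real (1 / kap\<^sup>2) * of_real (\<tau>\<^sup>2)
         = cnj (Qfun (\<i> * of_real (A_top - x)) - of_real (1 / kap\<^sup>2) * of_real (\<tau>\<^sup>2))"
        using gQ[OF B] by simp
      thus ?thesis using A by (metis complex_mod_cnj)
    qed
  qed
  thus False using kap_pos by simp
qed

text \<open>Such a w has nonzero real part, so it belongs to the open set \<open>Wset\<close> and
  \<open>Qfun\<close> is its own extension.\<close>

lemma Qfun_extends_at_boundary:
  assumes "\<bar>Im w\<bar> = A_width" "w \<noteq> \<i> * of_real A_width" "w \<noteq> - \<i> * of_real A_width"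
  shows "\<exists>r>0. Qfun holomorphic_on ball w r"
proof -
  have "Re w \<noteq> 0"
  proof
    assume "Re w = 0"
    moreover have "Im w = A_width \<or> Im w = - A_width" using assms(1) by linarith
    ultimately show False using assms(2,3) by (auto simp: complex_eq_iff)
  qed
  hence "w \<in> Wset" using assms(1) by (intro Wset_strip) (auto simp: A_width_eq)
  then obtain r where "r > 0" "ball w r \<subseteq> Wset" using open_Wset open_contains_ball by blast
  thus ?thesis using holomorphic_on_subset[OF holomorphic_Qfun] by blast
qed

theorem theorem3p1:
  fixes lh Lh :: "real \<Rightarrow> real"
  assumes ode1: "\<And>t. (lh has_real_derivative (- 3 * Lh t)) (at t)"
    and ode2: "\<And>t. (Lh has_real_derivative (- deriv V_pend (lh t))) (at t)"
    and range: "\<And>t. 0 < lh t \<and> lh t < pi"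
    and energy: "\<And>t. H_pend (lh t) (Lh t) = - 1/2"
    and homo_top: "(lh \<longlongrightarrow> 0) at_top" "(Lh \<longlongrightarrow> 0) at_top"
    and homo_bot: "(lh \<longlongrightarrow> 0) at_bot" "(Lh \<longlongrightarrow> 0) at_bot"
    and init: "Lh 0 = 0" "2 * pi / 3 < lh 0" "lh 0 < pi"
  shows
    "(\<forall>t. a_plus \<le> cos (lh t / 2) \<and> cos (lh t / 2) < 1)
     \<and> cos (lh 0 / 2) = a_plus
     \<and> (\<forall>t. \<exists>d. ((\<lambda>s. cos (lh s / 2)) has_real_derivative d) (at t) \<and>
           (let q = cos (lh t / 2) in
              d\<^sup>2 = 3 / q * (q - 1)\<^sup>2 * (q + 1) * (q - a_minus) * (q - a_plus)))
     \<and> (\<exists>Q. Q holomorphic_on strip_PiA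
          \<and> (\<forall>t::real. Q (complex_of_real t) = complex_of_real (cos (lh t / 2)))
          \<and> (\<forall>w. \<bar>Im w\<bar> = A_width \<and> w \<noteq> \<i> * complex_of_real A_width
                    \<and> w \<noteq> - \<i> * complex_of_real A_width \<longrightarrow>
               (\<exists>r>0. \<exists>g. g holomorphic_on ball w r \<and> (\<forall>z \<in> ball w r \<inter> strip_PiA. g z = Q z)))
          \<and> (\<forall>w \<in> {\<i> * complex_of_real A_width, - \<i> * complex_of_real A_width}.
               \<not> (\<exists>r>0. \<exists>g. g holomorphic_on ball w r \<and> (\<forall>z \<in> ball w r \<inter> strip_PiA. g z = Q z)))
          \<and> (\<exists>\<nu>>0. \<exists>\<alpha>p Qp Qm C.
                \<alpha>p ^ 3 = 1/2
              \<and> Qp holomorphic_on sector_disc (\<i> * complex_of_real A_width) \<nu> (- 3 * pi / 2) (pi / 2)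
              \<and> (\<forall>z \<in> sector_disc (\<i> * complex_of_real A_width) \<nu> (- 3 * pi / 2) (pi / 2) \<inter> strip_PiA.
                    Qp z = Q z)
              \<and> (\<forall>r th. 0 < r \<and> r < \<nu> \<and> - 3 * pi / 2 < th \<and> th < pi / 2 \<longrightarrow>
                    cmod (Qp (\<i> * complex_of_real A_width + complex_of_real r * cis th)
                          - (- (3 * \<alpha>p / 2) * complex_of_real (r powr (2/3)) * cis (2 * th / 3)))
                    \<le> C * r powr (4/3))
              \<and> Qm holomorphic_on sector_disc (- \<i> * complex_of_real A_width) \<nu> (- pi / 2) (3 * pi / 2)
              \<and> (\<forall>z \<in> sector_disc (- \<i> * complex_of_real A_width) \<nu> (- pi / 2) (3 * pi / 2) \<inter> strip_PiA.
                    Qm z = Q z)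
              \<and> (\<forall>r th. 0 < r \<and> r < \<nu> \<and> - pi / 2 < th \<and> th < 3 * pi / 2 \<longrightarrow>
                    cmod (Qm (- \<i> * complex_of_real A_width + complex_of_real r * cis th)
                          - (- (3 * cnj \<alpha>p / 2) * complex_of_real (r powr (2/3)) * cis (2 * th / 3)))
                    \<le> C * r powr (4/3))))"
proof -
  have q: "0 < cos (lh t / 2)" "cos (lh t / 2) < 1" "a_plus \<le> cos (lh t / 2)"
    "3 * cos (lh t / 2) * (Lh t)\<^sup>2 = 4 * (1 - cos (lh t / 2)) * (cos (lh t / 2) - a_plus) * (cos (lh t / 2) - a_minus)" for t
    using pend_energy[of "lh t" "Lh t"] range energy by auto
  have q0: "cos (lh 0 / 2) = a_plus"
    using q[of 0] init(1) a_minus_neg a_plus_bounds by auto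
  have qdot: "\<exists>d. ((\<lambda>s. cos (lh s / 2)) has_real_derivative d) (at t) \<and>
           (let q = cos (lh t / 2) in
              d\<^sup>2 = 3 / q * (q - 1)\<^sup>2 * (q + 1) * (q - a_minus) * (q - a_plus))" for t
  proof (intro exI conjI)
    show "((\<lambda>s. cos (lh s / 2)) has_real_derivative (3/2 * sin (lh t / 2) * Lh t)) (at t)"
      by (auto intro!: derivative_eq_intros ode1)
    define x where "x = cos (lh t / 2)"
    have x: "0 < x" "3 * x * (Lh t)\<^sup>2 = 4 * (1 - x) * (x - a_plus) * (x - a_minus)" using q[of t] by (auto simp: x_def)
    have "(3/2 * sin (lh t / 2) * Lh t)\<^sup>2 = 9/4 * (sin (lh t / 2))\<^sup>2 * (Lh t)\<^sup>2"
      by (simp add: power_mult_distrib power_divide)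
    also have "(sin (lh t / 2))\<^sup>2 = 1 - x\<^sup>2" by (simp add: x_def sin_squared_eq)
    also have "9/4 * (1 - x\<^sup>2) * (Lh t)\<^sup>2 = 3/4 * (1 - x\<^sup>2) * (3 * x * (Lh t)\<^sup>2) / x" using x(1) by simp
    also have "\<dots> = 3/4 * ((1 - x) * (1 + x)) * (4 * (1 - x) * (x - a_plus) * (x - a_minus)) / x"
      unfolding x(2) by (simp add: power2_eq_square algebra_simps)
    also have "\<dots> = 3 / x * (x - 1)\<^sup>2 * (x + 1) * (x - a_minus) * (x - a_plus)"
    proof -
      have "3/4 * (k * m) * (4 * k * a * b) / x = 3 / x * (k * k) * m * b * a" for k m a b by simp
      moreover have "(x - 1)\<^sup>2 = (1 - x) * (1 - x)" by (simp add: power2_eq_square algebra_simps)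
      ultimately show ?thesis by (simp only: add.commute[of 1 x])
    qed
    finally show "let q = cos (lh t / 2) in
              (3/2 * sin (lh t / 2) * Lh t)\<^sup>2 = 3 / q * (q - 1)\<^sup>2 * (q + 1) * (q - a_minus) * (q - a_plus)"
      by (simp only: Let_def x_def)
  qed
  obtain \<nu> C where nu: "0 < \<nu>" "0 \<le> C" and ex_top:
    "\<And>r th. \<lbrakk>0 < r; r < \<nu>; - 3 * pi / 2 < th; th < pi / 2\<rbrakk> \<Longrightarrow>
       \<i> * of_real A_top + of_real r * cis th \<in> Wset \<and>
       cmod (Qfun (\<i> * of_real A_top + of_real r * cis th)
         - cis (pi / 3) / of_real (kap\<^sup>2) * of_real (r powr (2/3)) * cis (2 * th / 3)) \<le> C * r powr (4/3)"
    using Qfun_expansion by blast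
  note ex = ex_top[folded A_width_eq]
  \<comment> \<open>Chosen so that -(3/2) \<alpha> is the leading coefficient of the expansion;
    cis(pi/3)^3 = -1 and kap^6 = 16/27 give the cube 1/2.\<close>
  define \<alpha> where "\<alpha> = - (2/3) * (cis (pi / 3) / of_real (kap\<^sup>2))"
  have \<alpha>: "- (3 * \<alpha> / 2) = cis (pi / 3) / of_real (kap\<^sup>2)" by (simp add: \<alpha>_def)
  have cn: "- \<i> * of_real A_width + of_real r * cis th = cnj (\<i> * of_real A_width + of_real r * cis (- th))" for r th
    by (simp add: cis_cnj)
  have cn\<alpha>: "- (3 * cnj \<alpha> / 2) = cnj (cis (pi / 3) / of_real (kap\<^sup>2))" by (simp add: \<alpha>_def)
  have \<alpha>3: "\<alpha> ^ 3 = 1/2"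
  proof -
    have "cis (pi / 3) ^ 3 = -1" by (simp add: Complex.DeMoivre)
    moreover have "complex_of_real (kap\<^sup>2) ^ 3 = of_real ((kap ^ 3)\<^sup>2)" by (simp flip: power_mult)
    moreover have "(kap ^ 3)\<^sup>2 = 16/27" unfolding kap_cube by (simp add: kap3_def power_divide power_mult_distrib)
    ultimately show ?thesis by (simp only: \<alpha>_def power_mult_distrib power_divide) (simp add: eval_nat_numeral)
  qed
  have secp: "sector_disc (\<i> * of_real A_width) \<nu> (- 3 * pi / 2) (pi / 2) \<subseteq> Wset"
    using ex by (auto simp: sector_disc_def)
  have secm: "sector_disc (- \<i> * of_real A_width) \<nu> (- pi / 2) (3 * pi / 2) \<subseteq> Wset"
  proof
    fix z assume "z \<in> sector_disc (- \<i> * of_real A_width) \<nu> (- pi / 2) (3 * pi / 2)"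
    then obtain r th where z: "z = - \<i> * of_real A_width + of_real r * cis th" "0 < r" "r < \<nu>" "- pi / 2 < th" "th < 3 * pi / 2"
      unfolding sector_disc_def by blast
    show "z \<in> Wset" unfolding z(1) cn by (rule Qfun_cnj(1)) (use ex[of r "- th"] z in auto)
  qed
  have bdm: "cmod (Qfun (- \<i> * of_real A_width + of_real r * cis th)
       - (- (3 * cnj \<alpha> / 2) * of_real (r powr (2/3)) * cis (2 * th / 3))) \<le> C * r powr (4/3)"
    if r: "0 < r" "r < \<nu>" "- pi / 2 < th" "th < 3 * pi / 2" for r th
  proof -
    have E: "\<i> * of_real A_width + of_real r * cis (- th) \<in> Wset \<and>
       cmod (Qfun (\<i> * of_real A_width + of_real r * cis (- th))
         - cis (pi / 3) / of_real (kap\<^sup>2) * of_real (r powr (2/3)) * cis (2 * (- th) / 3)) \<le> C * r powr (4/3)"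
      by (rule ex) (use r in auto)
    have "Qfun (- \<i> * of_real A_width + of_real r * cis th) - (- (3 * cnj \<alpha> / 2) * of_real (r powr (2/3)) * cis (2 * th / 3))
      = cnj (Qfun (\<i> * of_real A_width + of_real r * cis (- th)) - cis (pi / 3) / of_real (kap\<^sup>2) * of_real (r powr (2/3)) * cis (2 * (- th) / 3))"
      unfolding cn cn\<alpha> Qfun_cnj(2)[OF conjunct1[OF E]] by (simp add: cis_cnj)
    thus ?thesis using conjunct2[OF E] by (simp only: complex_mod_cnj)
  qed
  show ?thesis
  proof (intro conjI allI)
    show "a_plus \<le> cos (lh t / 2)" "cos (lh t / 2) < 1" for t using q by auto
    show "cos (lh 0 / 2) = a_plus" by (rule q0)
    show "\<exists>d. ((\<lambda>s. cos (lh s / 2)) has_real_derivative d) (at t) \<and>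
           (let q = cos (lh t / 2) in
              d\<^sup>2 = 3 / q * (q - 1)\<^sup>2 * (q + 1) * (q - a_minus) * (q - a_plus))" for t by (rule qdot)
  next
    show "\<exists>Q. Q holomorphic_on strip_PiA
          \<and> (\<forall>t::real. Q (complex_of_real t) = complex_of_real (cos (lh t / 2)))
          \<and> (\<forall>w. \<bar>Im w\<bar> = A_width \<and> w \<noteq> \<i> * complex_of_real A_width
                    \<and> w \<noteq> - \<i> * complex_of_real A_width \<longrightarrow>
               (\<exists>r>0. \<exists>g. g holomorphic_on ball w r \<and> (\<forall>z \<in> ball w r \<inter> strip_PiA. g z = Q z)))
          \<and> (\<forall>w \<in> {\<i> * complex_of_real A_width, - \<i> * complex_of_real A_width}.
               \<not> (\<exists>r>0. \<exists>g. g holomorphic_on ball w r \<and> (\<forall>z \<in> ball w r \<inter> strip_PiA. g z = Q z)))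
          \<and> (\<exists>\<nu>>0. \<exists>\<alpha>p Qp Qm C.
                \<alpha>p ^ 3 = 1/2
              \<and> Qp holomorphic_on sector_disc (\<i> * complex_of_real A_width) \<nu> (- 3 * pi / 2) (pi / 2)
              \<and> (\<forall>z \<in> sector_disc (\<i> * complex_of_real A_width) \<nu> (- 3 * pi / 2) (pi / 2) \<inter> strip_PiA.
                    Qp z = Q z)
              \<and> (\<forall>r th. 0 < r \<and> r < \<nu> \<and> - 3 * pi / 2 < th \<and> th < pi / 2 \<longrightarrow>
                    cmod (Qp (\<i> * complex_of_real A_width + complex_of_real r * cis th)
                          - (- (3 * \<alpha>p / 2) * complex_of_real (r powr (2/3)) * cis (2 * th / 3)))
                    \<le> C * r powr (4/3))
              \<and> Qm holomorphic_on sector_disc (- \<i> * complex_of_real A_width) \<nu> (- pi / 2) (3 * pi / 2)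
              \<and> (\<forall>z \<in> sector_disc (- \<i> * complex_of_real A_width) \<nu> (- pi / 2) (3 * pi / 2) \<inter> strip_PiA.
                    Qm z = Q z)
              \<and> (\<forall>r th. 0 < r \<and> r < \<nu> \<and> - pi / 2 < th \<and> th < 3 * pi / 2 \<longrightarrow>
                    cmod (Qm (- \<i> * complex_of_real A_width + complex_of_real r * cis th)
                          - (- (3 * cnj \<alpha>p / 2) * complex_of_real (r powr (2/3)) * cis (2 * th / 3)))
                    \<le> C * r powr (4/3)))"
    proof (rule exI[of _ Qfun], intro conjI)
      show "Qfun holomorphic_on strip_PiA" by (rule holomorphic_on_subset[OF holomorphic_Qfun strip_PiA_subset])
      show "\<forall>t::real. Qfun (complex_of_real t) = complex_of_real (cos (lh t / 2))"
        using Qfun_real[OF ode1 ode2 range energy init(1)] by blast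
      show "\<forall>w. \<bar>Im w\<bar> = A_width \<and> w \<noteq> \<i> * complex_of_real A_width
                    \<and> w \<noteq> - \<i> * complex_of_real A_width \<longrightarrow>
               (\<exists>r>0. \<exists>g. g holomorphic_on ball w r \<and> (\<forall>z \<in> ball w r \<inter> strip_PiA. g z = Qfun z))"
        using Qfun_extends_at_boundary by blast
      show "\<forall>w \<in> {\<i> * complex_of_real A_width, - \<i> * complex_of_real A_width}.
               \<not> (\<exists>r>0. \<exists>g. g holomorphic_on ball w r \<and> (\<forall>z \<in> ball w r \<inter> strip_PiA. g z = Qfun z))"
        using Qfun_not_extendable by blast
    next
      show "\<exists>\<nu>>0. \<exists>\<alpha>p Qp Qm C.
                \<alpha>p ^ 3 = 1/2
              \<and> Qp holomorphic_on sector_disc (\<i> * complex_of_real A_width) \<nu> (- 3 * pi / 2) (pi / 2)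
              \<and> (\<forall>z \<in> sector_disc (\<i> * complex_of_real A_width) \<nu> (- 3 * pi / 2) (pi / 2) \<inter> strip_PiA.
                    Qp z = Qfun z)
              \<and> (\<forall>r th. 0 < r \<and> r < \<nu> \<and> - 3 * pi / 2 < th \<and> th < pi / 2 \<longrightarrow>
                    cmod (Qp (\<i> * complex_of_real A_width + complex_of_real r * cis th)
                          - (- (3 * \<alpha>p / 2) * complex_of_real (r powr (2/3)) * cis (2 * th / 3)))
                    \<le> C * r powr (4/3))
              \<and> Qm holomorphic_on sector_disc (- \<i> * complex_of_real A_width) \<nu> (- pi / 2) (3 * pi / 2)
              \<and> (\<forall>z \<in> sector_disc (- \<i> * complex_of_real A_width) \<nu> (- pi / 2) (3 * pi / 2) \<inter> strip_PiA.
                    Qm z = Qfun z)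
              \<and> (\<forall>r th. 0 < r \<and> r < \<nu> \<and> - pi / 2 < th \<and> th < 3 * pi / 2 \<longrightarrow>
                    cmod (Qm (- \<i> * complex_of_real A_width + complex_of_real r * cis th)
                          - (- (3 * cnj \<alpha>p / 2) * complex_of_real (r powr (2/3)) * cis (2 * th / 3)))
                    \<le> C * r powr (4/3))"
      \<comment> \<open>Both slit discs lie in \<open>Wset\<close>, so \<open>Qfun\<close> itself
        serves as the two branches and agreement on the overlaps is reflexivity; conjugation lets
        the lower expansion share \<nu> and C.\<close>
      proof (rule exI[of _ \<nu>], rule conjI[OF nu(1)], rule exI[of _ \<alpha>], rule exI[of _ Qfun], rule exI[of _ Qfun],
          rule exI[of _ C], intro conjI ballI allI impI)
        show "\<alpha> ^ 3 = 1/2" by (rule \<alpha>3)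
        show "Qfun holomorphic_on sector_disc (\<i> * complex_of_real A_width) \<nu> (- 3 * pi / 2) (pi / 2)"
          by (rule holomorphic_on_subset[OF holomorphic_Qfun secp])
        show "Qfun holomorphic_on sector_disc (- \<i> * complex_of_real A_width) \<nu> (- pi / 2) (3 * pi / 2)"
          by (rule holomorphic_on_subset[OF holomorphic_Qfun secm])
        show "cmod (Qfun (\<i> * complex_of_real A_width + complex_of_real r * cis th)
                          - (- (3 * \<alpha> / 2) * complex_of_real (r powr (2/3)) * cis (2 * th / 3)))
                    \<le> C * r powr (4/3)" if "0 < r \<and> r < \<nu> \<and> - 3 * pi / 2 < th \<and> th < pi / 2" for r th
          unfolding \<alpha> using ex[of r th] that by blast
        show "cmod (Qfun (- \<i> * complex_of_real A_width + complex_of_real r * cis th)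
                          - (- (3 * cnj \<alpha> / 2) * complex_of_real (r powr (2/3)) * cis (2 * th / 3)))
                    \<le> C * r powr (4/3)" if "0 < r \<and> r < \<nu> \<and> - pi / 2 < th \<and> th < 3 * pi / 2" for r th
          using bdm[of r th] that by blast
      qed (rule refl)+
    qed
  qed
qed

end
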